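(* For every positive integer $n$, \[ W_{11}(n)=\frac{5}{1464}\sigma_3(n)+\frac{605}{1464}\sigma_3\left(\frac{n}{11}\right)-\frac{1}{44}n\sigma_1(n)-\frac{1}{4}n\sigma_1\left(\frac{n}{11}\right)+\frac{1}{24}\sigma_1(n)+\frac{1}{24}\sigma_1\left(\frac{n}{11}\right)-\frac{2t+43}{4026}\tau_{4,11,1}(n)+\frac{2t-47}{4026}\tau_{4,11,2}(n). \]
   Context: For positive integers $j,n$ let $\sigma_j(n)=\sum_{d\mid n}d^j$; set $\sigma_j(x)=0$ for $x\notin\mathbb{N}^*$. For $N\in\mathbb{N}^*$ let $W_N(n)=\sum_{m}\sigma_1(m)\sigma_1(n-Nm)$, summed over positive integers $m<n/N$. Write $q=e^{2\pi iz}$. Fix a root $t$ of $X^2-2X-2$. There are exactly two primitive forms (normalized newforms, i.e. Hecke eigenforms with first Fourier coefficient $1$) of weight $4$ on $\Gamma_0(11)$, with coefficients in $\mathbb{Q}(t)$; let $\Delta_{4,11,1}=q+(2-t)q^2+O(q^3)$ and $\Delta_{4,11,2}=q+tq^2+O(q^3)$ be these two forms, and write $\Delta_{4,11,i}=\sum_{n\ge1}\tau_{4,11,i}(n)q^n$. *)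

theory Defs
  imports "HOL-Complex_Analysis.Complex_Analysis"
begin

definition divisor_sigma :: "nat \<Rightarrow> nat \<Rightarrow> nat" where
  "divisor_sigma j n = (\<Sum>d | d dvd n. d ^ j)"

(* Extension by zero to arguments that are not positive integers. *)
definition divisor_sigma_ext :: "nat \<Rightarrow> rat \<Rightarrow> nat" where
  "divisor_sigma_ext j x = (if x \<in> \<nat> - {0} then divisor_sigma j (nat \<lfloor>x\<rfloor>) else 0)"

definition conv_W :: "nat \<Rightarrow> nat \<Rightarrow> nat" where
  "conv_W N n = (\<Sum>m | 0 < m \<and> N * m < n. divisor_sigma 1 m * divisor_sigma 1 (n - N * m))"

definition upper_half_plane :: "complex set" where
  "upper_half_plane = {z. Im z > 0}"

definition SL2Z :: "(int ^ 2 ^ 2) set" where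
  "SL2Z = {A. det A = 1}"

definition Gamma0 :: "nat \<Rightarrow> (int ^ 2 ^ 2) set" where
  "Gamma0 N = {A \<in> SL2Z. int N dvd A $ 2 $ 1}"

definition automorphy_factor :: "int ^ 2 ^ 2 \<Rightarrow> complex \<Rightarrow> complex" where
  "automorphy_factor A z = of_int (A $ 2 $ 1) * z + of_int (A $ 2 $ 2)"

definition moebius_action :: "int ^ 2 ^ 2 \<Rightarrow> complex \<Rightarrow> complex" where
  "moebius_action A z = (of_int (A $ 1 $ 1) * z + of_int (A $ 1 $ 2)) / automorphy_factor A z"

definition slash :: "nat \<Rightarrow> int ^ 2 ^ 2 \<Rightarrow> (complex \<Rightarrow> complex) \<Rightarrow> complex \<Rightarrow> complex" where
  "slash k A f z = f (moebius_action A z) / automorphy_factor A z ^ k"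

(* Every cusp is the image of infinity under some element of SL2Z, so the last condition says
   that f vanishes at all cusps. Values outside the upper half-plane are irrelevant. *)
definition cusp_form :: "nat \<Rightarrow> nat \<Rightarrow> (complex \<Rightarrow> complex) \<Rightarrow> bool" where
  "cusp_form k N f \<longleftrightarrow>
     f holomorphic_on upper_half_plane \<and>
     (\<forall>A\<in>Gamma0 N. \<forall>z\<in>upper_half_plane. slash k A f z = f z) \<and>
     (\<forall>A\<in>SL2Z. (slash k A f \<longlongrightarrow> 0) (filtercomap Im at_top))"

definition fourier_expansion :: "(complex \<Rightarrow> complex) \<Rightarrow> (nat \<Rightarrow> complex) \<Rightarrow> bool" where
  "fourier_expansion f a \<longleftrightarrow>
     (\<forall>z\<in>upper_half_plane. (\<lambda>n. a n * exp (2 * of_real pi * \<i> * z) ^ n) sums f z)"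

(* T_m on weight k and level N with trivial character:
   T_m f (z) = m^(k-1) * sum of d^(-k) * f ((a z + b) / d) over ad = m, gcd(a, N) = 1, 0 <= b < d.
   For primes m dividing N this is the operator U_m. *)
definition hecke_operator ::
    "nat \<Rightarrow> nat \<Rightarrow> nat \<Rightarrow> (complex \<Rightarrow> complex) \<Rightarrow> complex \<Rightarrow> complex" where
  "hecke_operator k N m f z =
     of_nat m powi (int k - 1) *
     (\<Sum>d | d dvd m \<and> coprime (m div d) N.
        \<Sum>b<d. f ((of_nat (m div d) * z + of_nat b) / of_nat d) / of_nat d ^ k)"

definition hecke_eigenform :: "nat \<Rightarrow> nat \<Rightarrow> (complex \<Rightarrow> complex) \<Rightarrow> bool" where
  "hecke_eigenform k N f \<longleftrightarrow>
     (\<exists>z\<in>upper_half_plane. f z \<noteq> 0) \<and>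
     (\<forall>m>0. \<exists>c. \<forall>z\<in>upper_half_plane. hecke_operator k N m f z = c * f z)"

definition fundamental_domain :: "complex set" where
  "fundamental_domain = {z \<in> upper_half_plane. \<bar>Re z\<bar> \<le> 1 / 2 \<and> norm z \<ge> 1}"

definition Gamma0_cosets :: "nat \<Rightarrow> (int ^ 2 ^ 2) set set" where
  "Gamma0_cosets N = (\<lambda>A. (\<lambda>B. B ** A) ` Gamma0 N) ` SL2Z"

(* The unnormalized Petersson product: the integral of f * cnj g * y^k against dx dy / y^2 over
   Gamma0 N \ H, whose fundamental domain is the union of the translates of the one of SL2Z by
   representatives of the cosets Gamma0 N * A. The choice of representatives is immaterial for
   forms of weight k on Gamma0 N. *)
definition petersson ::
    "nat \<Rightarrow> nat \<Rightarrow> (complex \<Rightarrow> complex) \<Rightarrow> (complex \<Rightarrow> complex) \<Rightarrow> complex" where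
  "petersson k N f g =
     (\<Sum>C\<in>Gamma0_cosets N.
        let A = (SOME A. A \<in> C) in
        LINT z:fundamental_domain|lborel.
          slash k A f z * cnj (slash k A g z) * of_real (Im z ^ k / (Im z)\<^sup>2))"

(* The old subspace of level N is spanned by the forms g (d z) below; being in the new subspace
   means being orthogonal to all of them. *)
definition in_new_subspace :: "nat \<Rightarrow> nat \<Rightarrow> (complex \<Rightarrow> complex) \<Rightarrow> bool" where
  "in_new_subspace k N f \<longleftrightarrow>
     cusp_form k N f \<and>
     (\<forall>M d g. M dvd N \<and> M \<noteq> N \<and> d dvd N div M \<and> cusp_form k M g \<longrightarrow>
        petersson k N f (\<lambda>z. g (of_nat d * z)) = 0)"

definition primitive_form :: "nat \<Rightarrow> nat \<Rightarrow> (complex \<Rightarrow> complex) \<Rightarrow> bool" where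
  "primitive_form k N f \<longleftrightarrow>
     in_new_subspace k N f \<and> hecke_eigenform k N f \<and>
     (\<exists>a. fourier_expansion f a \<and> a 1 = 1)"

end

theory Submission
  imports Defs
begin

text \<open>
  Write \<open>E\<^sub>2\<close>, \<open>E\<^sub>4\<close> for the normalized Eisenstein series and put
  \<open>L = (11 E\<^sub>2(11z) - E\<^sub>2(z)) / 10\<close>. The form
  \<open>C = L\<^sup>2 - E\<^sub>4(z) / 122 - 121 E\<^sub>4(11z) / 122\<close> is a cusp form of weight 4 on the group of level
  11, and since \<open>E\<^sub>2\<^sup>2 = E\<^sub>4 + 12 q dE\<^sub>2/dq\<close> (Liouville's evaluation of the convolution of
  \<open>\<sigma>\<^sub>1\<close> with itself), the product \<open>E\<^sub>2(z) E\<^sub>2(11z)\<close> that generates the convolution sum is a combination of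
  \<open>C\<close>, \<open>E\<^sub>4(z)\<close>, \<open>E\<^sub>4(11z)\<close> and the derivatives of \<open>E\<^sub>2(z)\<close>, \<open>E\<^sub>2(11z)\<close>.

  It remains to identify \<open>C\<close> with the stated combination of the two primitive forms. Their
  coefficients of index 1 and 2 are given, and the Hecke operator at 2 determines that of index 4, so
  the difference \<open>f\<close> is a cusp form whose coefficients of index 1, 2 and 4 vanish. Then
  \<open>f\<^sup>6\<^sup>0 / (\<Delta>(z)\<^sup>4 \<Delta>(11z)\<^sup>1\<^sup>6)\<close> is invariant and finite at both cusps, hence constant, which forces
  \<open>5 a\<^sub>4 = - 8 a\<^sub>3\<close> for the coefficients of \<open>f\<close>; so \<open>a\<^sub>3 = 0\<close>, the constant is 0, and \<open>f = 0\<close>.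

  Everything rests on the transformation of \<open>E\<^sub>2\<close> under \<open>z \<mapsto> - 1 / z\<close>, obtained from Eisenstein's
  double series; that of \<open>\<Delta>\<close> follows by integration and that of \<open>E\<^sub>4\<close> by differentiation.
\<close>

section \<open>The convolution of the divisor sum with itself\<close>

text \<open>Only two coefficients of each form are given and the space of cusp forms is not
  described, so a difference \<open>f\<close> has to be shown to vanish from very few coefficients.
  Weight 4 and index 12 allow 4 zeros in all, cusps included; order 3 at infinity and order 1 at 0
  use them up. Such an \<open>f\<close> would be a multiple of the fractional product
  \<eta>(z)^(8/5) \<eta>(11 z)^(32/5) = q^3 (1 - (8/5) q + ...), and the exponent 60 turns it into
  integral powers of the discriminant. The ratio a_4 : a_3 = - 8 : 5 is what lets index 4 stand in
  for index 3: the data do not give the Hecke eigenvalue at 3, while the one at 2 yields a_4 = a_2^2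
  - 8. The weights 1/122 and 121/122 are forced by the cusps: L^2 tends to 1 at infinity and to
  1/121 at 0, where the two Eisenstein series of weight 4 tend to 1, 1 and to 1, 1/11^4
  respectively.\<close>

definition quads :: "nat \<Rightarrow> (nat \<times> nat \<times> nat \<times> nat) set" where
  "quads n = {(a, b, x, y). a > 0 \<and> b > 0 \<and> x > 0 \<and> y > 0 \<and> a * x + b * y = n}"

lemma finite_quads [simp, intro]: "finite (quads n)"
proof (rule finite_subset)
  show "quads n \<subseteq> {..n} \<times> {..n} \<times> {..n} \<times> {..n}"
  proof
    fix s assume "s \<in> quads n"
    then obtain a b x y where s: "s = (a, b, x, y)" "a > 0" "b > 0" "x > 0" "y > 0" "a * x + b * y = n"
      by (auto simp: quads_def)
    have "a \<le> a * x" "x \<le> a * x" "b \<le> b * y" "y \<le> b * y" using s by auto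
    then have "a \<le> n" "x \<le> n" "b \<le> n" "y \<le> n" using s(6) by linarith+
    then show "s \<in> {..n} \<times> {..n} \<times> {..n} \<times> {..n}" using s by auto
  qed
qed auto

text \<open>A divisor a of m and a divisor b of n - m are recorded with their cofactors, so that m =
  a x and n - m = b y; the four factors then enter symmetrically.\<close>

lemma conv_W_1_quads: "conv_W 1 n = (\<Sum>(a, b, x, y)\<in>quads n. a * b)"
proof -
  have "conv_W 1 n = (\<Sum>m | 0 < m \<and> m < n. \<Sum>(a, b)\<in>{a. a dvd m} \<times> {b. b dvd n - m}. a * b)"
    by (simp add: conv_W_def divisor_sigma_def sum_product sum.cartesian_product)
  also have "\<dots> = (\<Sum>(m, a, b)\<in>(SIGMA m:{m. 0 < m \<and> m < n}. {a. a dvd m} \<times> {b. b dvd n - m}). a * b)"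
    by (subst sum.Sigma) (auto simp: case_prod_unfold)
  also have "\<dots> = (\<Sum>(a, b, x, y)\<in>quads n. a * b)"
    by (rule sum.reindex_bij_witness[where
          j = "\<lambda>(m, a, b). (a, b, m div a, (n - m) div b)" and i = "\<lambda>(a, b, x, y). (a * x, a, b)"])
       (auto simp: quads_def dvd_div_eq_0_iff intro!: Nat.gr0I)
  finally show ?thesis .
qed

lemma quads_swap:
  "(\<Sum>(a, b, x, y)\<in>quads n. f a b x y) = (\<Sum>(a, b, x, y)\<in>quads n. f b a y x)"
  by (rule sum.reindex_bij_witness[where
        j = "\<lambda>(a, b, x, y). (b, a, y, x)" and i = "\<lambda>(a, b, x, y). (b, a, y, x)"])
     (auto simp: quads_def)

lemma quads_transpose:
  "(\<Sum>(a, b, x, y)\<in>quads n. f a b x y) = (\<Sum>(a, b, x, y)\<in>quads n. f a y x b)"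
  by (rule sum.reindex_bij_witness[where
        j = "\<lambda>(a, b, x, y). (a, y, x, b)" and i = "\<lambda>(a, b, x, y). (a, y, x, b)"])
     (auto simp: quads_def mult.commute)

text \<open>The substitution (a, b, x, y) -> (a + b, b, x, y - x) preserves a x + b y. It needs x <
  y to keep y - x positive, and its image is cut out by b < a.\<close>

lemma quads_shear:
  fixes f :: "nat \<Rightarrow> nat \<Rightarrow> nat \<Rightarrow> nat \<Rightarrow> int"
  shows "(\<Sum>(a, b, x, y)\<in>quads n. if x < y then f (a + b) b x (y - x) else 0)
       = (\<Sum>(a, b, x, y)\<in>quads n. if b < a then f a b x y else 0)"
proof -
  have "(\<Sum>(a, b, x, y)\<in>{s\<in>quads n. case s of (a, b, x, y) \<Rightarrow> x < y}. f (a + b) b x (y - x))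
      = (\<Sum>(a, b, x, y)\<in>{s\<in>quads n. case s of (a, b, x, y) \<Rightarrow> b < a}. f a b x y)"
    by (rule sum.reindex_bij_witness[where
        j = "\<lambda>(a, b, x, y). (a + b, b, x, y - x)" and i = "\<lambda>(a, b, x, y). (a - b, b, x, x + y)"])
      (auto simp: quads_def algebra_simps diff_mult_distrib diff_mult_distrib2
        intro!: le_add_diff_inverse trans_le_add1)
  then show ?thesis
    by (simp add: sum.inter_filter[symmetric] case_prod_unfold)
qed

text \<open>For fixed \<open>a\<close> and \<open>b\<close> the solutions form an arithmetic progression with step \<open>(b, - a)\<close>;
  both sides count its end points.\<close>

lemma quads_slide:
  fixes f :: "nat \<Rightarrow> nat \<Rightarrow> int"
  shows "(\<Sum>(a, b, x, y)\<in>quads n. if x \<le> b then f a b else 0)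
       = (\<Sum>(a, b, x, y)\<in>quads n. if y \<le> a then f a b else 0)"
proof -
  \<comment> \<open>Dividing y - 1 instead of y puts the remainder plus one into 1..a, so the new y
    stays positive; the quotient is moved to x.\<close>
  have slide: "a * (x + b * ((y - 1) div a)) + b * ((y - 1) mod a + 1) = a * x + b * y"
    if "y > 0" for a b x y :: nat
  proof -
    define k r where "k = (y - 1) div a" and "r = (y - 1) mod a"
    have "y - 1 = a * k + r" unfolding k_def r_def by simp
    with that have "y = a * k + r + 1" by linarith
    then have "a * (x + b * k) + b * (r + 1) = a * x + b * y"
      by (simp add: algebra_simps)
    then show ?thesis unfolding k_def r_def .
  qed
  have wrap: "(x + b * k - 1) mod b + 1 = x" "(x + b * k - 1) div b = k"
    if x: "0 < x" "x \<le> b" for x b k :: nat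
  proof -
    obtain m where "x = Suc m" "m < b" using x by (cases x) auto
    then show "(x + b * k - 1) mod b + 1 = x" "(x + b * k - 1) div b = k"
      by simp_all
  qed
  have recon: "(y - Suc 0) mod a + 1 + a * ((y - Suc 0) div a) = y" if "y > 0" for a y :: nat
    using that by simp
  have "(\<Sum>(a, b, x, y)\<in>{s\<in>quads n. case s of (a, b, x, y) \<Rightarrow> x \<le> b}. f a b)
      = (\<Sum>(a, b, x, y)\<in>{s\<in>quads n. case s of (a, b, x, y) \<Rightarrow> y \<le> a}. f a b)"
  proof (rule sum.reindex_bij_witness[where
        j = "\<lambda>(a, b, x, y). (a, b, x + b * ((y - 1) div a), (y - 1) mod a + 1)" and
        i = "\<lambda>(a, b, x, y). (a, b, (x - 1) mod b + 1, y + a * ((x - 1) div b))"])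
    fix s assume s: "s \<in> {s\<in>quads n. case s of (a, b, x, y) \<Rightarrow> x \<le> b}"
    obtain a b x y where e: "s = (a, b, x, y)" by (cases s)
    show "(case case s of (a, b, x, y) \<Rightarrow> (a, b, x + b * ((y - 1) div a), (y - 1) mod a + 1) of
        (a, b, x, y) \<Rightarrow> (a, b, (x - 1) mod b + 1, y + a * ((x - 1) div b))) = s"
      using s wrap[of x b] recon[of y a] by (auto simp: e quads_def)
    show "(case s of (a, b, x, y) \<Rightarrow> (a, b, x + b * ((y - 1) div a), (y - 1) mod a + 1))
        \<in> {s\<in>quads n. case s of (a, b, x, y) \<Rightarrow> y \<le> a}"
      using s slide[of y a x b] by (auto simp: e quads_def Suc_le_eq add.commute)
    show "(case case s of (a, b, x, y) \<Rightarrow> (a, b, x + b * ((y - 1) div a), (y - 1) mod a + 1) of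
        (a, b, x, y) \<Rightarrow> f a b) = (case s of (a, b, x, y) \<Rightarrow> f a b)"
      by (simp add: e)
  next
    fix s assume s: "s \<in> {s\<in>quads n. case s of (a, b, x, y) \<Rightarrow> y \<le> a}"
    obtain a b x y where e: "s = (a, b, x, y)" by (cases s)
    show "(case case s of (a, b, x, y) \<Rightarrow> (a, b, (x - 1) mod b + 1, y + a * ((x - 1) div b)) of
        (a, b, x, y) \<Rightarrow> (a, b, x + b * ((y - 1) div a), (y - 1) mod a + 1)) = s"
      using s wrap[of y a] recon[of x b] by (auto simp: e quads_def)
    show "(case s of (a, b, x, y) \<Rightarrow> (a, b, (x - 1) mod b + 1, y + a * ((x - 1) div b)))
        \<in> {s\<in>quads n. case s of (a, b, x, y) \<Rightarrow> x \<le> b}"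
      using s slide[of x b y a] by (auto simp: e quads_def Suc_le_eq add.commute)
  qed
  then show ?thesis
    by (simp add: sum.inter_filter[symmetric] case_prod_unfold)
qed

text \<open>On x = y the equation reads (a + b) x = n, so d = a + b is a divisor of n and a is free
  below d.\<close>

lemma quads_diagonal_xy:
  fixes f :: "nat \<Rightarrow> nat \<Rightarrow> int"
  assumes "n > 0"
  shows "(\<Sum>(a, b, x, y)\<in>quads n. if x = y then f a (a + b) else 0)
       = (\<Sum>d | d dvd n. \<Sum>a\<in>{1..<d}. f a d)"
proof -
  have fin: "finite {d. d dvd n}" using assms by simp
  have "(\<Sum>(a, b, x, y)\<in>{s\<in>quads n. case s of (a, b, x, y) \<Rightarrow> x = y}. f a (a + b))
      = (\<Sum>(d, a)\<in>(SIGMA d:{d. d dvd n}. {1..<d}). f a d)"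
    by (rule sum.reindex_bij_witness[where
        j = "\<lambda>(a, b, x, y). (a + b, a)" and i = "\<lambda>(d, a). (a, d - a, n div d, n div d)"])
      (use assms in \<open>auto simp: quads_def add_mult_distrib[symmetric] dvd_div_eq_0_iff intro!: Nat.gr0I\<close>)
  also have "\<dots> = (\<Sum>d | d dvd n. \<Sum>a\<in>{1..<d}. f a d)"
    using fin by (subst sum.Sigma) auto
  finally show ?thesis
    by (simp add: sum.inter_filter[symmetric] case_prod_unfold)
qed

text \<open>On a = b the equation reads a (x + y) = n, so a divisor d leaves n / d - 1 choices of
  x.\<close>

lemma quads_diagonal_ab:
  fixes f :: "nat \<Rightarrow> int"
  assumes "n > 0"
  shows "(\<Sum>(a, b, x, y)\<in>quads n. if a = b then f a else 0)
       = (\<Sum>d | d dvd n. (int (n div d) - 1) * f d)"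
proof -
  have fin: "finite {d. d dvd n}" using assms by simp
  have "(\<Sum>(a, b, x, y)\<in>{s\<in>quads n. case s of (a, b, x, y) \<Rightarrow> a = b}. f a)
      = (\<Sum>(d, x)\<in>(SIGMA d:{d. d dvd n}. {1..<n div d}). f d)"
    by (rule sum.reindex_bij_witness[where
        j = "\<lambda>(a, b, x, y). (a, x)" and i = "\<lambda>(d, x). (d, d, x, n div d - x)"])
      (use assms in \<open>auto simp: quads_def add_mult_distrib2[symmetric] intro!: Nat.gr0I\<close>)
  also have "\<dots> = (\<Sum>d | d dvd n. \<Sum>x\<in>{1..<n div d}. f d)"
    using fin by (subst sum.Sigma) auto
  also have "\<dots> = (\<Sum>d | d dvd n. (int (n div d) - 1) * f d)"
    using assms by (intro sum.cong refl) (auto simp: of_nat_diff dvd_div_eq_0_iff Suc_le_eq intro!: Nat.gr0I)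
  finally show ?thesis
    by (simp add: sum.inter_filter[symmetric] case_prod_unfold)
qed

lemma sum_squares_below: "6 * (\<Sum>a\<in>{1..<d}. (int a)\<^sup>2) = 2 * int d ^ 3 - 3 * int d ^ 2 + int d"
proof (induction d)
  case (Suc d)
  show ?case
  proof (cases "d = 0")
    case False
    then have "{1..<Suc d} = insert d {1..<d}" by auto
    then show ?thesis using Suc by (simp add: algebra_simps power2_eq_square power3_eq_cube)
  qed simp
qed simp

text \<open>Liouville's method, applied to \<open>4ab = (a + b)\<^sup>2 - (a - b)\<^sup>2\<close>.\<close>

lemma conv_W_1:
  assumes "n > 0"
  shows "12 * int (conv_W 1 n) = 5 * int (divisor_sigma 3 n) - (6 * int n - 1) * int (divisor_sigma 1 n)"
proof -
  define S where "S = (\<lambda>f :: nat \<Rightarrow> nat \<Rightarrow> nat \<Rightarrow> nat \<Rightarrow> int. \<Sum>(a, b, x, y)\<in>quads n. f a b x y)"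
  have S_add: "S (\<lambda>a b x y. f a b x y + g a b x y) = S f + S g" for f g
    by (simp add: S_def case_prod_unfold sum.distrib)
  have S_diff: "S (\<lambda>a b x y. f a b x y - g a b x y) = S f - S g" for f g
    by (simp add: S_def case_prod_unfold sum_subtractf)
  have S_mult: "S (\<lambda>a b x y. k * f a b x y) = k * S f" for f k
    by (simp add: S_def case_prod_unfold sum_distrib_left)
  have swap: "S f = S (\<lambda>a b x y. f b a y x)" for f
    unfolding S_def by (rule quads_swap)
  have transpose: "S f = S (\<lambda>a b x y. f a y x b)" for f
    unfolding S_def by (rule quads_transpose)
  define U where "U = S (\<lambda>a b x y. if x < y then int a ^ 2 else 0)"
  define V where "V = S (\<lambda>a b x y. if b < a then int a ^ 2 else 0)"
  define X where "X = S (\<lambda>a b x y. if x = y then int a ^ 2 else 0)"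
  define Y where "Y = S (\<lambda>a b x y. if a = b then int a ^ 2 else 0)"
  define Z where "Z = S (\<lambda>a b x y. if x = y then int (a + b) ^ 2 else 0)"
  \<comment> \<open>Split by comparing x and y: the two off-diagonal halves are mirror images, and
    the shear turns each of them into \<open>V\<close>.\<close>
  have plus: "S (\<lambda>a b x y. int (a + b) ^ 2) = 2 * V + Z"
  proof -
    have "S (\<lambda>a b x y. int (a + b) ^ 2) = S (\<lambda>a b x y. (if x < y then int (a + b) ^ 2 else 0)
      + ((if y < x then int (a + b) ^ 2 else 0) + (if x = y then int (a + b) ^ 2 else 0)))"
      by (intro arg_cong[of _ _ S] ext) auto
    also have "\<dots> = S (\<lambda>a b x y. if x < y then int (a + b) ^ 2 else 0)
      + (S (\<lambda>a b x y. if y < x then int (a + b) ^ 2 else 0) + Z)"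
      by (simp only: S_add Z_def)
    also have "S (\<lambda>a b x y. if y < x then int (a + b) ^ 2 else 0)
      = S (\<lambda>a b x y. if x < y then int (a + b) ^ 2 else 0)"
      by (subst swap) (simp only: add.commute)
    also have "S (\<lambda>a b x y. if x < y then int (a + b) ^ 2 else 0) = V"
      using quads_shear[where n = n and f = "\<lambda>a b x y. int a ^ 2"] by (simp add: S_def V_def)
    finally show ?thesis by simp
  qed
  \<comment> \<open>Split by comparing a and b; here the shear is read in the opposite
    direction.\<close>
  have minus: "S (\<lambda>a b x y. (int a - int b) ^ 2) = 2 * U"
  proof -
    have "S (\<lambda>a b x y. (int a - int b) ^ 2) = S (\<lambda>a b x y. (if b < a then (int a - int b) ^ 2 else 0)
      + (if a < b then (int a - int b) ^ 2 else 0))"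
      by (intro arg_cong[of _ _ S] ext) auto
    also have "\<dots> = S (\<lambda>a b x y. if b < a then (int a - int b) ^ 2 else 0)
      + S (\<lambda>a b x y. if a < b then (int a - int b) ^ 2 else 0)"
      by (simp only: S_add)
    also have "S (\<lambda>a b x y. if a < b then (int a - int b) ^ 2 else 0)
      = S (\<lambda>a b x y. if b < a then (int a - int b) ^ 2 else 0)"
      by (subst swap, intro arg_cong[of _ _ S] ext) (simp add: power2_commute)
    also have "S (\<lambda>a b x y. if b < a then (int a - int b) ^ 2 else 0) = U"
    proof -
      have "int (a + b) - int b = int a" for a b by simp
      with quads_shear[where n = n and f = "\<lambda>a b x y. (int a - int b) ^ 2"] show ?thesis
        by (simp only: S_def U_def)
    qed
    finally show ?thesis by simp
  qed
  \<comment> \<open>Neither \<open>U\<close> nor \<open>V\<close> is evaluated: only V - U enters,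
    and this relation trades it for diagonal sums. The weight a^2 involves neither b nor y, so
    exchanging these two turns the conditions x \<le> b and y \<le> a of \<open>quads_slide\<close>
    into x \<le> y and b \<le> a.\<close>
  have slide: "U + X = V + Y"
  proof -
    have "S (\<lambda>a b x y. if x \<le> b then int a ^ 2 else 0) = S (\<lambda>a b x y. if y \<le> a then int a ^ 2 else 0)"
      unfolding S_def by (rule quads_slide)
    then have "S (\<lambda>a b x y. if x \<le> y then int a ^ 2 else 0) = S (\<lambda>a b x y. if b \<le> a then int a ^ 2 else 0)"
      by (subst transpose, subst (2) transpose)
    moreover have "S (\<lambda>a b x y. if x \<le> y then int a ^ 2 else 0) = U + X"
      unfolding U_def X_def S_add[symmetric] by (intro arg_cong[of _ _ S] ext) auto
    moreover have "S (\<lambda>a b x y. if b \<le> a then int a ^ 2 else 0) = V + Y"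
      unfolding V_def Y_def S_add[symmetric] by (intro arg_cong[of _ _ S] ext) auto
    ultimately show ?thesis by simp
  qed
  have "4 * S (\<lambda>a b x y. int a * int b) = S (\<lambda>a b x y. int (a + b) ^ 2 - (int a - int b) ^ 2)"
    unfolding S_mult[symmetric]
    by (intro arg_cong[of _ _ S] ext) (simp add: power2_eq_square algebra_simps)
  also have "\<dots> = 2 * V + Z - 2 * U"
    by (simp only: S_diff plus minus)
  finally have *: "4 * S (\<lambda>a b x y. int a * int b) = Z + 2 * X - 2 * Y"
    using slide by linarith
  have X: "6 * X = (\<Sum>d | d dvd n. 2 * int d ^ 3 - 3 * int d ^ 2 + int d)"
    unfolding X_def S_def using quads_diagonal_xy[OF assms, of "\<lambda>a d. int a ^ 2"]
    by (simp add: sum_distrib_left flip: sum_squares_below)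
  have Y: "Y = (\<Sum>d | d dvd n. int n * int d - int d ^ 2)"
    unfolding Y_def S_def quads_diagonal_ab[OF assms]
    by (intro sum.cong refl) (auto simp: power2_eq_square algebra_simps simp flip: of_nat_mult)
  have Z: "Z = (\<Sum>d | d dvd n. int d ^ 3 - int d ^ 2)"
  proof -
    have "Z = (\<Sum>d | d dvd n. \<Sum>a\<in>{1..<d}. int d ^ 2)"
      unfolding Z_def S_def using quads_diagonal_xy[OF assms, of "\<lambda>a d. int d ^ 2"] by simp
    also have "\<dots> = (\<Sum>d | d dvd n. int d ^ 3 - int d ^ 2)"
      using assms by (intro sum.cong refl)
        (auto simp: of_nat_diff power2_eq_square power3_eq_cube algebra_simps Suc_le_eq intro!: Nat.gr0I)
    finally show ?thesis .
  qed
  have W: "int (conv_W 1 n) = S (\<lambda>a b x y. int a * int b)"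
    unfolding conv_W_1_quads S_def by (simp add: case_prod_unfold)
  have "12 * int (conv_W 1 n) = 3 * Z + 6 * X - 6 * Y"
    using * unfolding W by linarith
  also have "\<dots> = (\<Sum>d | d dvd n. 5 * int d ^ 3 - (6 * int n - 1) * int d)"
    unfolding X Y Z by (simp add: sum_distrib_left flip: sum.distrib sum_subtractf)
      (intro sum.cong refl, simp add: algebra_simps)
  also have "\<dots> = 5 * int (divisor_sigma 3 n) - (6 * int n - 1) * int (divisor_sigma 1 n)"
    by (simp add: divisor_sigma_def sum_subtractf sum_distrib_left)
  finally show ?thesis .
qed

section \<open>The nome q = exp (2 pi i z)\<close>

abbreviation nome :: "complex \<Rightarrow> complex" where
  "nome z \<equiv> exp (2 * of_real pi * \<i> * z)"

lemma norm_nome: "norm (nome z) = exp (- 2 * pi * Im z)"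
  by simp

lemma norm_nome_less_1: "Im z > 0 \<Longrightarrow> norm (nome z) < 1"
  by (simp add: norm_nome)

lemma nome_mult_nat: "nome (of_nat n * z) = nome z ^ n"
  by (simp add: exp_of_nat_mult[symmetric] mult_ac)

section \<open>Partial fractions of the cotangent\<close>

lemma sin_pi_times_eq_0: "sin (of_real pi * w :: complex) = 0 \<longleftrightarrow> w \<in> \<int>"
proof -
  have "of_real pi * w = of_real (of_int n * pi) \<longleftrightarrow> w = of_int n" for n :: int
  proof -
    have "of_real pi * w = of_real (of_int n * pi) \<longleftrightarrow> of_real pi * w = of_real pi * of_int n"
      by (simp only: of_real_mult of_real_of_int_eq mult.commute)
    then show ?thesis by simp
  qed
  then show ?thesis unfolding sin_eq_0 by (auto elim: Ints_cases)
qed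

text \<open>Logarithmic derivative of Euler's reflection formula, written for the entire function 1
  / Gamma so that the product is divided out only at the end.\<close>

lemma Digamma_reflection_complex:
  assumes w: "w \<notin> (\<int> :: complex set)"
  shows "Digamma (1 - w) - Digamma w = of_real pi * cot (of_real pi * w)"
proof -
  have w': "w \<notin> \<int>\<^sub>\<le>\<^sub>0" "1 - w \<notin> \<int>\<^sub>\<le>\<^sub>0"
    using w nonpos_Ints_subset_Ints Ints_diff[of 1 "1 - w"] by auto
  have "((\<lambda>w. rGamma w * rGamma (1 - w)) has_field_derivative
          - rGamma w * Digamma w * rGamma (1 - w) + rGamma (1 - w) * Digamma (1 - w) * rGamma w) (at w)"
    using w' by (auto intro!: derivative_eq_intros)
  moreover have "((\<lambda>w. sin (of_real pi * w) / of_real pi) has_field_derivative cos (of_real pi * w)) (at w)"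
    by (auto intro!: derivative_eq_intros)
  ultimately have "- rGamma w * Digamma w * rGamma (1 - w) + rGamma (1 - w) * Digamma (1 - w) * rGamma w
      = cos (of_real pi * w)"
    unfolding rGamma_reflection_complex by (rule DERIV_unique)
  then have "(rGamma w * rGamma (1 - w)) * (Digamma (1 - w) - Digamma w) = cos (of_real pi * w)"
    by (simp add: algebra_simps)
  then have "sin (of_real pi * w) * (Digamma (1 - w) - Digamma w) = of_real pi * cos (of_real pi * w)"
    unfolding rGamma_reflection_complex by (simp add: field_simps)
  moreover have "sin (of_real pi * w) \<noteq> 0" using w by (simp add: sin_pi_times_eq_0)
  ultimately show ?thesis by (simp add: cot_def field_simps)
qed

text \<open>This form isolates the limit - pi i for growing imaginary part, which is the source of
  the non-modular term in \<open>E2_S\<close>.\<close>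

lemma cot_nome:
  assumes "Im w > 0"
  shows "of_real pi * cot (of_real pi * w) = - of_real pi * \<i> - 2 * of_real pi * \<i> * (nome w / (1 - nome w))"
proof -
  define e where "e = exp (\<i> * (of_real pi * w))"
  have e0: "e \<noteq> 0" by (simp add: e_def)
  have e2: "nome w = e\<^sup>2"
    by (simp add: e_def power2_eq_square exp_add[symmetric] mult_ac)
  have "norm (e\<^sup>2) < 1" using norm_nome_less_1[OF assms] e2 by simp
  then have ne: "e\<^sup>2 \<noteq> 1" by auto
  have em: "exp (- (\<i> * (of_real pi * w))) = 1 / e" by (simp add: e_def exp_minus inverse_eq_divide)
  have "cot (of_real pi * w) = \<i> * (e + 1 / e) / (e - 1 / e)"
  proof -
    define C D where "C = e + 1 / e" and "D = e - 1 / e"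
    have "D \<noteq> 0" unfolding D_def using e0 ne by (auto simp: field_simps power2_eq_square)
    then have "(C / 2) / (D / (2 * \<i>)) = \<i> * C / D" by (simp add: divide_simps)
    then show ?thesis
      unfolding cot_def cos_exp_eq sin_exp_eq e_def[symmetric] em C_def D_def .
  qed
  also have "\<dots> = \<i> * (e\<^sup>2 + 1) / (e\<^sup>2 - 1)"
    using e0 ne by (auto simp: field_simps power2_eq_square)
  also have "\<dots> = - \<i> - 2 * \<i> * (e\<^sup>2 / (1 - e\<^sup>2))"
  proof -
    have "e\<^sup>2 - 1 \<noteq> 0" "1 - e\<^sup>2 \<noteq> 0" using ne by auto
    then show ?thesis by (simp add: divide_simps) (simp add: algebra_simps)
  qed
  finally have c: "cot (of_real pi * w) = - \<i> - 2 * \<i> * (e\<^sup>2 / (1 - e\<^sup>2))" .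
  show ?thesis unfolding e2 c by (simp add: right_diff_distrib)
qed

lemma cot_pi_plus_1: "cot (of_real pi * (w + 1) :: complex) = cot (of_real pi * w)"
  by (simp add: cot_def algebra_simps sin_add cos_add flip: sin_of_real cos_of_real)

lemma Im_pos_not_Int: "Im w \<noteq> 0 \<Longrightarrow> w \<notin> \<int>"
  by (auto elim: Ints_cases)

lemma has_sum_int_split:
  fixes f :: "int \<Rightarrow> 'a :: real_normed_vector"
  assumes "((\<lambda>n::nat. f (int n)) has_sum a) UNIV" "((\<lambda>n::nat. f (- 1 - int n)) has_sum b) UNIV"
  shows "(f has_sum (a + b)) UNIV"
proof -
  have "(f has_sum a) {0..}"
    using assms(1) by (rule has_sum_reindex_bij_witness[of _ nat int, THEN iffD1, rotated -1]) auto
  moreover have "(f has_sum b) {..<0}"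
    using assms(2)
    by (rule has_sum_reindex_bij_witness[of _ "\<lambda>k. nat (- 1 - k)" "\<lambda>n. - 1 - int n", THEN iffD1, rotated -1]) auto
  ultimately have "(f has_sum (a + b)) ({0..} \<union> {..<0})"
    by (rule has_sum_Un_disjoint) auto
  moreover have "{0..} \<union> {..<0} = (UNIV :: int set)" by auto
  ultimately show ?thesis by simp
qed

lemma summable_norm_inverse_square_shift:
  fixes w :: complex
  shows "summable (\<lambda>k::nat. norm (1 / (w + of_nat k)\<^sup>2))"
proof (rule summable_comparison_test_ev)
  show "summable (\<lambda>k. 4 * (1 / real k ^ 2))"
    using inverse_power_summable[of 2, where ?'a = real] by (intro summable_mult) (simp add: field_simps)
  show "\<forall>\<^sub>F k in sequentially. norm (norm (1 / (w + of_nat k)\<^sup>2)) \<le> 4 * (1 / real k ^ 2)"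
    using eventually_ge_at_top[of "nat \<lceil>2 * norm w\<rceil> + 1"]
  proof eventually_elim
    case (elim k)
    have k: "real k \<ge> 2 * norm w" "k > 0" using elim by linarith+
    have "norm (of_nat k :: complex) - norm w \<le> norm (of_nat k + w)" by (rule norm_diff_ineq)
    then have "real k / 2 \<le> norm (w + of_nat k)" using k by (simp add: add.commute)
    then have "(real k / 2)\<^sup>2 \<le> norm (w + of_nat k) ^ 2" by (intro power_mono) auto
    moreover have "(real k / 2)\<^sup>2 > 0" using k by simp
    ultimately have "1 / norm (w + of_nat k) ^ 2 \<le> 1 / (real k / 2)\<^sup>2"
      by (intro divide_left_mono mult_pos_pos) auto
    then show ?case by (simp add: norm_divide norm_power power_divide)
  qed
qed

lemma sums_Digamma:
  assumes "w \<noteq> (0 :: complex)"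
  shows "(\<lambda>k. 1 / of_nat (Suc k) - 1 / (w + of_nat k)) sums (Digamma w + euler_mascheroni)"
  using summable_sums[OF summable_Digamma[OF assms]] by (simp add: Digamma_def inverse_eq_divide)

text \<open>Partial fractions with denominators c + u - h and c + u + h turn each half-line of c
  into a difference of Digamma values; the reflection formula joins the halves to cotangents. In the
  double series h is 1/2 along the rows and 1 / (2 z) along the columns.\<close>

lemma has_sum_inverse_quadratic:
  fixes u h :: complex
  assumes h: "h \<noteq> 0" and u: "u - h \<notin> \<int>" "u + h \<notin> \<int>"
  shows "((\<lambda>c::int. 1 / ((of_int c + u)\<^sup>2 - h\<^sup>2)) has_sum
    (of_real pi * cot (of_real pi * (u - h)) - of_real pi * cot (of_real pi * (u + h))) / (2 * h)) UNIV"
proof -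
  have ne: "u - h + of_int k \<noteq> 0" "u + h + of_int k \<noteq> 0" for k :: int
  proof -
    show "u - h + of_int k \<noteq> 0" using u(1) Ints_minus[OF Ints_of_int[of k]]
      by (metis add_eq_0_iff2)
    show "u + h + of_int k \<noteq> 0" using u(2) Ints_minus[OF Ints_of_int[of k]]
      by (metis add_eq_0_iff2)
  qed
  have key: "1 / ((of_int c + u)\<^sup>2 - h\<^sup>2) = (1 / (u - h + of_int c) - 1 / (u + h + of_int c)) / (2 * h)" for c
    using ne[of c] h
  proof -
    have "(of_int c + u)\<^sup>2 - h\<^sup>2 = (u - h + of_int c) * (u + h + of_int c)"
      by (simp add: power2_eq_square algebra_simps)
    then show ?thesis using ne[of c] h by (simp add: divide_simps)
  qed
  \<comment> \<open>Absolute convergence on both half-lines at once: s = 1, k = 0 gives c \<ge> 0,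
    and s = k = - 1 gives c < 0.\<close>
  have sm: "summable (\<lambda>n::nat. norm (1 / ((of_int (s * int n + k) + u)\<^sup>2 - h\<^sup>2)))" if "s = 1 \<or> s = -1" for s k :: int
  proof (rule summable_comparison_test)
    define A where "A = of_int s * (u - h + of_int k)"
    define B where "B = of_int s * (u + h + of_int k)"
    show "summable (\<lambda>n::nat. norm (1 / (A + of_nat n)\<^sup>2) + norm (1 / (B + of_nat n)\<^sup>2))"
      by (intro summable_add summable_norm_inverse_square_shift)
    have "norm (1 / ((of_int (s * int n + k) + u)\<^sup>2 - h\<^sup>2)) \<le> norm (1 / (A + of_nat n)\<^sup>2) + norm (1 / (B + of_nat n)\<^sup>2)" for n
    proof -
      have "(of_int (s * int n + k) + u)\<^sup>2 - h\<^sup>2 = (A + of_nat n) * (B + of_nat n)"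
        using that by (auto simp: A_def B_def power2_eq_square algebra_simps)
      then have "norm (1 / ((of_int (s * int n + k) + u)\<^sup>2 - h\<^sup>2))
          = norm (1 / (A + of_nat n)) * norm (1 / (B + of_nat n))"
        by (simp add: norm_mult norm_divide)
      also have "\<dots> \<le> norm (1 / (A + of_nat n)) ^ 2 + norm (1 / (B + of_nat n)) ^ 2"
      proof -
        have "a * b \<le> a\<^sup>2 + b\<^sup>2" if "a \<ge> 0" "b \<ge> 0" for a b :: real
          using sum_squares_bound[of a b] mult_nonneg_nonneg[OF that] by linarith
        then show ?thesis by simp
      qed
      finally show ?thesis by (simp add: norm_divide norm_power power_divide)
    qed
    then show "\<exists>N. \<forall>n\<ge>N. norm (norm (1 / ((of_int (s * int n + k) + u)\<^sup>2 - h\<^sup>2)))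
        \<le> norm (1 / (A + of_nat n)\<^sup>2) + norm (1 / (B + of_nat n)\<^sup>2)" by simp
  qed
  have "(\<lambda>n::nat. 1 / ((of_int (int n) + u)\<^sup>2 - h\<^sup>2)) sums ((Digamma (u + h) - Digamma (u - h)) / (2 * h))"
    using sums_divide[OF sums_diff[OF sums_Digamma[of "u + h"] sums_Digamma[of "u - h"]], of "2 * h"]
      ne[of 0] unfolding key by simp
  then have 1: "((\<lambda>n::nat. 1 / ((of_int (int n) + u)\<^sup>2 - h\<^sup>2)) has_sum ((Digamma (u + h) - Digamma (u - h)) / (2 * h))) UNIV"
    using sm[of 1 0] by (intro norm_summable_imp_has_sum) auto
  have e: "1 / ((of_int (- 1 - int n) + u)\<^sup>2 - h\<^sup>2)
      = ((1 / of_nat (Suc n) - 1 / (1 - (u - h) + of_nat n)) - (1 / of_nat (Suc n) - 1 / (1 - (u + h) + of_nat n))) / (2 * h)" for n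
  proof -
    have "u - h + of_int (- 1 - int n) = - (1 - (u - h) + of_nat n)"
         "u + h + of_int (- 1 - int n) = - (1 - (u + h) + of_nat n)" by (simp_all add: algebra_simps)
    then show ?thesis unfolding key by (simp only: divide_minus_right) simp
  qed
  have "1 - (u - h) \<noteq> 0" "1 - (u + h) \<noteq> 0" using ne[of "-1"] by auto
  then have "(\<lambda>n::nat. 1 / ((of_int (- 1 - int n) + u)\<^sup>2 - h\<^sup>2)) sums ((Digamma (1 - (u - h)) - Digamma (1 - (u + h))) / (2 * h))"
    using sums_divide[OF sums_diff[OF sums_Digamma[of "1 - (u - h)"] sums_Digamma[of "1 - (u + h)"]], of "2 * h"]
    unfolding e by simp
  then have 2: "((\<lambda>n::nat. 1 / ((of_int (- 1 - int n) + u)\<^sup>2 - h\<^sup>2)) has_sum ((Digamma (1 - (u - h)) - Digamma (1 - (u + h))) / (2 * h))) UNIV"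
    using sm[of "-1" "-1"] by (intro norm_summable_imp_has_sum) (auto simp: algebra_simps)
  have "(Digamma (u + h) - Digamma (u - h)) / (2 * h) + (Digamma (1 - (u - h)) - Digamma (1 - (u + h))) / (2 * h)
    = (of_real pi * cot (of_real pi * (u - h)) - of_real pi * cot (of_real pi * (u + h))) / (2 * h)"
    unfolding Digamma_reflection_complex[OF u(1), symmetric] Digamma_reflection_complex[OF u(2), symmetric]
    by (simp add: add_divide_distrib diff_divide_distrib)
  then show ?thesis using has_sum_int_split[OF 1 2] by simp
qed

text \<open>Lipschitz's formula for exponent 2. The halves d \<ge> 0 and d < 0 are the trigamma
  values at w and 1 - w, and differentiating the Digamma reflection together with
  \<open>cot_nome\<close> evaluates their sum.\<close>

lemma has_sum_inverse_squares_upper: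
  assumes w: "Im w > 0"
  shows "((\<lambda>d::int. 1 / (w + of_int d)\<^sup>2) has_sum (- 4 * of_real pi ^ 2 * (nome w / (1 - nome w)\<^sup>2))) UNIV"
proof -
  have nz: "w \<noteq> 0" "1 - w \<noteq> 0" "w \<notin> \<int>\<^sub>\<le>\<^sub>0" "1 - w \<notin> \<int>\<^sub>\<le>\<^sub>0"
    using w by (auto elim: nonpos_Ints_cases simp: complex_eq_iff)
  have sm: "(\<lambda>k. 1 / (v + of_nat k)\<^sup>2) sums Polygamma 1 v" if "v \<noteq> 0" for v :: complex
    using summable_sums[OF Polygamma_converges'[OF that, of 2]]
    by (simp add: Polygamma_def inverse_eq_divide power2_eq_square)
  have 1: "((\<lambda>n::nat. 1 / (w + of_int (int n))\<^sup>2) has_sum Polygamma 1 w) UNIV"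
    using sm[OF nz(1)] summable_norm_inverse_square_shift[of w]
    by (intro norm_summable_imp_has_sum) auto
  have e: "(w + of_int (- 1 - int n))\<^sup>2 = (1 - w + of_nat n)\<^sup>2" for n
    by (simp add: power2_eq_square algebra_simps)
  have 2: "((\<lambda>n::nat. 1 / (w + of_int (- 1 - int n))\<^sup>2) has_sum Polygamma 1 (1 - w)) UNIV"
    unfolding e using sm[OF nz(2)] summable_norm_inverse_square_shift[of "1 - w"]
    by (intro norm_summable_imp_has_sum) auto
  have "((\<lambda>w. Digamma (1 - w) - Digamma w) has_field_derivative - Polygamma 1 (1 - w) - Polygamma 1 w) (at w)"
    using nz by (auto intro!: derivative_eq_intros)
  moreover have "((\<lambda>w. Digamma (1 - w) - Digamma w) has_field_derivative
      4 * of_real pi ^ 2 * (nome w / (1 - nome w)\<^sup>2)) (at w)"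
  proof (rule has_field_derivative_transform_within_open)
    have ne: "nome w \<noteq> 1" using norm_nome_less_1[OF w] by (metis norm_one less_irrefl)
    have d: "(nome has_field_derivative 2 * of_real pi * \<i> * nome w) (at w)"
      by (auto intro!: derivative_eq_intros)
    have num: "c * q * (1 - q) - q * (0 - c * q) = c * q" for c q :: complex
      by (simp add: algebra_simps)
    have "((\<lambda>w. nome w / (1 - nome w)) has_field_derivative
        (2 * of_real pi * \<i> * nome w * (1 - nome w) - nome w * (0 - 2 * of_real pi * \<i> * nome w))
          / ((1 - nome w) * (1 - nome w))) (at w)"
      by (rule DERIV_divide[OF d DERIV_diff[OF DERIV_const d]]) (use ne in simp)
    then have "((\<lambda>w. nome w / (1 - nome w)) has_field_derivative
        (2 * of_real pi * \<i> * nome w) / (1 - nome w)\<^sup>2) (at w)"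
      unfolding num power2_eq_square .
    from DERIV_diff[OF DERIV_const DERIV_cmult[OF this], of "- of_real pi * \<i>" "2 * of_real pi * \<i>"]
    show "((\<lambda>w. - of_real pi * \<i> - 2 * of_real pi * \<i> * (nome w / (1 - nome w))) has_field_derivative
        4 * of_real pi ^ 2 * (nome w / (1 - nome w)\<^sup>2)) (at w)"
      by (rule DERIV_cong) (simp add: power2_eq_square mult_ac)
    show "open {w. Im w > 0}" by (rule open_halfspace_Im_gt)
    show "w \<in> {w. Im w > 0}" using w by simp
    show "- of_real pi * \<i> - 2 * of_real pi * \<i> * (nome v / (1 - nome v)) = Digamma (1 - v) - Digamma v"
      if "v \<in> {w. Im w > 0}" for v
      using that by (subst Digamma_reflection_complex) (auto intro!: Im_pos_not_Int simp: cot_nome)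
  qed
  ultimately have eq: "- Polygamma 1 (1 - w) - Polygamma 1 w = 4 * of_real pi ^ 2 * (nome w / (1 - nome w)\<^sup>2)"
    by (rule DERIV_unique)
  have "Polygamma 1 w + Polygamma 1 (1 - w) = - 4 * of_real pi ^ 2 * (nome w / (1 - nome w)\<^sup>2)"
  proof -
    have "- a - b = c \<Longrightarrow> b + a = - c" for a b c :: complex by auto
    then show ?thesis using eq by (metis mult_minus_left)
  qed
  then show ?thesis using has_sum_int_split[OF 1 2] by simp
qed

section \<open>Power series converging on the unit disc\<close>

lemma sums_imp_conv_radius:
  fixes F :: "complex fps"
  assumes "\<And>q. norm q < 1 \<Longrightarrow> summable (\<lambda>n. fps_nth F n * q ^ n)"
  shows "fps_conv_radius F \<ge> 1"
  unfolding fps_conv_radius_def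
proof (rule conv_radius_geI_ex')
  fix r :: real assume "0 < r" "ereal r < 1"
  then show "summable (\<lambda>n. fps_nth F n * of_real r ^ n)"
    by (intro assms) (simp add: one_ereal_def)
qed

lemma norm_less_conv_radius:
  "norm q < 1 \<Longrightarrow> fps_conv_radius F \<ge> 1 \<Longrightarrow> ereal (norm q) < fps_conv_radius F"
  by (rule less_le_trans[of _ 1]) simp_all

lemma conv_radius_ge_1_add:
  "fps_conv_radius F \<ge> 1 \<Longrightarrow> fps_conv_radius G \<ge> 1 \<Longrightarrow> fps_conv_radius (F + G :: complex fps) \<ge> 1"
  by (metis fps_conv_radius_add min.boundedI order_trans)

lemma conv_radius_ge_1_diff:
  "fps_conv_radius F \<ge> 1 \<Longrightarrow> fps_conv_radius G \<ge> 1 \<Longrightarrow> fps_conv_radius (F - G :: complex fps) \<ge> 1"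
  by (metis fps_conv_radius_diff min.boundedI order_trans)

lemma conv_radius_ge_1_mult:
  "fps_conv_radius F \<ge> 1 \<Longrightarrow> fps_conv_radius G \<ge> 1 \<Longrightarrow> fps_conv_radius (F * G :: complex fps) \<ge> 1"
  by (metis fps_conv_radius_mult min.boundedI order_trans)

lemma conv_radius_ge_1_power:
  "fps_conv_radius F \<ge> 1 \<Longrightarrow> fps_conv_radius (F ^ n :: complex fps) \<ge> 1"
  using fps_conv_radius_power[of F n] by (auto intro: order_trans)

lemma conv_radius_ge_1_deriv:
  "fps_conv_radius F \<ge> 1 \<Longrightarrow> fps_conv_radius (fps_deriv F :: complex fps) \<ge> 1"
  using fps_conv_radius_deriv[of F] by (auto intro: order_trans)

lemma conv_radius_ge_1_triv:
  "fps_conv_radius (fps_const c :: complex fps) \<ge> 1" "fps_conv_radius (numeral k :: complex fps) \<ge> 1"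
  "fps_conv_radius (1 :: complex fps) \<ge> 1" "fps_conv_radius (fps_X :: complex fps) \<ge> 1"
  by simp_all

lemmas conv_radius_ge_1_intros = conv_radius_ge_1_add conv_radius_ge_1_diff conv_radius_ge_1_mult
  conv_radius_ge_1_power conv_radius_ge_1_deriv conv_radius_ge_1_triv

lemma fps_conv_radius_powers: "fps_conv_radius (Abs_fps (\<lambda>n. of_nat n ^ k) :: complex fps) \<ge> 1"
proof (induction k)
  case 0
  show ?case by (rule sums_imp_conv_radius) (simp add: summable_geometric)
next
  case (Suc k)
  have "Abs_fps (\<lambda>n. of_nat n ^ Suc k) = fps_X * fps_deriv (Abs_fps (\<lambda>n. of_nat n ^ k) :: complex fps)"
    by (rule fps_ext) (simp add: fps_X_mult_nth)
  then show ?case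
    using Suc by (auto intro!: conv_radius_ge_1_intros)
qed

lemma fps_conv_radius_polynomial_growth:
  fixes F :: "complex fps"
  assumes "\<And>n. norm (fps_nth F n) \<le> real n ^ k"
  shows "fps_conv_radius F \<ge> 1"
proof (rule sums_imp_conv_radius)
  fix q :: complex assume q: "norm q < 1"
  have "ereal (norm q) < fps_conv_radius (Abs_fps (\<lambda>n. of_nat n ^ k) :: complex fps)"
    using q fps_conv_radius_powers by (rule norm_less_conv_radius)
  from norm_summable_fps[OF this]
  show "summable (\<lambda>n. fps_nth F n * q ^ n)"
    by (rule summable_comparison_test[rotated])
       (auto intro!: exI[of _ 0] mult_right_mono assms simp: norm_mult norm_power)
qed

text \<open>Every d divides 0, so the sum runs over an infinite set and takes the default value 0.
  Hence the generating series below have no constant term.\<close>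

lemma divisor_sigma_0 [simp]: "divisor_sigma j 0 = 0"
  by (simp add: divisor_sigma_def)

lemma divisor_sigma_le: "divisor_sigma j n \<le> n ^ Suc j"
proof (cases "n = 0")
  case False
  have "divisor_sigma j n \<le> (\<Sum>d | d dvd n. n ^ j)"
    unfolding divisor_sigma_def using False by (intro sum_mono power_mono) (auto intro: dvd_imp_le)
  also have "\<dots> = card {d. d dvd n} * n ^ j" by simp
  also have "card {d. d dvd n} \<le> card {1..n}"
    using False by (intro card_mono) (auto intro: dvd_imp_le Nat.gr0I simp: Suc_le_eq)
  finally show ?thesis by simp
qed simp

definition sigma_fps :: "nat \<Rightarrow> complex fps" where
  "sigma_fps j = Abs_fps (\<lambda>n. of_nat (divisor_sigma j n))"

lemma fps_conv_radius_sigma: "fps_conv_radius (sigma_fps j) \<ge> 1"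
  by (rule fps_conv_radius_polynomial_growth[of _ "Suc j"])
     (use divisor_sigma_le[of j] in \<open>simp add: sigma_fps_def flip: of_nat_power of_nat_mult del: power_Suc\<close>)

section \<open>The Eisenstein series of weight 2\<close>

text \<open>Both sides regroup the double series of d q^(c d): collecting N = c d gives divisor
  sums, collecting c gives the derivative of a geometric series. Absolute convergence comes from the
  first grouping.\<close>

lemma has_sum_lambert_sigma:
  assumes q: "norm (q :: complex) < 1"
  shows "((\<lambda>c::nat. q ^ c / (1 - q ^ c)\<^sup>2) has_sum eval_fps (sigma_fps 1) q) {1..}"
proof -
  let ?D = "Sigma {1..} (\<lambda>N::nat. {d. d dvd N})"
  have nq: "ereal (norm q) < fps_conv_radius (sigma_fps 1)"
    by (rule norm_less_conv_radius[OF q fps_conv_radius_sigma])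
  have fin: "finite {d. d dvd N}" if "N \<in> {1..}" for N :: nat using that by auto
  have smr: "summable (\<lambda>N. real (divisor_sigma 1 N) * norm q ^ N)"
    using norm_summable_fps[OF nq] by (simp add: sigma_fps_def norm_mult norm_power)
  have "(\<lambda>(N, d). real d * norm q ^ N) summable_on ?D"
  proof (rule summable_on_SigmaI)
    show "((\<lambda>d. case (N, d) of (N, d) \<Rightarrow> real d * norm q ^ N) has_sum real (divisor_sigma 1 N) * norm q ^ N) {d. d dvd N}"
      if "N \<in> {1..}" for N
      using fin[OF that] by (intro has_sum_finiteI) (auto simp: divisor_sigma_def sum_distrib_right)
    show "(\<lambda>N. real (divisor_sigma 1 N) * norm q ^ N) summable_on {1..}"
      using summable_nonneg_imp_summable_on[OF smr] by (rule summable_on_subset) auto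
  qed auto
  then have "(\<lambda>x. norm (case x of (N, d) \<Rightarrow> of_nat d * q ^ N)) summable_on ?D"
    by (rule summable_on_cong[THEN iffD1, rotated]) (auto simp: norm_mult norm_power)
  then have "(\<lambda>(N, d). of_nat d * q ^ N) summable_on ?D"
    by (rule abs_summable_summable)
  then obtain S where S: "((\<lambda>(N, d). of_nat d * q ^ N) has_sum S) ?D"
    using has_sum_infsum by blast
  have "((\<lambda>N. of_nat (divisor_sigma 1 N) * q ^ N) has_sum S) {1..}"
  proof (rule has_sum_SigmaD[OF S])
    show "((\<lambda>d. case (N, d) of (N, d) \<Rightarrow> of_nat d * q ^ N) has_sum of_nat (divisor_sigma 1 N) * q ^ N) {d. d dvd N}"
      if "N \<in> {1..}" for N
      using fin[OF that] by (intro has_sum_finiteI) (auto simp: divisor_sigma_def sum_distrib_right)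
  qed
  then have "((\<lambda>N. of_nat (divisor_sigma 1 N) * q ^ N) has_sum S) UNIV"
    by (rule has_sum_cong_neutral[THEN iffD1, rotated -1]) (auto simp: not_le)
  moreover have "((\<lambda>N. of_nat (divisor_sigma 1 N) * q ^ N) has_sum eval_fps (sigma_fps 1) q) UNIV"
    using norm_summable_fps[OF nq] sums_eval_fps[OF nq]
    by (intro norm_summable_imp_has_sum) (simp_all add: sigma_fps_def)
  ultimately have S_eq: "S = eval_fps (sigma_fps 1) q" by (rule has_sum_unique)
  have "((\<lambda>(c, d). of_nat d * q ^ (c * d)) has_sum S) ({1..} \<times> {1..})"
    using S
    by (rule has_sum_reindex_bij_witness[of _ "\<lambda>(c, d). (c * d, d)" "\<lambda>(N, d). (N div d, d)", THEN iffD1, rotated -1])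
       (auto simp: Suc_le_eq dvd_div_eq_0_iff intro!: Nat.gr0I)
  then have "((\<lambda>c. q ^ c / (1 - q ^ c)\<^sup>2) has_sum S) {1..}"
  proof (rule has_sum_SigmaD)
    fix c :: nat assume c: "c \<in> {1..}"
    define w where "w = q ^ c"
    have w: "norm w < 1" using q c by (simp add: w_def norm_power power_less_one_iff)
    have "(\<lambda>n. of_nat (Suc n) * w ^ n * w) sums (1 / (1 - w)\<^sup>2 * w)"
      by (intro sums_mult2 geometric_deriv_sums w)
    moreover have "summable (\<lambda>n. norm (of_nat (Suc n) * w ^ n * w))"
      using sums_summable[OF sums_mult2[OF geometric_deriv_sums[of "norm w"], of "norm w"]] w
      by (simp add: norm_mult norm_power del: of_nat_Suc)
    ultimately have "((\<lambda>n. of_nat (Suc n) * w ^ n * w) has_sum (1 / (1 - w)\<^sup>2 * w)) UNIV"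
      by (intro norm_summable_imp_has_sum)
    then have "((\<lambda>d. of_nat d * w ^ d) has_sum (1 / (1 - w)\<^sup>2 * w)) {1..}"
      by (rule has_sum_reindex_bij_witness[of _ "\<lambda>n. n - 1" "\<lambda>n. n + 1", THEN iffD1, rotated -1]) auto
    then show "((\<lambda>d. case (c, d) of (c, d) \<Rightarrow> of_nat d * q ^ (c * d)) has_sum q ^ c / (1 - q ^ c)\<^sup>2) {1..}"
      by (simp add: w_def power_mult)
  qed
  then show ?thesis unfolding S_eq .
qed

definition E2 :: "complex \<Rightarrow> complex" where
  "E2 z = 1 - 24 * eval_fps (sigma_fps 1) (nome z)"

text \<open>The sum of 1 / (c z + d)^2 over all integers d. For c = 0 the convention 1 / 0 = 0 drops
  the origin and leaves 2 \<zeta>(2).\<close>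

definition row_sum :: "complex \<Rightarrow> int \<Rightarrow> complex" where
  "row_sum z c = (if c = 0 then of_real pi ^ 2 / 3 else
     - 4 * of_real pi ^ 2 * (nome (of_int \<bar>c\<bar> * z) / (1 - nome (of_int \<bar>c\<bar> * z))\<^sup>2))"

lemma has_sum_int_inverse_squares: "((\<lambda>d::int. 1 / (of_int d :: complex)\<^sup>2) has_sum of_real pi ^ 2 / 3) UNIV"
proof -
  have s: "(\<lambda>n. 1 / (of_nat (Suc n) :: complex)\<^sup>2) sums (of_real pi ^ 2 / 6)"
    using sums_of_real[OF inverse_squares_sums, where ?'a = complex] by (simp add: add.commute)
  have n: "summable (\<lambda>n. norm (1 / (of_nat (Suc n) :: complex)\<^sup>2))"
    using summable_norm_inverse_square_shift[of 1] by simp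
  have s0: "(\<lambda>n. 1 / (of_nat n :: complex)\<^sup>2) sums (of_real pi ^ 2 / 6)"
    using s by (subst (asm) sums_Suc_iff) simp
  have n0: "summable (\<lambda>n. norm (1 / (of_nat n :: complex)\<^sup>2))"
    using summable_norm_inverse_square_shift[of 0] by simp
  have 1: "((\<lambda>n::nat. 1 / (of_int (int n) :: complex)\<^sup>2) has_sum of_real pi ^ 2 / 6) UNIV"
    using norm_summable_imp_has_sum[OF n0 s0] by simp
  have e: "(of_int (- 1 - int n) :: complex)\<^sup>2 = (of_nat (Suc n))\<^sup>2" for n
    by (simp add: power2_eq_square algebra_simps)
  have 2: "((\<lambda>n::nat. 1 / (of_int (- 1 - int n) :: complex)\<^sup>2) has_sum of_real pi ^ 2 / 6) UNIV"
    unfolding e by (rule norm_summable_imp_has_sum[OF n s])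
  show ?thesis using has_sum_int_split[OF 1 2] by simp
qed

lemma has_sum_reflect_int: "(f has_sum S) (UNIV :: int set) \<Longrightarrow> ((\<lambda>d. f (- d)) has_sum S) UNIV"
  by (rule has_sum_reindex_bij_witness[of _ uminus uminus, THEN iffD1, rotated -1]) auto

lemma has_sum_row:
  assumes z: "Im z > 0"
  shows "((\<lambda>d::int. 1 / (of_int c * z + of_int d)\<^sup>2) has_sum row_sum z c) UNIV"
proof (cases c "0 :: int" rule: linorder_cases)
  case equal
  then show ?thesis using has_sum_int_inverse_squares by (simp add: row_sum_def)
next
  case greater
  then have "Im (of_int c * z) > 0" using z by simp
  from has_sum_inverse_squares_upper[OF this] show ?thesis using greater by (simp add: row_sum_def)
next
  case less
  then have "Im (of_int (- c) * z) > 0" using z by (simp add: mult_neg_pos)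
  from has_sum_reflect_int[OF has_sum_inverse_squares_upper[OF this]]
  have "((\<lambda>d::int. 1 / (of_int (- c) * z + of_int (- d))\<^sup>2) has_sum row_sum z c) UNIV"
    using less by (simp add: row_sum_def)
  moreover have "(of_int (- c) * z + of_int (- d))\<^sup>2 = (of_int c * z + of_int d)\<^sup>2" for d
    by (simp add: power2_eq_square algebra_simps)
  ultimately show ?thesis by simp
qed

text \<open>The rows c and - c agree, so the Lambert series is counted twice; relative to pi^2 / 3
  its factor - 8 pi^2 becomes the - 24 of \<open>E2\<close>.\<close>

lemma has_sum_row_sum:
  assumes z: "Im z > 0"
  shows "(row_sum z has_sum of_real pi ^ 2 / 3 * E2 z) UNIV"
proof -
  define S where "S = - 4 * of_real pi ^ 2 * eval_fps (sigma_fps 1) (nome z)"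
  have "((\<lambda>c::nat. - 4 * of_real pi ^ 2 * (nome z ^ c / (1 - nome z ^ c)\<^sup>2)) has_sum S) {1..}"
    unfolding S_def by (intro has_sum_cmult_right has_sum_lambert_sigma norm_nome_less_1 z)
  then have S: "((\<lambda>c::nat. row_sum z (int c)) has_sum S) {1..}"
    by (rule has_sum_cong[THEN iffD1, rotated]) (auto simp: row_sum_def nome_mult_nat)
  have pos: "(row_sum z has_sum S) {1..}"
    using S by (rule has_sum_reindex_bij_witness[of _ nat int, THEN iffD1, rotated -1]) auto
  have neg: "(row_sum z has_sum S) {..-1}"
    using S by (rule has_sum_reindex_bij_witness[of _ "\<lambda>k. nat (- k)" "\<lambda>n. - int n", THEN iffD1, rotated -1])
      (auto simp: row_sum_def)
  have zero: "(row_sum z has_sum of_real pi ^ 2 / 3) {0}"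
    by (rule has_sum_finiteI) (auto simp: row_sum_def)
  have "(row_sum z has_sum (S + (S + of_real pi ^ 2 / 3))) ({1..} \<union> ({..-1} \<union> {0}))"
    by (intro has_sum_Un_disjoint pos neg zero) auto
  moreover have "{1..} \<union> ({..-1} \<union> {0}) = (UNIV :: int set)" by auto
  moreover have "S + (S + of_real pi ^ 2 / 3) = of_real pi ^ 2 / 3 * E2 z"
    by (simp add: S_def E2_def algebra_simps)
  ultimately show ?thesis by simp
qed

section \<open>Eisenstein's double series\<close>

lemma lattice_norm_bound:
  assumes z: "Im z > 0"
  obtains K where "K > 0" "\<And>c d :: real. \<bar>c\<bar> + \<bar>d\<bar> \<le> K * norm (of_real c * z + of_real d)"
proof
  define K where "K = 1 / Im z + 1 + norm z / Im z"
  show "K > 0" using z by (simp add: K_def add_pos_nonneg)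
  fix c d :: real
  define N where "N = norm (of_real c * z + of_real d)"
  have "\<bar>c\<bar> * Im z \<le> N"
    using abs_Im_le_cmod[of "of_real c * z + of_real d"] z by (simp add: N_def abs_mult)
  then have c: "\<bar>c\<bar> \<le> N / Im z" using z by (simp add: field_simps)
  have "\<bar>d\<bar> = norm ((of_real c * z + of_real d) - of_real c * z)" by simp
  also have "\<dots> \<le> N + \<bar>c\<bar> * norm z"
    unfolding N_def by (rule order_trans[OF norm_triangle_ineq4]) (simp add: norm_mult)
  also have "\<dots> \<le> N + N / Im z * norm z" by (intro add_left_mono mult_right_mono c) auto
  finally have "\<bar>c\<bar> + \<bar>d\<bar> \<le> K * N"
    using c by (simp add: K_def algebra_simps)
  then show "\<bar>c\<bar> + \<bar>d\<bar> \<le> K * norm (of_real c * z + of_real d)"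
    unfolding N_def .
qed

lemma has_sum_int_lim:
  assumes "(f has_sum S) (UNIV :: int set)"
  shows "(\<lambda>N. \<Sum>d\<in>{- int N..int N}. f d) \<longlonglongrightarrow> S"
proof -
  have "filterlim (\<lambda>N. {- int N..int N}) (finite_subsets_at_top UNIV) sequentially"
    unfolding filterlim_finite_subsets_at_top
  proof safe
    fix X :: "int set" assume X: "finite X"
    define M where "M = nat (Max (insert 0 (abs ` X)))"
    have M: "\<bar>x\<bar> \<le> int M" if "x \<in> X" for x
      using Max_ge[of "insert 0 (abs ` X)" "\<bar>x\<bar>"] X that unfolding M_def by auto
    show "\<forall>\<^sub>F N in sequentially. finite {- int N..int N} \<and> X \<subseteq> {- int N..int N} \<and> {- int N..int N} \<subseteq> UNIV"
      using eventually_ge_at_top[of M]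
    proof eventually_elim
      case (elim N)
      have "- int N \<le> x \<and> x \<le> int N" if "x \<in> X" for x
        using M[OF that] elim by linarith
      then show ?case by auto
    qed
  qed
  with assms show ?thesis unfolding has_sum_def by (rule filterlim_compose)
qed

text \<open>The subtracted term makes the double series absolutely convergent; its own iterated sums are
  telescoping, vanish along the rows, and give the correction term along the columns. The summand
  at the origin is \<open>0 + 4\<close>.\<close>

lemma summable_lattice_remainder:
  assumes z: "Im z > 0"
  shows "(\<lambda>(c::int, d::int). 1 / (of_int c * z + of_int d)\<^sup>2 - 1 / ((of_int c * z + of_int d)\<^sup>2 - (1/2)\<^sup>2))
    summable_on UNIV \<times> UNIV"
proof -
  obtain K where K: "K > 0" "\<And>c d :: real. \<bar>c\<bar> + \<bar>d\<bar> \<le> K * norm (of_real c * z + of_real d)"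
    using lattice_norm_bound[OF z] by blast
  define a where "a = (\<lambda>c::int. 1 / (1 + real_of_int \<bar>c\<bar>)\<^sup>2)"
  obtain A where A: "(a has_sum A) UNIV"
  proof -
    have s0: "summable (\<lambda>n::nat. 1 / (1 + real n)\<^sup>2)"
      using sums_summable[OF inverse_squares_sums] by (simp add: add.commute)
    then have s1: "summable (\<lambda>n::nat. 1 / (1 + real (Suc n))\<^sup>2)"
      by (subst summable_Suc_iff[of "\<lambda>n. 1 / (1 + real n)\<^sup>2"])
    obtain X Y where "((\<lambda>n::nat. 1 / (1 + real n)\<^sup>2) has_sum X) UNIV"
      "((\<lambda>n::nat. 1 / (1 + real (Suc n))\<^sup>2) has_sum Y) UNIV"
      using summable_nonneg_imp_summable_on[OF s0] summable_nonneg_imp_summable_on[OF s1]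
      by (auto simp: summable_on_def)
    then have "(a has_sum (X + Y)) UNIV"
      by (intro has_sum_int_split) (simp_all add: a_def abs_if algebra_simps)
    then show ?thesis by (rule that)
  qed
  \<comment> \<open>The larger of the value at the origin and of the constant that the estimate
    below yields elsewhere.\<close>
  define C where "C = max 4 (16 * K ^ 4)"
  have dom: "(\<lambda>(c, d). C * a c * a d) summable_on UNIV \<times> UNIV"
  proof (rule summable_on_SigmaI)
    show "((\<lambda>d. case (c, d) of (c, d) \<Rightarrow> C * a c * a d) has_sum (C * a c * A)) UNIV" for c
      using has_sum_cmult_right[OF A, of "C * a c"] by simp
    show "(\<lambda>c. C * a c * A) summable_on UNIV"
      using has_sum_cmult_left[OF has_sum_cmult_right[OF A, of C], of A] by (auto simp: summable_on_def)
  qed (auto simp: C_def a_def)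
  have bound: "norm (1 / (of_int c * z + of_int d)\<^sup>2 - 1 / ((of_int c * z + of_int d)\<^sup>2 - (1/2)\<^sup>2)) \<le> C * a c * a d"
    for c d :: int
  proof -
    define w where "w = of_int c * z + of_int d"
    show ?thesis
      unfolding w_def[symmetric]
    proof (cases "c = 0 \<and> d = 0")
      case True
      then show "norm (1 / w\<^sup>2 - 1 / (w\<^sup>2 - (1/2)\<^sup>2)) \<le> C * a c * a d"
        by (simp add: w_def C_def a_def power2_eq_square)
    next
      case False
      define s where "s = real_of_int \<bar>c\<bar> + real_of_int \<bar>d\<bar>"
      have s: "s \<ge> 1" using False unfolding s_def by linarith
      have w1: "s / K \<le> norm w"
        using K(2)[of "of_int c" "of_int d"] K(1) by (simp add: s_def w_def field_simps)
      \<comment> \<open>Away from the origin s \<ge> 1, so a shift by 1/2 costs at most half of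
        s.\<close>
      have w2: "s / 2 / K \<le> norm (w + of_real e)" if "\<bar>e\<bar> = 1 / 2" for e :: real
      proof -
        have "s / 2 \<le> \<bar>real_of_int c\<bar> + \<bar>real_of_int d + e\<bar>"
          using s that abs_triangle_ineq4[of "real_of_int d + e" e] unfolding s_def by simp
        also have "\<dots> \<le> K * norm (w + of_real e)"
          using K(2)[of "of_int c" "of_int d + e"] by (simp add: w_def add_ac)
        finally show ?thesis using K(1) by (simp add: field_simps)
      qed
      have pos: "s / K > 0" "s / 2 / K > 0" using s K(1) by auto
      have nz: "w \<noteq> 0" "w - 1 / 2 \<noteq> 0" "w + 1 / 2 \<noteq> 0"
        using w1 w2[of "1/2"] w2[of "-1/2"] pos by force+
      have fac: "w\<^sup>2 - (1/2)\<^sup>2 = (w - 1 / 2) * (w + 1 / 2)"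
        by (simp add: power2_eq_square algebra_simps)
      have "1 / w\<^sup>2 - 1 / (w\<^sup>2 - (1/2)\<^sup>2) = (w\<^sup>2 - (1/2)\<^sup>2 - w\<^sup>2) / (w\<^sup>2 * (w\<^sup>2 - (1/2)\<^sup>2))"
        by (rule diff_frac_eq[of _ _ 1 1, simplified mult_1]) (use nz fac in auto)
      also have "\<dots> = - (1 / 4) / (w\<^sup>2 * ((w - 1 / 2) * (w + 1 / 2)))"
        unfolding fac[symmetric] by (simp add: power2_eq_square)
      finally have "norm (1 / w\<^sup>2 - 1 / (w\<^sup>2 - (1/2)\<^sup>2))
          = (1 / 4) / (norm w ^ 2 * (norm (w - 1 / 2) * norm (w + 1 / 2)))"
        by (simp add: norm_divide norm_mult norm_power)
      also have "\<dots> \<le> (1 / 4) / ((s / K) ^ 2 * ((s / 2 / K) * (s / 2 / K)))"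
        using w1 w2[of "1/2"] w2[of "-1/2"] pos nz
        by (intro divide_left_mono mult_mono power_mono mult_pos_pos zero_less_power) auto
      also have "\<dots> = K ^ 4 / (s\<^sup>2)\<^sup>2"
        using pos by (simp add: field_simps power2_eq_square power4_eq_xxxx)
      \<comment> \<open>Bounding (1 + |c|) (1 + |d|) by 4 s^2 splits the decay s^(-4) into two
        summable factors, one in c and one in d.\<close>
      also have "\<dots> \<le> K ^ 4 / ((1 + real_of_int \<bar>c\<bar>) * (1 + real_of_int \<bar>d\<bar>) / 4)\<^sup>2"
      proof (intro divide_left_mono power_mono mult_pos_pos)
        have "(1 + real_of_int \<bar>c\<bar>) * (1 + real_of_int \<bar>d\<bar>) \<le> (1 + s) * (1 + s)"
          unfolding s_def by (intro mult_mono) auto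
        also have "\<dots> \<le> (2 * s) * (2 * s)" using s by (intro mult_mono) auto
        finally show "(1 + real_of_int \<bar>c\<bar>) * (1 + real_of_int \<bar>d\<bar>) / 4 \<le> s\<^sup>2"
          by (simp add: power2_eq_square)
      qed (use s K in \<open>auto intro!: zero_less_power divide_pos_pos mult_pos_pos\<close>)
      also have "\<dots> = 16 * K ^ 4 * (a c * a d)"
        by (simp add: a_def power_divide power_mult_distrib)
      also have "\<dots> \<le> C * (a c * a d)"
        by (intro mult_right_mono) (auto simp: C_def a_def)
      finally show "norm (1 / w\<^sup>2 - 1 / (w\<^sup>2 - (1/2)\<^sup>2)) \<le> C * a c * a d" by (simp add: mult.assoc)
    qed
  qed
  show ?thesis
  proof (rule abs_summable_summable, rule Infinite_Sum.abs_summable_on_comparison_test'[OF dom])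
    fix x :: "int \<times> int"
    obtain c d where x: "x = (c, d)" by (cases x)
    show "norm (case x of (c, d) \<Rightarrow> 1 / (of_int c * z + of_int d)\<^sup>2 - 1 / ((of_int c * z + of_int d)\<^sup>2 - (1/2)\<^sup>2))
        \<le> (case x of (c, d) \<Rightarrow> C * a c * a d)"
      unfolding x prod.case by (rule bound)
  qed
qed

lemma half_not_Int: "(1 / 2 :: complex) \<notin> \<int>"
  by (auto elim!: Ints_cases simp: complex_eq_iff)

text \<open>The absolutely convergent series has one sum T in both orders. Rows give E2(z); columns
  give E2(- 1 / z) / z^2 minus a telescoping sum of cotangents with value - 2 pi i / z. Comparing
  the two is the transformation law.\<close>

lemma E2_S:
  assumes z: "Im z > 0"
  shows "E2 (- 1 / z) = z\<^sup>2 * E2 z - 6 * \<i> * z / of_real pi"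
proof -
  define r where "r = (\<lambda>(c::int, d::int). 1 / (of_int c * z + of_int d)\<^sup>2
     - 1 / ((of_int c * z + of_int d)\<^sup>2 - (1/2)\<^sup>2))"
  obtain T where T: "(r has_sum T) (UNIV \<times> UNIV)"
    using summable_lattice_remainder[OF z] unfolding r_def summable_on_def by blast
  define K where "K = (\<lambda>w :: complex. of_real pi * cot (of_real pi * w))"
  have z0: "z \<noteq> 0" using z by auto
  define z' where "z' = - 1 / z"
  have z': "Im z' > 0" using z by (simp add: z'_def Im_divide_Reals Im_divide power2_eq_square add_nonneg_pos)
  have "(row_sum z has_sum T) UNIV"
  proof (rule has_sum_SigmaD[OF T])
    fix c :: int
    define u where "u = of_int c * z"
    have nI: "u - 1 / 2 \<notin> \<int>" "u + 1 / 2 \<notin> \<int>"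
    proof -
      have "c = 0 \<or> Im u \<noteq> 0" using z by (auto simp: u_def)
      then show "u - 1 / 2 \<notin> \<int>" "u + 1 / 2 \<notin> \<int>"
        using half_not_Int Ints_minus[of "- (1 / 2 :: complex)"] Im_pos_not_Int[of "u - 1/2"] Im_pos_not_Int[of "u + 1/2"]
        by (auto simp: u_def)
    qed
    \<comment> \<open>The two arguments differ by a period of the cotangent, so the subtracted row
      has sum 0, also for c = 0.\<close>
    have "cot (of_real pi * (u - 1 / 2)) = cot (of_real pi * (u + 1 / 2))"
      using cot_pi_plus_1[of "u - 1 / 2"] by (simp add: add.commute)
    with has_sum_inverse_quadratic[OF _ nI]
    have "((\<lambda>d::int. 1 / ((of_int d + u)\<^sup>2 - (1/2)\<^sup>2)) has_sum 0) UNIV" by simp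
    from has_sum_add[OF has_sum_row[OF z, of c] has_sum_uminusI[OF this]]
    show "((\<lambda>d. r (c, d)) has_sum row_sum z c) UNIV"
      by (simp add: r_def u_def add.commute)
  qed
  from has_sum_unique[OF this has_sum_row_sum[OF z]] have T_eq: "T = of_real pi ^ 2 / 3 * E2 z" .
  define \<psi> where "\<psi> = (\<lambda>d::int. (K ((of_int d - 1/2) / z) - K ((of_int d + 1/2) / z)) / z)"
  have "((\<lambda>(d, c). r (c, d)) has_sum T) (UNIV \<times> UNIV)"
    using T by (subst has_sum_swap) (simp add: case_prod_unfold)
  then have "((\<lambda>d. row_sum z' d / z\<^sup>2 - \<psi> d) has_sum T) UNIV"
  proof (rule has_sum_SigmaD)
    fix d :: int
    define u h where "u = of_int d / z" and "h = 1 / (2 * z)"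
    have Imz: "Im (of_real x / z) \<noteq> 0" if "x \<noteq> 0" for x :: real
      using that z by (auto simp: Im_divide power2_eq_square)
    have uh: "u - h = of_real (of_int d - 1 / 2) / z" "u + h = of_real (of_int d + 1 / 2) / z"
      using z0 by (simp_all add: u_def h_def field_simps)
    have "2 * d \<noteq> 1" "2 * d \<noteq> - 1" by presburger+
    then have "real_of_int (2 * d) \<noteq> real_of_int 1" "real_of_int (2 * d) \<noteq> real_of_int (- 1)"
      unfolding of_int_eq_iff by auto
    then have "real_of_int d - 1 / 2 \<noteq> 0" "real_of_int d + 1 / 2 \<noteq> 0" by (simp_all add: field_simps)
    then have nI: "u - h \<notin> \<int>" "u + h \<notin> \<int>"
      unfolding uh by (auto intro!: Im_pos_not_Int Imz simp del: of_real_diff of_real_add)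
    have q: "(of_int c * z + of_int d)\<^sup>2 - (1/2)\<^sup>2 = z\<^sup>2 * ((of_int c + u)\<^sup>2 - h\<^sup>2)" for c
      using z0 by (simp add: u_def h_def field_simps power2_eq_square)
    have "((\<lambda>c::int. 1 / ((of_int c + u)\<^sup>2 - h\<^sup>2) / z\<^sup>2) has_sum (K (u - h) - K (u + h)) / (2 * h) / z\<^sup>2) UNIV"
      unfolding K_def using z0 by (intro has_sum_divide_const has_sum_inverse_quadratic nI) (simp add: h_def)
    moreover have "(K (u - h) - K (u + h)) / (2 * h) / z\<^sup>2 = \<psi> d"
    proof -
      have "2 * h * z\<^sup>2 = z" using z0 by (simp add: h_def power2_eq_square)
      then show ?thesis unfolding \<psi>_def uh by (simp only: divide_divide_eq_left) simp
    qed
    ultimately have 1: "((\<lambda>c::int. 1 / ((of_int c * z + of_int d)\<^sup>2 - (1/2)\<^sup>2)) has_sum \<psi> d) UNIV"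
      unfolding q by (simp add: mult.commute)
    have p: "(of_int c * z + of_int d)\<^sup>2 = (of_int d * z' + of_int (- c))\<^sup>2 * z\<^sup>2" for c
      using z0 by (simp add: z'_def power2_eq_square field_simps)
    have "((\<lambda>c::int. 1 / (of_int c * z + of_int d)\<^sup>2) has_sum row_sum z' d / z\<^sup>2) UNIV"
      using has_sum_divide_const[OF has_sum_reflect_int[OF has_sum_row[OF z', of d]], of "z\<^sup>2"]
      unfolding p by simp
    from has_sum_add[OF this has_sum_uminusI[OF 1]]
    show "((\<lambda>c. case (d, c) of (d, c) \<Rightarrow> r (c, d)) has_sum row_sum z' d / z\<^sup>2 - \<psi> d) UNIV"
      by (simp add: r_def)
  qed
  from has_sum_add[OF has_sum_divide_const[OF has_sum_row_sum[OF z'], of "z\<^sup>2"] has_sum_uminusI[OF this]]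
  have "(\<psi> has_sum (of_real pi ^ 2 / 3 * E2 z' / z\<^sup>2 - T)) UNIV"
    by simp
  from has_sum_int_lim[OF this]
  have lim1: "(\<lambda>N. \<Sum>d\<in>{- int N..int N}. \<psi> d) \<longlonglongrightarrow> of_real pi ^ 2 / 3 * E2 z' / z\<^sup>2 - T" .
  \<comment> \<open>Over a symmetric range only the outermost cotangents survive. Their arguments
    are opposite, so oddness doubles one of them, taken at a point of the upper half-plane.\<close>
  have tele: "(\<Sum>d\<in>{- int N..int N}. \<psi> d) = 2 * K ((of_nat N + 1/2) * z') / z" for N
  proof -
    have Kodd: "K (- w) = - K w" for w by (simp add: K_def cot_def)
    have tel: "(\<Sum>d\<in>{- int N..int N}. \<psi> d) = (K ((- of_nat N - 1/2) / z) - K ((of_nat N + 1/2) / z)) / z"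
    proof (induction N)
      case 0
      then show ?case by (simp add: \<psi>_def)
    next
      case (Suc N)
      have "{- int (Suc N)..int (Suc N)} = insert (int (Suc N)) (insert (- int (Suc N)) {- int N..int N})"
        by auto
      then have "(\<Sum>d\<in>{- int (Suc N)..int (Suc N)}. \<psi> d)
          = \<psi> (int (Suc N)) + (\<psi> (- int (Suc N)) + (\<Sum>d\<in>{- int N..int N}. \<psi> d))" by simp
      also have "\<psi> (int (Suc N)) = (K ((of_nat N + 1/2) / z) - K ((of_nat (Suc N) + 1/2) / z)) / z"
        by (simp add: \<psi>_def algebra_simps)
      also have "\<psi> (- int (Suc N)) = (K ((- of_nat (Suc N) - 1/2) / z) - K ((- of_nat N - 1/2) / z)) / z"
      proof -
        have "of_int (- int (Suc N)) - 1/2 = - of_nat (Suc N) - (1/2 :: complex)"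
          "of_int (- int (Suc N)) + 1/2 = - of_nat N - (1/2 :: complex)" by (simp_all add: field_simps)
        then show ?thesis unfolding \<psi>_def by (simp only:)
      qed
      finally show ?case unfolding Suc.IH by (simp add: diff_divide_distrib)
    qed
    have e: "(- of_nat N - 1/2) / z = (of_nat N + 1/2) * z'" "(of_nat N + 1/2) / z = - ((of_nat N + 1/2) * z')"
      using z0 by (simp_all add: z'_def divide_simps)
    show ?thesis unfolding tel e Kodd by simp
  qed
  have lim2: "(\<lambda>N. 2 * K ((of_nat N + 1/2) * z') / z) \<longlonglongrightarrow> 2 * (- of_real pi * \<i>) / z"
  proof (intro tendsto_divide tendsto_mult tendsto_const)
    have pos: "Im ((of_nat N + 1/2) * z') > 0" for N :: nat
    proof -
      have "(of_nat N + 1/2) * z' = of_real (real N + 1/2) * z'" by simp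
      then show ?thesis using z' by (simp only: Im_complex_of_real mult_pos_pos times_complex.simps) (simp add: add_nonneg_pos)
    qed
    have "(\<lambda>N. nome ((of_nat N + 1/2) * z')) \<longlonglongrightarrow> 0"
    proof -
      have "(\<lambda>N. nome (z' / 2) * nome z' ^ N) \<longlonglongrightarrow> nome (z' / 2) * 0"
        by (intro tendsto_mult tendsto_const LIMSEQ_power_zero norm_nome_less_1 z')
      moreover have "nome (z' / 2) * nome z' ^ N = nome ((of_nat N + 1/2) * z')" for N
        unfolding nome_mult_nat[symmetric] exp_add[symmetric] by (simp add: algebra_simps)
      ultimately show ?thesis by (simp only: mult_zero_right)
    qed
    then have "(\<lambda>N. - of_real pi * \<i> - 2 * of_real pi * \<i> *
        (nome ((of_nat N + 1/2) * z') / (1 - nome ((of_nat N + 1/2) * z'))))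
      \<longlonglongrightarrow> - of_real pi * \<i> - 2 * of_real pi * \<i> * (0 / (1 - 0))"
      by (intro tendsto_intros) auto
    then show "(\<lambda>N. K ((of_nat N + 1/2) * z')) \<longlonglongrightarrow> - of_real pi * \<i>"
      unfolding K_def cot_nome[OF pos] by (simp only: div_0 mult_zero_right diff_0_right)
  qed (use z0 in auto)
  have "X * A = X * (z\<^sup>2 * B) - 6 * p * \<i> * z" if "X / 3 * A / z\<^sup>2 - X / 3 * B = 2 * (- p * \<i>) / z" for X A B p
  proof -
    have "X / 3 * A / z\<^sup>2 = X / 3 * B + 2 * (- p * \<i>) / z"
      using that by (simp only: diff_eq_eq add.commute)
    then have "X / 3 * A = (X / 3 * B + 2 * (- p * \<i>) / z) * z\<^sup>2"
      using z0 by (subst (asm) divide_eq_eq) simp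
    then have "3 * (X / 3 * A) = 3 * ((X / 3 * B + 2 * (- p * \<i>) / z) * z\<^sup>2)" by (rule arg_cong)
    then show ?thesis using z0 by (simp add: algebra_simps power2_eq_square)
  qed
  from this[OF LIMSEQ_unique[OF lim1[unfolded tele] lim2, unfolded T_eq]]
  have "of_real pi ^ 2 * E2 z' = of_real pi ^ 2 * (z\<^sup>2 * E2 z) - 6 * of_real pi * \<i> * z" .
  then have "of_real pi ^ 2 * E2 z' = of_real pi ^ 2 * (z\<^sup>2 * E2 z - 6 * \<i> * z / of_real pi)"
    by (simp add: algebra_simps power2_eq_square)
  moreover have "(of_real pi :: complex) ^ 2 \<noteq> 0" by simp
  ultimately show ?thesis unfolding z'_def using mult_left_cancel by blast
qed

section \<open>The discriminant\<close>

lemma DERIV_nome: "(nome has_field_derivative 2 * of_real pi * \<i> * nome z) (at z)"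
  by (auto intro!: derivative_eq_intros)

lemma nome_plus_1: "nome (z + 1) = nome z"
  by (simp add: algebra_simps exp_add)

lemma DERIV_eval_fps_nome:
  assumes "fps_conv_radius F \<ge> 1" "Im z > 0"
  shows "((\<lambda>z. eval_fps F (nome z)) has_field_derivative
    2 * of_real pi * \<i> * eval_fps (fps_X * fps_deriv F) (nome z)) (at z)"
proof -
  have q: "ereal (norm (nome z)) < fps_conv_radius F"
    by (intro norm_less_conv_radius norm_nome_less_1 assms)
  have q': "ereal (norm (nome z)) < fps_conv_radius (fps_deriv F)"
    by (intro norm_less_conv_radius norm_nome_less_1 assms order_trans[OF assms(1) fps_conv_radius_deriv])
  have "eval_fps (fps_X * fps_deriv F) (nome z) = nome z * eval_fps (fps_deriv F) (nome z)"
    using q' by (subst eval_fps_mult) auto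
  then show ?thesis
    using DERIV_chain2[OF has_field_derivative_eval_fps[OF q] DERIV_nome] by (simp add: mult_ac)
qed

lemma holomorphic_eval_fps_nome:
  assumes "fps_conv_radius F \<ge> 1"
  shows "(\<lambda>z. eval_fps F (nome z)) holomorphic_on {z. Im z > 0}"
  unfolding holomorphic_on_def field_differentiable_def
  using DERIV_eval_fps_nome[OF assms] by (blast intro: has_field_derivative_at_within)

definition delta_log_fps :: "complex fps" where
  "delta_log_fps = Abs_fps (\<lambda>n. of_nat (divisor_sigma 1 n) / of_nat n)"

lemma fps_conv_radius_delta_log: "fps_conv_radius delta_log_fps \<ge> 1"
proof (rule fps_conv_radius_polynomial_growth)
  show "norm (fps_nth delta_log_fps n) \<le> real n ^ 1" for n
    using divisor_sigma_le[of 1 n]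
    by (cases "n = 0") (simp_all add: delta_log_fps_def norm_divide field_simps flip: of_nat_mult)
qed

lemma fps_X_deriv_delta_log: "fps_X * fps_deriv delta_log_fps = sigma_fps 1"
proof (rule fps_ext)
  show "fps_nth (fps_X * fps_deriv delta_log_fps) n = fps_nth (sigma_fps 1) n" for n
    by (cases n) (simp_all add: delta_log_fps_def sigma_fps_def del: of_nat_Suc)
qed

text \<open>This is \<open>q \<Prod>\<^sub>n (1 - q\<^sup>n)\<^sup>2\<^sup>4\<close>: the coefficient of \<open>q\<^sup>n\<close> in
  \<open>- log (\<Prod>\<^sub>m (1 - q\<^sup>m))\<close> is \<open>\<sigma>\<^sub>1(n) / n\<close>.\<close>

definition delta :: "complex \<Rightarrow> complex" where
  "delta z = exp (2 * of_real pi * \<i> * z - 24 * eval_fps delta_log_fps (nome z))"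

lemma delta_nonzero [simp]: "delta z \<noteq> 0"
  by (simp add: delta_def)

lemma delta_eq_nome: "delta z = nome z * exp (- 24 * eval_fps delta_log_fps (nome z))"
  by (simp add: delta_def exp_diff exp_minus field_simps)

lemma DERIV_delta:
  assumes z: "Im z > 0"
  shows "(delta has_field_derivative 2 * of_real pi * \<i> * E2 z * delta z) (at z)"
proof -
  note d = DERIV_eval_fps_nome[OF fps_conv_radius_delta_log z, unfolded fps_X_deriv_delta_log]
  have "((\<lambda>z. exp (2 * of_real pi * \<i> * z - 24 * eval_fps delta_log_fps (nome z))) has_field_derivative
     exp (2 * of_real pi * \<i> * z - 24 * eval_fps delta_log_fps (nome z)) *
       (2 * of_real pi * \<i> * 1 - 24 * (2 * of_real pi * \<i> * eval_fps (sigma_fps 1) (nome z)))) (at z)"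
    by (intro DERIV_chain2[OF DERIV_exp] DERIV_diff DERIV_cmult DERIV_ident d)
  then show ?thesis
    unfolding delta_def[symmetric] E2_def by (rule DERIV_cong) (simp add: algebra_simps)
qed

lemma delta_T: "delta (z + 1) = delta z"
  by (simp add: delta_eq_nome nome_plus_1)

lemma Im_minus_inverse_pos: "Im z > 0 \<Longrightarrow> Im (- 1 / z) > 0"
  by (simp add: Im_divide power2_eq_square add_nonneg_pos)

text \<open>By \<open>E2_S\<close> both sides have the same logarithmic derivative, the correction
  term of \<open>E2\<close> being the 12 / z of z^12. The fixed point \<i> shows that the constant
  quotient is 1.\<close>

lemma delta_S:
  assumes z: "Im z > 0"
  shows "delta (- 1 / z) = z ^ 12 * delta z"
proof -
  let ?H = "{z :: complex. Im z > 0}"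
  have "\<exists>c. \<forall>z\<in>?H. delta (- 1 / z) / (z ^ 12 * delta z) = c"
  proof (rule has_field_derivative_zero_constant)
    show "convex ?H" by (rule convex_halfspace_Im_gt)
    fix z assume "z \<in> ?H"
    then have z: "Im z > 0" and z0: "z \<noteq> 0" by auto
    define k where "k = 2 * of_real pi * \<i> * E2 z + 12 / z"
    have "((\<lambda>z. - 1 / z) has_field_derivative 1 / z\<^sup>2) (at z)"
      using z0 by (auto intro!: derivative_eq_intros simp: power2_eq_square)
    from DERIV_chain2[OF DERIV_delta[OF Im_minus_inverse_pos[OF z]] this]
    have 1: "((\<lambda>z. delta (- 1 / z)) has_field_derivative k * delta (- 1 / z)) (at z)"
    proof (rule DERIV_cong)
      have "2 * of_real pi * \<i> * (z\<^sup>2 * E2 z - 6 * \<i> * z / of_real pi) * D * (1 / z\<^sup>2) = k * D" for D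
        using z0 by (simp add: k_def field_simps power2_eq_square)
      then show "2 * of_real pi * \<i> * E2 (- 1 / z) * delta (- 1 / z) * (1 / z\<^sup>2) = k * delta (- 1 / z)"
        unfolding E2_S[OF z] .
    qed
    have "((\<lambda>z. z ^ 12) has_field_derivative 12 * z ^ 11) (at z)"
      by (auto intro!: derivative_eq_intros)
    from DERIV_mult[OF this DERIV_delta[OF z]]
    have 2: "((\<lambda>z. z ^ 12 * delta z) has_field_derivative k * (z ^ 12 * delta z)) (at z)"
    proof (rule DERIV_cong)
      have "z ^ 12 = z ^ 11 * z" by (simp flip: power_Suc2)
      then show "12 * z ^ 11 * delta z + 2 * of_real pi * \<i> * E2 z * delta z * z ^ 12 = k * (z ^ 12 * delta z)"
        using z0 by (simp add: k_def field_simps)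
    qed
    have "((\<lambda>z. delta (- 1 / z) / (z ^ 12 * delta z)) has_field_derivative
       (k * delta (- 1 / z) * (z ^ 12 * delta z) - delta (- 1 / z) * (k * (z ^ 12 * delta z)))
         / ((z ^ 12 * delta z) * (z ^ 12 * delta z))) (at z)"
      using z0 by (intro DERIV_divide 1 2) auto
    moreover have "k * x * y - x * (k * y) = 0" for x y by simp
    ultimately show "((\<lambda>z. delta (- 1 / z) / (z ^ 12 * delta z)) has_field_derivative 0) (at z within ?H)"
      by (simp only: div_0 has_field_derivative_at_within)
  qed
  then obtain c where c: "\<And>z. Im z > 0 \<Longrightarrow> delta (- 1 / z) / (z ^ 12 * delta z) = c" by blast
  have "- 1 / \<i> = \<i>" by (simp add: field_simps)
  moreover have "\<i> ^ 12 = 1" using power_mult[of \<i> 4 3] by simp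
  ultimately have "c = 1" using c[of \<i>] by simp
  with c[OF z] have "delta (- 1 / z) / (z ^ 12 * delta z) = 1" by (simp only:)
  moreover have "z ^ 12 * delta z \<noteq> 0" using z by auto
  ultimately show ?thesis by (simp only: divide_eq_1_iff) 
qed

section \<open>The action of the modular group\<close>

text \<open>Separate integer entries keep determinants and divisibility as plain arithmetic;
  \<open>slash_matrix\<close> translates back to matrices.\<close>

definition moeb :: "int \<Rightarrow> int \<Rightarrow> int \<Rightarrow> int \<Rightarrow> complex \<Rightarrow> complex" where
  "moeb a b c d z = (of_int a * z + of_int b) / (of_int c * z + of_int d)"

lemma denom_nonzero:
  assumes "a * d - b * c = 1" "Im z > 0"
  shows "of_int c * z + of_int d \<noteq> 0"
proof
  assume eq: "of_int c * z + of_int d = 0"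
  then have "Im (of_int c * z + of_int d) = 0" by simp
  then have "c = 0" using assms by simp
  with eq assms show False by auto
qed

lemma Im_moeb:
  assumes "a * d - b * c = 1" "Im z > 0"
  shows "Im (moeb a b c d z) = Im z / norm (of_int c * z + of_int d) ^ 2"
proof -
  have "Im (moeb a b c d z) = Im ((of_int a * z + of_int b) * cnj (of_int c * z + of_int d)) / norm (of_int c * z + of_int d) ^ 2"
    unfolding moeb_def by (subst complex_div_cnj) (simp add: Im_divide_of_real del: complex_cnj_add complex_cnj_mult flip: of_real_power)
  also have "Im ((of_int a * z + of_int b) * cnj (of_int c * z + of_int d)) = of_int (a * d - b * c) * Im z"
    by (simp add: algebra_simps)
  finally show ?thesis using assms by simp
qed

lemma Im_moeb_pos:
  assumes "a * d - b * c = 1" "Im z > 0"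
  shows "Im (moeb a b c d z) > 0"
  using denom_nonzero[OF assms] assms(2) by (simp add: Im_moeb[OF assms])

lemma periodic_int:
  assumes T: "\<And>z. Im z > 0 \<Longrightarrow> f (z + 1) = f (z :: complex)" and z: "Im z > 0"
  shows "f (z + of_int k) = f z"
proof (induction k rule: int_induct[of _ 0])
  case (step1 i)
  then show ?case using T[of "z + of_int i"] z by (simp add: add.assoc)
next
  case (step2 i)
  then show ?case using T[of "z + of_int (i - 1)"] z by (simp add: add.assoc)
qed simp

text \<open>Euclid's algorithm on the first column: a translation by a div c followed by z -> - 1 /
  z replaces the lower left entry c by a mod c, until c = 0 leaves a translation. The even weight
  absorbs the signs.\<close>

lemma modular_by_generators:
  assumes T: "\<And>z. Im z > 0 \<Longrightarrow> f (z + 1) = f (z :: complex)"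
    and S: "\<And>z. Im z > 0 \<Longrightarrow> f (- 1 / z) = z ^ k * (f z :: complex)"
    and k: "even k"
    and det: "a * d - b * c = 1" and z: "Im z > 0"
  shows "f (moeb a b c d z) = (of_int c * z + of_int d) ^ k * f z"
  using det
proof (induction "nat \<bar>c\<bar>" arbitrary: a b c d rule: less_induct)
  case less
  show ?case
  proof (cases "c = 0")
    case True
    then have "a * d = 1" using less.prems by simp
    then have "a = 1 \<and> d = 1 \<or> a = -1 \<and> d = -1" by (auto simp: zmult_eq_1_iff)
    then have "moeb a b c d z = z + of_int (b * d)" "(of_int d :: complex) ^ k = 1"
      using True k by (auto simp: moeb_def)
    then show ?thesis using True periodic_int[of f, OF T z, of "b * d"] by simp
  next
    case False
    define m where "m = a div c"
    define a' b' where "a' = a - m * c" and "b' = b - m * d"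
    have "a' = a mod c" by (simp add: a'_def m_def minus_div_mult_eq_mod)
    then have lt: "nat \<bar>a'\<bar> < nat \<bar>c\<bar>" using False by (simp add: abs_mod_less)
    have det': "(- c) * b' - (- d) * a' = 1" using less.prems by (simp add: a'_def b'_def algebra_simps)
    define w where "w = moeb (- c) (- d) a' b' z"
    have w: "Im w > 0" unfolding w_def by (rule Im_moeb_pos[OF det' z])
    have nz: "of_int c * z + of_int d \<noteq> 0" "of_int a' * z + of_int b' \<noteq> 0"
      using denom_nonzero[OF less.prems z] denom_nonzero[OF det' z] by auto
    have w_eq: "w = - (of_int c * z + of_int d) / (of_int a' * z + of_int b')"
      by (simp add: w_def moeb_def)
    have mw: "- 1 / w = (of_int a' * z + of_int b') / (of_int c * z + of_int d)"
    proof -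
      have "- 1 / (- x / y) = y / x" for x y :: complex by simp
      then show ?thesis unfolding w_eq .
    qed
    have "of_int a * z + of_int b = (of_int a' * z + of_int b') + of_int m * (of_int c * z + of_int d)"
      by (simp add: a'_def b'_def algebra_simps)
    then have "moeb a b c d z = - 1 / w + of_int m"
      unfolding mw using nz(1) by (simp add: moeb_def add_divide_distrib)
    then have "f (moeb a b c d z) = f (- 1 / w)"
      using periodic_int[of f, OF T Im_minus_inverse_pos[OF w]] by simp
    also have "\<dots> = w ^ k * ((of_int a' * z + of_int b') ^ k * f z)"
      unfolding S[OF w] using less.hyps[OF lt det'] by (simp add: w_def)
    also have "\<dots> = (w * (of_int a' * z + of_int b')) ^ k * f z"
      by (simp add: power_mult_distrib)
    also have "w * (of_int a' * z + of_int b') = - (of_int c * z + of_int d)"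
      using nz by (simp add: w_eq)
    finally show ?thesis using k by (simp only: power_minus_even)
  qed
qed

lemma delta_modular:
  assumes "a * d - b * c = 1" "Im z > 0"
  shows "delta (moeb a b c d z) = (of_int c * z + of_int d) ^ 12 * delta z"
  by (rule modular_by_generators[OF delta_T delta_S]) (use assms in auto)

lemma DERIV_moeb:
  assumes "a * d - b * c = 1" "Im z > 0"
  shows "(moeb a b c d has_field_derivative 1 / (of_int c * z + of_int d)\<^sup>2) (at z)"
proof -
  let ?j = "of_int c * z + of_int d"
  have "((\<lambda>z. (of_int a * z + of_int b) / (of_int c * z + of_int d)) has_field_derivative
     (of_int a * ?j - (of_int a * z + of_int b) * of_int c) / (?j * ?j)) (at z)"
    using denom_nonzero[OF assms] by (auto intro!: derivative_eq_intros)
  moreover have "of_int a * ?j - (of_int a * z + of_int b) * of_int c = of_int (a * d - b * c)"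
    by (simp add: algebra_simps)
  ultimately show ?thesis using assms(1) by (simp add: moeb_def[abs_def] power2_eq_square)
qed

text \<open>\<open>E2\<close> has no pure factor of automorphy, so
  \<open>modular_by_generators\<close> does not apply to it directly; its law is the logarithmic
  derivative of the law of \<open>delta\<close>.\<close>

lemma E2_modular:
  assumes det: "a * d - b * c = 1" and z: "Im z > 0"
  shows "2 * of_real pi * \<i> * E2 (moeb a b c d z) =
    2 * of_real pi * \<i> * E2 z * (of_int c * z + of_int d)\<^sup>2 + 12 * of_int c * (of_int c * z + of_int d)"
proof -
  define j where "j = of_int c * z + of_int d"
  have j0: "j \<noteq> 0" unfolding j_def by (rule denom_nonzero[OF det z])
  have dj: "((\<lambda>z. (of_int c * z + of_int d) ^ 12) has_field_derivative 12 * j ^ 11 * of_int c) (at z)"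
    unfolding j_def by (auto intro!: derivative_eq_intros)
  have "((\<lambda>z. delta (moeb a b c d z)) has_field_derivative
      2 * of_real pi * \<i> * E2 (moeb a b c d z) * delta (moeb a b c d z) * (1 / j\<^sup>2)) (at z)"
    unfolding j_def by (rule DERIV_chain2[OF DERIV_delta[OF Im_moeb_pos[OF det z]] DERIV_moeb[OF det z]])
  moreover have "((\<lambda>z. delta (moeb a b c d z)) has_field_derivative
      12 * j ^ 11 * of_int c * delta z + 2 * of_real pi * \<i> * E2 z * delta z * j ^ 12) (at z)"
  proof (rule has_field_derivative_transform_within_open)
    show "((\<lambda>z. (of_int c * z + of_int d) ^ 12 * delta z) has_field_derivative
        12 * j ^ 11 * of_int c * delta z + 2 * of_real pi * \<i> * E2 z * delta z * j ^ 12) (at z)"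
      using DERIV_mult[OF dj DERIV_delta[OF z]] by (simp add: j_def)
    show "open {z. Im z > 0}" by (rule open_halfspace_Im_gt)
  qed (use z delta_modular[OF det] in auto)
  ultimately have eq: "2 * of_real pi * \<i> * E2 (moeb a b c d z) * delta (moeb a b c d z) * (1 / j\<^sup>2)
    = 12 * j ^ 11 * of_int c * delta z + 2 * of_real pi * \<i> * E2 z * delta z * j ^ 12"
    by (rule DERIV_unique)
  have p: "j ^ 12 = j ^ 10 * j\<^sup>2" "j ^ 11 = j ^ 10 * j"
    by (simp_all flip: power_add power_Suc2)
  have 1: "X * (j ^ 12 * D) * (1 / j\<^sup>2) = (j ^ 10 * D) * X" for X D
  proof -
    have "X * (a * b * D) * (1 / b) = (a * D) * X" if "b \<noteq> 0" for a b
      using that by simp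
    from this[of "j\<^sup>2" "j ^ 10"] show ?thesis using j0 unfolding p(1) by simp
  qed
  have 2: "12 * j ^ 11 * C * D + Y * D * j ^ 12 = (j ^ 10 * D) * (Y * j\<^sup>2 + 12 * C * j)" for C D Y
    unfolding p by (simp add: algebra_simps)
  have "j ^ 10 * delta z \<noteq> 0" using j0 by simp
  with eq show ?thesis
    unfolding delta_modular[OF det z] j_def[symmetric] 1 2 using mult_left_cancel by blast
qed

section \<open>The Eisenstein series of weight 4\<close>

definition D_E2 :: "complex \<Rightarrow> complex" where
  "D_E2 z = - 24 * eval_fps (fps_X * fps_deriv (sigma_fps 1)) (nome z)"

text \<open>Ramanujan's differential equation for \<open>E2\<close>, read as a definition.
  Modularity then follows by differentiation, and Liouville's convolution supplies the Fourier
  coefficients in \<open>E4_eq\<close>.\<close>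

definition E4 :: "complex \<Rightarrow> complex" where
  "E4 z = E2 z ^ 2 - 12 * D_E2 z"

lemma DERIV_E2:
  assumes z: "Im z > 0"
  shows "(E2 has_field_derivative 2 * of_real pi * \<i> * D_E2 z) (at z)"
proof -
  have "((\<lambda>z. 1 - 24 * eval_fps (sigma_fps 1) (nome z)) has_field_derivative
    0 - 24 * (2 * of_real pi * \<i> * eval_fps (fps_X * fps_deriv (sigma_fps 1)) (nome z))) (at z)"
    by (intro DERIV_diff DERIV_const DERIV_cmult DERIV_eval_fps_nome fps_conv_radius_sigma z)
  then show ?thesis unfolding E2_def[symmetric] by (simp add: D_E2_def mult_ac)
qed

text \<open>Differentiating the law of \<open>E2\<close> produces terms linear in \<open>E2\<close>
  and free of it. They are proportional to those arising from the square of the law, and the factor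
  12 makes them cancel.\<close>

lemma E4_modular:
  assumes det: "a * d - b * c = 1" and z: "Im z > 0"
  shows "E4 (moeb a b c d z) = (of_int c * z + of_int d) ^ 4 * E4 z"
proof -
  define j where "j = of_int c * z + of_int d"
  have j0: "j \<noteq> 0" unfolding j_def by (rule denom_nonzero[OF det z])
  define p where "p = 2 * of_real pi * \<i>"
  have p0: "p \<noteq> 0" by (simp add: p_def)
  have E2: "E2 (moeb a b c d z) = E2 z * (of_int c * z + of_int d)\<^sup>2 + 12 * of_int c / p * (of_int c * z + of_int d)"
    if "Im z > 0" for z
    using E2_modular[OF det that] p0 unfolding p_def[symmetric] by (simp add: field_simps)
  have "((\<lambda>z. E2 (moeb a b c d z)) has_field_derivative p * D_E2 (moeb a b c d z) * (1 / j\<^sup>2)) (at z)"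
    unfolding j_def p_def by (rule DERIV_chain2[OF DERIV_E2[OF Im_moeb_pos[OF det z]] DERIV_moeb[OF det z]])
  moreover have "((\<lambda>z. E2 (moeb a b c d z)) has_field_derivative
      p * D_E2 z * j\<^sup>2 + 2 * j * of_int c * E2 z + 12 * of_int c / p * of_int c) (at z)"
  proof (rule has_field_derivative_transform_within_open)
    have dj: "((\<lambda>z. (of_int c * z + of_int d)\<^sup>2) has_field_derivative 2 * j * of_int c) (at z)"
      "((\<lambda>z. of_int c * z + of_int d) has_field_derivative of_int c) (at z)"
      unfolding j_def by (auto intro!: derivative_eq_intros)
    show "((\<lambda>z. E2 z * (of_int c * z + of_int d)\<^sup>2 + 12 * of_int c / p * (of_int c * z + of_int d)) has_field_derivative
        p * D_E2 z * j\<^sup>2 + 2 * j * of_int c * E2 z + 12 * of_int c / p * of_int c) (at z)"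
      using DERIV_add[OF DERIV_mult[OF DERIV_E2[OF z] dj(1)] DERIV_cmult[OF dj(2), of "12 * of_int c / p"]]
      by (simp add: j_def p_def)
    show "open {z. Im z > 0}" by (rule open_halfspace_Im_gt)
  qed (use z E2 in auto)
  ultimately have "p * D_E2 (moeb a b c d z) * (1 / j\<^sup>2)
      = p * D_E2 z * j\<^sup>2 + 2 * j * of_int c * E2 z + 12 * of_int c / p * of_int c"
    by (rule DERIV_unique)
  then have D: "D_E2 (moeb a b c d z) = (p * D_E2 z * j\<^sup>2 + 2 * j * of_int c * E2 z + 12 * of_int c / p * of_int c) * j\<^sup>2 / p"
    using j0 p0 by (simp add: divide_simps mult_ac)
  show ?thesis
    unfolding E4_def E2[OF z] D j_def[symmetric] using p0
    by (simp add: power2_eq_square power4_eq_xxxx field_simps)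
qed

lemma conv_W_cauchy: "(\<Sum>i=0..n. divisor_sigma 1 i * divisor_sigma 1 (n - i)) = conv_W 1 n"
  unfolding conv_W_def
proof (rule sum.mono_neutral_cong_right)
  show "\<forall>i\<in>{0..n} - {m. 0 < m \<and> 1 * m < n}. divisor_sigma 1 i * divisor_sigma 1 (n - i) = 0"
  proof
    fix i assume "i \<in> {0..n} - {m. 0 < m \<and> 1 * m < n}"
    then have "i = 0 \<or> i = n" by auto
    then show "divisor_sigma 1 i * divisor_sigma 1 (n - i) = 0" by auto
  qed
qed auto

lemma E4_eq: 
  assumes z: "Im z > 0"
  shows "E4 z = 1 + 240 * eval_fps (sigma_fps 3) (nome z)"
proof -
  define s where "s = sigma_fps 1"
  \<comment> \<open>At every positive index this is \<open>conv_W_1\<close> multiplied by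
    48.\<close>
  have id: "(1 - 24 * s) ^ 2 + 288 * (fps_X * fps_deriv s) = 1 + 240 * sigma_fps 3"
  proof (rule fps_ext)
    fix n
    have "(1 - 24 * s) ^ 2 = 1 - 48 * s + 576 * (s * s)" by (simp add: power2_eq_square algebra_simps)
    then have "fps_nth ((1 - 24 * s) ^ 2 + 288 * (fps_X * fps_deriv s)) n
      = fps_nth 1 n - 48 * fps_nth s n + 576 * fps_nth (s * s) n + 288 * fps_nth (fps_X * fps_deriv s) n"
      by simp
    also have "fps_nth (fps_X * fps_deriv s) n = of_nat n * fps_nth s n"
      by (cases n) simp_all
    also have "fps_nth (s * s) n = of_nat (conv_W 1 n)"
      unfolding conv_W_cauchy[symmetric] by (simp add: fps_mult_nth s_def sigma_fps_def)
    also have "fps_nth 1 n - 48 * fps_nth s n + 576 * of_nat (conv_W 1 n) + 288 * (of_nat n * fps_nth s n)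
       = fps_nth (1 + 240 * sigma_fps 3) n"
    proof (cases "n = 0")
      case True
      then show ?thesis by (simp add: s_def sigma_fps_def conv_W_def)
    next
      case False
      then have "(of_int (12 * int (conv_W 1 n)) :: complex) = of_int (5 * int (divisor_sigma 3 n) - (6 * int n - 1) * int (divisor_sigma 1 n))"
        by (subst conv_W_1) auto
      then have "12 * (of_nat (conv_W 1 n) :: complex) = 5 * of_nat (divisor_sigma 3 n) - (6 * of_nat n - 1) * of_nat (divisor_sigma 1 n)"
        by simp
      then have "48 * (12 * (of_nat (conv_W 1 n) :: complex)) = 48 * (5 * of_nat (divisor_sigma 3 n) - (6 * of_nat n - 1) * of_nat (divisor_sigma 1 n))"
        by (rule arg_cong)
      moreover have "fps_nth (1 + 240 * sigma_fps 3) n = 240 * of_nat (divisor_sigma 3 n)"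
        "fps_nth s n = of_nat (divisor_sigma 1 n)" "fps_nth 1 n = (0 :: complex)"
        using False by (simp_all add: sigma_fps_def s_def)
      ultimately show ?thesis by (simp add: algebra_simps)
    qed
    finally show "fps_nth ((1 - 24 * s) ^ 2 + 288 * (fps_X * fps_deriv s)) n = fps_nth (1 + 240 * sigma_fps 3) n" .
  qed
  define q where "q = nome z"
  have q: "norm q < 1" unfolding q_def by (rule norm_nome_less_1[OF z])
  note r = norm_less_conv_radius[OF q]
  have rs: "fps_conv_radius s \<ge> 1" unfolding s_def by (rule fps_conv_radius_sigma)
  have ec: "eval_fps (numeral k * F) q = numeral k * eval_fps F q" if "fps_conv_radius F \<ge> 1" for k and F :: "complex fps"
    using r[OF that] by (subst eval_fps_mult) auto
  have E2_q: "E2 z = 1 - 24 * eval_fps s q" unfolding E2_def s_def q_def ..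
  have D_q: "D_E2 z = - 24 * eval_fps (fps_X * fps_deriv s) q" unfolding D_E2_def s_def q_def ..
  have "eval_fps (1 - 24 * s) q = 1 - 24 * eval_fps s q"
    by (subst eval_fps_diff) (auto intro!: r conv_radius_ge_1_intros rs simp: ec[OF rs])
  then have "eval_fps ((1 - 24 * s) ^ 2) q = E2 z ^ 2"
    unfolding E2_q by (subst eval_fps_power) (auto intro!: r conv_radius_ge_1_intros rs)
  moreover have "eval_fps (288 * (fps_X * fps_deriv s)) q = - 12 * D_E2 z"
    unfolding D_q by (subst ec) (auto intro!: conv_radius_ge_1_intros rs)
  ultimately have "eval_fps ((1 - 24 * s) ^ 2 + 288 * (fps_X * fps_deriv s)) q = E4 z"
    by (subst eval_fps_add) (auto intro!: r conv_radius_ge_1_intros rs simp: E4_def)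
  moreover have "eval_fps (1 + 240 * sigma_fps 3) q = 1 + 240 * eval_fps (sigma_fps 3) q"
    by (subst eval_fps_add) (auto intro!: r conv_radius_ge_1_intros fps_conv_radius_sigma
        simp: ec[OF fps_conv_radius_sigma])
  ultimately show ?thesis unfolding id q_def by simp
qed

section \<open>A maximum principle for the group of level 11\<close>

text \<open>A pair (c, d) minimising |c z + d| is coprime and hence the bottom row of a matrix of
  determinant 1. Comparison with its top row gives |w| \<ge> 1, and |Re w| \<le> 1/2 then bounds Im
  w from below; 1/2 is a convenient weakening of sqrt 3 / 2.\<close>

lemma exists_fundamental_point:
  assumes z: "Im z > 0"
  obtains a b c d :: int where "a * d - b * c = 1"
    "\<bar>Re (moeb a b c d z)\<bar> \<le> 1 / 2" "Im (moeb a b c d z) \<ge> 1 / 2"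
proof -
  define L where "L = {(c :: int, d :: int). (c, d) \<noteq> (0, 0) \<and> norm (of_int c * z + of_int d) \<le> 1}"
  obtain K where K: "K > 0" "\<And>c d :: real. \<bar>c\<bar> + \<bar>d\<bar> \<le> K * norm (of_real c * z + of_real d)"
    using lattice_norm_bound[OF z] by blast
  have "L \<subseteq> {- \<lceil>K\<rceil>..\<lceil>K\<rceil>} \<times> {- \<lceil>K\<rceil>..\<lceil>K\<rceil>}"
  proof clarify
    fix c d assume "(c, d) \<in> L"
    then have "norm (of_int c * z + of_int d) \<le> 1" by (simp add: L_def)
    then have "K * norm (of_int c * z + of_int d) \<le> K" using K(1) by simp
    then have "\<bar>real_of_int c\<bar> + \<bar>real_of_int d\<bar> \<le> K"
      using K(2)[of "of_int c" "of_int d"] by simp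
    then have "\<bar>real_of_int c\<bar> \<le> K" "\<bar>real_of_int d\<bar> \<le> K" by linarith+
    then show "c \<in> {- \<lceil>K\<rceil>..\<lceil>K\<rceil>} \<and> d \<in> {- \<lceil>K\<rceil>..\<lceil>K\<rceil>}"
      by (auto simp: abs_le_iff) linarith+
  qed
  then have fin: "finite L" by (rule finite_subset) auto
  have "(0, 1) \<in> L" by (simp add: L_def)
  then have "L \<noteq> {}" by blast
  \<comment> \<open>Pairs outside the finite set \<open>L\<close> have norm above 1 and so cannot
    beat (0, 1); the minimum over \<open>L\<close> is a global one.\<close>
  define N where "N = (\<lambda>p :: int \<times> int. norm (of_int (fst p) * z + of_int (snd p)))"
  define p where "p = arg_min_on N L"
  have p: "p \<in> L" "\<And>p'. p' \<in> L \<Longrightarrow> N p \<le> N p'"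
    using arg_min_if_finite[OF fin \<open>L \<noteq> {}\<close>, of N] unfolding p_def by (auto simp: not_less)
  obtain c d where cd: "p = (c, d)" by (cases p)
  have min: "norm (of_int c * z + of_int d) \<le> norm (of_int c' * z + of_int d')"
    if "(c', d') \<noteq> (0, 0)" for c' d' :: int
  proof (cases "norm (of_int c' * z + of_int d') \<le> 1")
    case True
    then show ?thesis using p(2)[of "(c', d')"] that by (simp add: L_def N_def cd)
  next
    case False
    then show ?thesis using p(1) by (simp add: L_def cd)
  qed
  have nz: "(c, d) \<noteq> (0, 0)" using p(1) by (auto simp: L_def cd)
  have jnz: "of_int c * z + of_int d \<noteq> 0"
  proof
    assume eq: "of_int c * z + of_int d = 0"
    then have "Im (of_int c * z + of_int d) = 0" by simp
    then have "c = 0" using z by simp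
    with eq nz show False by auto
  qed
  have "coprime c d"
  proof (rule ccontr)
    assume nc: "\<not> coprime c d"
    define g where "g = gcd c d"
    have g: "g \<ge> 2" using nc nz unfolding g_def coprime_iff_gcd_eq_1
      by (smt (verit) gcd_eq_0_iff gcd_ge_0_int prod.inject)
    obtain c' d' where c': "c = g * c'" "d = g * d'"
      unfolding g_def by (meson dvdE gcd_dvd1 gcd_dvd2)
    then have nz': "(c', d') \<noteq> (0, 0)" using nz by auto
    have "of_int c * z + of_int d = of_int g * (of_int c' * z + of_int d')"
      by (simp add: c' algebra_simps)
    then have e: "norm (of_int c * z + of_int d) = of_int g * norm (of_int c' * z + of_int d')"
      using g by (simp add: norm_mult)
    have pos: "norm (of_int c' * z + of_int d') > 0" using e jnz by (metis mult_zero_right norm_eq_zero zero_less_norm_iff)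
    have "2 * norm (of_int c' * z + of_int d') \<le> of_int g * norm (of_int c' * z + of_int d')"
      using g pos by (intro mult_right_mono) auto
    then show False using min[OF nz'] e pos by linarith
  qed
  then obtain a0 b0 where ab0: "a0 * d - b0 * c = 1"
  proof -
    obtain u v where "u * c + v * d = gcd c d" using bezout_int by blast
    then have "v * d - (- u) * c = 1" using \<open>coprime c d\<close> by (simp add: algebra_simps)
    then show ?thesis by (rule that)
  qed
  define m where "m = round (Re (moeb a0 b0 c d z))"
  define a b where "a = a0 - m * c" and "b = b0 - m * d"
  have det: "a * d - b * c = 1" using ab0 by (simp add: a_def b_def algebra_simps)
  define w where "w = moeb a b c d z"
  have w_eq: "w = moeb a0 b0 c d z - of_int m"
  proof -
    have "of_int a * z + of_int b = (of_int a0 * z + of_int b0) - of_int m * (of_int c * z + of_int d)"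
      by (simp add: a_def b_def algebra_simps)
    then show ?thesis using jnz by (simp add: w_def moeb_def diff_divide_distrib)
  qed
  have re: "\<bar>Re w\<bar> \<le> 1 / 2"
    unfolding w_eq m_def using of_int_round_abs_le[of "Re (moeb a0 b0 c d z)"] by (simp add: abs_minus_commute)
  have "(a, b) \<noteq> (0, 0)" using det by auto
  from min[OF this] have "norm w \<ge> 1"
    using jnz by (simp add: w_def moeb_def norm_divide)
  then have "(Re w)\<^sup>2 + (Im w)\<^sup>2 \<ge> 1" by (simp add: cmod_def)
  moreover have "(Re w)\<^sup>2 \<le> (1 / 2)\<^sup>2" using re by (subst abs_le_square_iff[symmetric]) simp
  ultimately have "(1 / 2)\<^sup>2 \<le> (Im w)\<^sup>2" by (simp add: power2_eq_square)
  moreover have "Im w > 0" unfolding w_def by (rule Im_moeb_pos[OF det z])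
  ultimately have "Im w \<ge> 1 / 2" by (meson power2_le_imp_le less_imp_le)
  with re det show ?thesis unfolding w_def by (intro that)
qed

lemma moeb_inverse:
  assumes det: "a * d - b * c = 1" and z: "Im z > 0"
  shows "moeb d (- b) (- c) a (moeb a b c d z) = z"
proof -
  define j where "j = of_int c * z + of_int d"
  have j0: "j \<noteq> 0" unfolding j_def by (rule denom_nonzero[OF det z])
  have num: "of_int d * (of_int a * z + of_int b) - of_int b * j = of_int (a * d - b * c) * z"
    by (simp add: j_def algebra_simps)
  have den: "- of_int c * (of_int a * z + of_int b) + of_int a * j = of_int (a * d - b * c)"
    by (simp add: j_def algebra_simps)
  define N where "N = of_int a * z + of_int b"
  have 1: "of_int d * (N / j) + of_int (- b) = (of_int d * N - of_int b * j) / j"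
    "of_int (- c) * (N / j) + of_int a = (- of_int c * N + of_int a * j) / j"
    using j0 by (simp_all add: diff_divide_distrib)
  show ?thesis
    unfolding moeb_def N_def[symmetric] j_def[symmetric] 1
    unfolding N_def num den det using j0 by simp
qed

lemma moeb_comp_S:
  assumes z: "Im z > 0"
  shows "moeb a b c d (- 1 / z) = moeb b (- a) d (- c) z"
proof -
  have "z \<noteq> 0" using z by auto
  then have "of_int a * (- 1 / z) + of_int b = (of_int b * z + of_int (- a)) / z"
    "of_int c * (- 1 / z) + of_int d = (of_int d * z + of_int (- c)) / z"
    by (simp_all add: field_simps)
  then show ?thesis using \<open>z \<noteq> 0\<close> unfolding moeb_def by simp
qed

definition Gamma0_11_invariant :: "(complex \<Rightarrow> complex) \<Rightarrow> bool" where
  "Gamma0_11_invariant g \<longleftrightarrow> (\<forall>a b c d z. a * d - b * c = 1 \<and> 11 dvd c \<and> Im z > 0 \<longrightarrow> g (moeb a b c d z) = g z)"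

text \<open>The group of level 11 has two classes of cusps, so the translates of the fundamental domain
  reach every point through \<open>g\<close> itself or through \<open>g (- 1 / w)\<close>.\<close>

lemma invariant_reduction:
  assumes g: "Gamma0_11_invariant g" and z: "Im z > 0"
  obtains w where "\<bar>Re w\<bar> \<le> 12" "Im w \<ge> 1 / 2" "g z = g w \<or> g z = g (- 1 / w)"
proof -
  obtain a b c d :: int where det: "a * d - b * c = 1"
    and re: "\<bar>Re (moeb a b c d z)\<bar> \<le> 1 / 2" and im: "Im (moeb a b c d z) \<ge> 1 / 2"
    by (rule exists_fundamental_point[OF z])
  define w where "w = moeb a b c d z"
  have w: "Im w > 0" unfolding w_def by (rule Im_moeb_pos[OF det z])
  have zw: "moeb d (- b) (- c) a w = z" unfolding w_def by (rule moeb_inverse[OF det z])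
  have det': "d * a - (- b) * (- c) = 1" using det by (simp add: algebra_simps)
  show ?thesis
  proof (cases "11 dvd c")
    case True
    then have "g z = g w"
      using g[unfolded Gamma0_11_invariant_def, rule_format, of d a "- b" "- c" w] det' w zw by simp
    then show ?thesis using re im by (intro that[of w]) (auto simp: w_def)
  next
    case False
    have "coprime c 11"
    proof -
      have "prime (11 :: int)" by simp
      with False show ?thesis using prime_imp_coprime coprime_commute by blast
    qed
    then obtain u v where uv: "u * c + v * 11 = 1"
      using bezout_int[of c 11] by auto
    \<comment> \<open>With u inverse to c modulo 11, this j solves a + c j \<equiv> 0 modulo 11.
      Shifting by j \<le> 10 is what widens the strip to |Re w| \<le> 12.\<close>
    define j where "j = (- a * u) mod 11"
    have j: "0 \<le> j" "j < 11" by (simp_all add: j_def)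
    define t where "t = (- a * u) div 11"
    have "- a * u = 11 * t + j" unfolding j_def t_def by simp
    then have "j = - a * u - 11 * t" by simp
    moreover have "a + c * (- a * u - 11 * t) = a * (1 - u * c) - 11 * (t * c)" by (simp add: algebra_simps)
    ultimately have "a + c * j = a * (1 - u * c) - 11 * (t * c)" by simp
    also have "1 - u * c = v * 11" using uv by simp
    finally have dvd: "11 dvd a + c * j" by simp
    define w' where "w' = w + of_int j"
    have w': "Im w' > 0" using w by (simp add: w'_def)
    have "moeb d (- b) (- c) a w = moeb d (- b - d * j) (- c) (a + c * j) w'"
      by (simp add: moeb_def w'_def algebra_simps)
    also have "\<dots> = moeb (- b - d * j) (- d) (a + c * j) c (- 1 / w')"
      using moeb_comp_S[OF Im_minus_inverse_pos[OF w'], of d "- b - d * j" "- c" "a + c * j"] by simp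
    finally have "z = moeb (- b - d * j) (- d) (a + c * j) c (- 1 / w')" using zw by simp
    moreover have "(- b - d * j) * c - (- d) * (a + c * j) = 1" using det by (simp add: algebra_simps)
    ultimately have "g z = g (- 1 / w')"
      using g dvd Im_minus_inverse_pos[OF w'] unfolding Gamma0_11_invariant_def by blast
    then show ?thesis using re im j by (intro that[of w']) (auto simp: w_def w'_def)
  qed
qed

lemma filtercomap_Im_nontrivial: "filtercomap Im at_top \<noteq> (bot :: complex filter)"
proof -
  have "surj Im" by (metis complex.sel(2) surjI)
  then show ?thesis by (simp add: filtercomap_neq_bot_surj)
qed

lemma eventually_Im_pos: "\<forall>\<^sub>F z in filtercomap Im at_top. Im z > 0"
  unfolding eventually_filtercomap_at_top_dense by blast

text \<open>The two limits of g may differ, so the maximum principle is applied to (g - c1) (g -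
  c0), which tends to 0 at both cusps. Once this product vanishes, g takes at most two values and is
  constant by connectedness.\<close>

lemma invariant_constant:
  assumes inv: "Gamma0_11_invariant g" and hol: "g holomorphic_on {z. Im z > 0}"
    and lim_inf: "(g \<longlongrightarrow> c1) (filtercomap Im at_top)"
    and lim_0: "((\<lambda>z. g (- 1 / z)) \<longlongrightarrow> c0) (filtercomap Im at_top)"
    and z: "Im z > 0"
  shows "g z = c1"
proof -
  let ?H = "{z :: complex. Im z > 0}"
  have openH: "open ?H" by (rule open_halfspace_Im_gt)
  have connH: "connected ?H" by (rule convex_connected[OF convex_halfspace_Im_gt])
  define h where "h = (\<lambda>z. (g z - c1) * (g z - c0))"
  define h' where "h' = (\<lambda>z. h (- 1 / z))"
  have inv_h: "Gamma0_11_invariant h" using inv by (simp add: Gamma0_11_invariant_def h_def)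
  have hol_h: "h holomorphic_on ?H" unfolding h_def by (intro holomorphic_intros hol)
  have hol_h': "h' holomorphic_on ?H"
  proof -
    have "(\<lambda>z. - 1 / z) holomorphic_on ?H" by (auto intro!: holomorphic_intros)
    moreover have "(\<lambda>z. - 1 / z) ` ?H \<subseteq> ?H" using Im_minus_inverse_pos by blast
    ultimately show ?thesis
      using holomorphic_on_compose_gen[OF _ hol_h] unfolding h'_def o_def by blast
  qed
  have "(h \<longlongrightarrow> (c1 - c1) * (c1 - c0)) (filtercomap Im at_top)"
    unfolding h_def by (intro tendsto_intros lim_inf)
  then have lim_h: "(h \<longlongrightarrow> 0) (filtercomap Im at_top)" by simp
  have "(h' \<longlongrightarrow> (c0 - c1) * (c0 - c0)) (filtercomap Im at_top)"
    unfolding h_def h'_def by (intro tendsto_intros lim_0)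
  then have lim_h': "(h' \<longlongrightarrow> 0) (filtercomap Im at_top)" by simp
  have h0: "h z = 0" if z: "Im z > 0" for z
  proof (rule ccontr)
    assume nz: "h z \<noteq> 0"
    define \<epsilon> where "\<epsilon> = norm (h z)"
    have \<epsilon>: "\<epsilon> > 0" using nz by (simp add: \<epsilon>_def)
    have "\<forall>\<^sub>F z in filtercomap Im at_top. norm (h z) < \<epsilon> \<and> norm (h' z) < \<epsilon>"
      using tendstoD[OF lim_h \<epsilon>] tendstoD[OF lim_h' \<epsilon>] by eventually_elim simp
    then obtain Y where Y: "\<And>z. Im z > Y \<Longrightarrow> norm (h z) < \<epsilon> \<and> norm (h' z) < \<epsilon>"
      unfolding eventually_filtercomap_at_top_dense by blast
    define R where "R = cbox (Complex (- 12) (1 / 2)) (Complex 12 Y)"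
    have R: "w \<in> R \<longleftrightarrow> \<bar>Re w\<bar> \<le> 12 \<and> 1 / 2 \<le> Im w \<and> Im w \<le> Y" for w
      by (auto simp: R_def in_cbox_complex_iff)
    have RH: "R \<subseteq> ?H" using R by force
    have red: "\<exists>w\<in>R. norm (h v) \<le> max (norm (h w)) (norm (h' w))" if v: "Im v > 0" "norm (h v) \<ge> \<epsilon>" for v
    proof -
      obtain w where w: "\<bar>Re w\<bar> \<le> 12" "Im w \<ge> 1 / 2" "h v = h w \<or> h v = h (- 1 / w)"
        using invariant_reduction[OF inv_h v(1)] by blast
      then have "norm (h v) \<le> max (norm (h w)) (norm (h' w))" by (auto simp: h'_def)
      moreover have "Im w \<le> Y"
      proof (rule ccontr)
        assume "\<not> Im w \<le> Y"
        then have "norm (h w) < \<epsilon>" "norm (h' w) < \<epsilon>" using Y[of w] by auto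
        with calculation v(2) show False by auto
      qed
      ultimately show ?thesis using w R by blast
    qed
    have "R \<noteq> {}" using red[OF z] by (auto simp: \<epsilon>_def)
    moreover have "compact R" by (simp add: R_def compact_cbox)
    \<comment> \<open>The reduction reaches some points only through - 1 / w, so the compact
      rectangle controls the larger of the norms of \<open>h\<close> and \<open>h'\<close>, not that
      of \<open>h\<close> alone.\<close>
    moreover have cont: "continuous_on R (\<lambda>w. max (norm (h w)) (norm (h' w)))"
      using holomorphic_on_imp_continuous_on[OF holomorphic_on_subset[OF hol_h RH]]
        holomorphic_on_imp_continuous_on[OF holomorphic_on_subset[OF hol_h' RH]]
      by (intro continuous_on_max continuous_on_norm)
    ultimately obtain w where w: "w \<in> R"
      "\<And>v. v \<in> R \<Longrightarrow> max (norm (h v)) (norm (h' v)) \<le> max (norm (h w)) (norm (h' w))"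
      using continuous_attains_sup[OF _ _ cont] by blast
    define M where "M = max (norm (h w)) (norm (h' w))"
    have "\<epsilon> \<le> M" using red[OF z] w(2) by (force simp: \<epsilon>_def M_def)
    have le_M: "norm (h v) \<le> M" if "Im v > 0" for v
    proof (cases "norm (h v) \<ge> \<epsilon>")
      case True
      then show ?thesis using red[OF that] w(2) by (force simp: M_def)
    qed (use \<open>\<epsilon> \<le> M\<close> in simp)
    have wH: "Im w > 0" using w(1) RH by auto
    \<comment> \<open>The maximum may be attained by \<open>h\<close> or by \<open>h'\<close>;
      either one would be a constant of norm at least \<epsilon> that also tends to 0.\<close>
    have no_const: False if f: "f holomorphic_on ?H" "(f \<longlongrightarrow> 0) (filtercomap Im at_top)"
      "norm (f w) = M" "\<And>v. Im v > 0 \<Longrightarrow> norm (f v) \<le> M" for f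
    proof -
      have "f constant_on ?H"
        by (rule maximum_modulus_principle[OF f(1) openH connH openH order_refl, of w]) (use wH f in auto)
      then obtain k where k: "\<And>v. Im v > 0 \<Longrightarrow> f v = k" unfolding constant_on_def by auto
      have "\<forall>\<^sub>F v in filtercomap Im at_top. f v = k"
        unfolding eventually_filtercomap_at_top_dense using k by blast
      then have "(f \<longlongrightarrow> k) (filtercomap Im at_top)" by (rule tendsto_eventually)
      with f(2) have "k = 0" using tendsto_unique[OF filtercomap_Im_nontrivial] by blast
      then show False using f(3) k[OF wH] \<open>\<epsilon> \<le> M\<close> \<epsilon> by simp
    qed
    have "norm (h' v) \<le> M" if "Im v > 0" for v
      unfolding h'_def by (rule le_M[OF Im_minus_inverse_pos[OF that]])
    then show False
      using no_const[OF hol_h lim_h _ le_M] no_const[OF hol_h' lim_h'] unfolding M_def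
      by (metis max_def)
  qed
  have "g constant_on ?H"
  proof (rule continuous_finite_range_constant[OF connH])
    show "continuous_on ?H g" by (rule holomorphic_on_imp_continuous_on[OF hol])
    have "g ` ?H \<subseteq> {c0, c1}" using h0 by (auto simp: h_def)
    then show "finite (g ` ?H)" by (rule finite_subset) simp
  qed
  then obtain k where k: "\<And>v. Im v > 0 \<Longrightarrow> g v = k" unfolding constant_on_def by auto
  have "\<forall>\<^sub>F v in filtercomap Im at_top. g v = k"
    unfolding eventually_filtercomap_at_top_dense using k by blast
  then have "(g \<longlongrightarrow> k) (filtercomap Im at_top)" by (rule tendsto_eventually)
  with lim_inf have "k = c1" using tendsto_unique[OF filtercomap_Im_nontrivial] by blast
  then show ?thesis using k[OF z] by simp
qed

section \<open>Expansions at the cusps\<close>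

lemma Im_pos_of_norm_nome: "norm (nome z) < 1 \<Longrightarrow> Im z > 0"
  by (simp add: norm_nome zero_less_mult_iff)

lemma nome_Ln: "q \<noteq> 0 \<Longrightarrow> nome (Ln q / (2 * of_real pi * \<i>)) = q"
  by simp

lemma nome_eq_imp:
  assumes "nome v = nome w"
  obtains k :: int where "v = w + of_int k"
proof -
  obtain k :: int where "2 * of_real pi * \<i> * v = 2 * of_real pi * \<i> * w + (of_int (2 * k) * pi) * \<i>"
    using assms unfolding exp_eq by blast
  then have "2 * of_real pi * \<i> * v = 2 * of_real pi * \<i> * (w + of_int k)"
    by (simp add: algebra_simps)
  then have "v = w + of_int k" by simp
  then show ?thesis by (rule that)
qed

lemma nome_tendsto_0: "(nome \<longlongrightarrow> 0) (filtercomap Im at_top)"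
proof (rule tendsto_norm_zero_cancel)
  have "((\<lambda>y. exp (- 2 * pi * y)) \<longlongrightarrow> 0) at_top" by real_asymp
  from filterlim_compose[OF this filterlim_filtercomap]
  show "((\<lambda>z. norm (nome z)) \<longlongrightarrow> 0) (filtercomap Im at_top)"
    unfolding norm_nome .
qed

lemma nome_surj:
  assumes "norm q < 1" "q \<noteq> 0"
  obtains z where "Im z > 0" "nome z = q"
  using nome_Ln[OF assms(2)] assms(1) Im_pos_of_norm_nome that by metis

lemma holomorphic_nome_tendsto:
  assumes H: "H holomorphic_on ball 0 1"
    and u: "filterlim u (filtercomap Im at_top) (filtercomap Im at_top)"
  shows "((\<lambda>z. H (nome (u z))) \<longlongrightarrow> H 0) (filtercomap Im at_top)"
proof -
  have "isCont H 0"
    using H holomorphic_on_imp_continuous_on continuous_on_interior[of "ball 0 1" H 0] by auto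
  then have "(H \<longlongrightarrow> H 0) (nhds 0)" by (simp add: continuous_at tendsto_nhds_iff)
  from filterlim_compose[OF this filterlim_compose[OF nome_tendsto_0 u]] show ?thesis .
qed

lemma holomorphic_eval_fps_ball:
  "fps_conv_radius F \<ge> 1 \<Longrightarrow> eval_fps (F :: complex fps) holomorphic_on ball 0 1"
  by (rule holomorphic_on_eval_fps) (auto simp: norm_less_conv_radius)

lemma filterlim_Im_scale:
  assumes "r > 0"
  shows "filterlim (\<lambda>w. of_real r * w) (filtercomap Im at_top) (filtercomap Im at_top)"
proof -
  have "filterlim (\<lambda>y :: real. r * y) at_top at_top" using assms by real_asymp
  from filterlim_compose[OF this filterlim_filtercomap[of Im]] show ?thesis
    unfolding filterlim_filtercomap_iff o_def by simp
qed

text \<open>Periodicity lets f descend to the punctured disc. The limit removes the singularity at 0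
  with value 0, and that zero is split off as a factor q.\<close>

lemma periodic_cusp_expansion:
  assumes hol: "f holomorphic_on {z. Im z > 0}"
    and per: "\<And>z. Im z > 0 \<Longrightarrow> f (z + 1) = f z"
    and lim: "(f \<longlongrightarrow> 0) (filtercomap Im at_top)"
  obtains h where "h holomorphic_on ball 0 1" "\<And>z. Im z > 0 \<Longrightarrow> f z = nome z * h (nome z)"
proof -
  let ?H = "{z :: complex. Im z > 0}"
  define \<phi> where "\<phi> = (\<lambda>q. f (Ln q / (2 * of_real pi * \<i>)))"
  have \<phi>_nome: "\<phi> (nome v) = f v" if v: "Im v > 0" for v
  proof -
    have "nome (Ln (nome v) / (2 * of_real pi * \<i>)) = nome v" by (rule nome_Ln) simp
    then obtain k :: int where "Ln (nome v) / (2 * of_real pi * \<i>) = v + of_int k"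
      by (rule nome_eq_imp)
    then show ?thesis unfolding \<phi>_def using periodic_int[of f, OF per v] by simp
  qed
  have hol_\<phi>: "\<phi> holomorphic_on ball 0 1 - {0}"
    unfolding holomorphic_on_def
  proof
    fix q0 :: complex assume q0: "q0 \<in> ball 0 1 - {0}"
    define v0 where "v0 = Ln q0 / (2 * of_real pi * \<i>)"
    \<comment> \<open>\<open>Ln\<close> jumps across the negative axis, so a branch adapted to q0 is
      used: on the ball of radius |q0| about q0 the quotient q / q0 avoids the non-positive
      reals.\<close>
    define V where "V = (\<lambda>q. v0 + Ln (q / q0) / (2 * of_real pi * \<i>))"
    define U where "U = ball 0 1 \<inter> ball q0 (norm q0)"
    have nz: "q \<noteq> 0" if "q \<in> U" for q using that by (auto simp: U_def dist_norm)
    have V: "nome (V q) = q" if "q \<in> U" for q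
    proof -
      have "nome (V q) = nome v0 * nome (Ln (q / q0) / (2 * of_real pi * \<i>))"
        by (simp only: V_def exp_add[symmetric] distrib_left)
      also have "\<dots> = q0 * (q / q0)"
        using q0 nz[OF that] nome_Ln[of q0] nome_Ln[of "q / q0"] unfolding v0_def by auto
      finally show ?thesis using q0 by simp
    qed
    have VH: "Im (V q) > 0" if "q \<in> U" for q
      using V[OF that] that by (intro Im_pos_of_norm_nome) (simp add: U_def)
    have "(f \<circ> V) holomorphic_on U"
    proof (rule holomorphic_on_compose_gen[OF _ hol])
      have "q / q0 \<notin> \<real>\<^sub>\<le>\<^sub>0" if "q \<in> U" for q
      proof
        assume "q / q0 \<in> \<real>\<^sub>\<le>\<^sub>0"
        then obtain r where r: "r \<le> 0" "q / q0 = of_real r" by (auto elim!: nonpos_Reals_cases)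
        then have "q = of_real r * q0" using q0 by (auto simp: field_simps)
        then have "q0 - q = of_real (1 - r) * q0" by (simp add: algebra_simps)
        then have "norm (q0 - q) = (1 - r) * norm q0" using r(1) by (simp only: norm_mult norm_of_real)
        moreover have "norm (q0 - q) < norm q0" using that by (simp add: U_def dist_norm)
        moreover have "1 * norm q0 \<le> (1 - r) * norm q0" using r(1) by (intro mult_right_mono) auto
        ultimately show False by simp
      qed
      then show "V holomorphic_on U" unfolding V_def using q0 by (intro holomorphic_intros) auto
      show "V ` U \<subseteq> ?H" using VH by auto
    qed
    moreover have "open U" "q0 \<in> U" using q0 by (auto simp: U_def)
    moreover have "(f \<circ> V) q = \<phi> q" if "q \<in> U" for q
      using \<phi>_nome[OF VH[OF that]] V[OF that] by simp
    ultimately have "\<phi> field_differentiable at q0"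
      using holomorphic_transform holomorphic_on_imp_differentiable_at by blast
    then show "\<phi> field_differentiable at q0 within ball 0 1 - {0}"
      by (rule field_differentiable_at_within)
  qed
  have "\<phi> \<midarrow>0\<rightarrow> 0"
  proof (rule tendstoI)
    fix e :: real assume "e > 0"
    then have "\<forall>\<^sub>F z in filtercomap Im at_top. dist (f z) 0 < e" by (rule tendstoD[OF lim])
    then obtain Y where Y: "\<And>z. Im z > Y \<Longrightarrow> norm (f z) < e"
      unfolding eventually_filtercomap_at_top_dense by auto
    have "\<forall>\<^sub>F q in at 0. q \<in> ball 0 (exp (- 2 * pi * Y)) - {0}"
      by (rule eventually_at_in_open) auto
    then show "\<forall>\<^sub>F q in at 0. dist (\<phi> q) 0 < e"
    proof eventually_elim
      case (elim q)
      define v where "v = Ln q / (2 * of_real pi * \<i>)"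
      have "nome v = q" unfolding v_def by (rule nome_Ln) (use elim in simp)
      then have "exp (- 2 * pi * Im v) = norm q" by (simp only: norm_nome[symmetric])
      also have "\<dots> < exp (- 2 * pi * Y)" using elim by simp
      finally have "Im v > Y" by simp
      then show ?case using Y[of v] by (simp add: \<phi>_def v_def)
    qed
  qed
  then have g: "(\<lambda>q. if q = 0 then 0 else \<phi> q) holomorphic_on ball 0 1"
    by (rule removable_singularity[OF hol_\<phi> open_ball])
  define g where "g = (\<lambda>q. if q = 0 then 0 else \<phi> q)"
  define h where "h = (\<lambda>q. if q = 0 then deriv g 0 else (g q - g 0) / (q - 0))"
  show ?thesis
  proof (rule that[of h])
    show "h holomorphic_on ball 0 1"
      unfolding h_def by (rule pole_lemma_open) (use g in \<open>auto simp: g_def\<close>)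
    show "f z = nome z * h (nome z)" if "Im z > 0" for z
      using \<phi>_nome[OF that] by (simp add: h_def g_def)
  qed
qed

section \<open>Vanishing of forms of weight 4\<close>

text \<open>Vanishing is imposed here at the cusp 0; the behaviour at infinity is carried by the
  power series of the form.\<close>

definition level11_form :: "(complex \<Rightarrow> complex) \<Rightarrow> bool" where
  "level11_form f \<longleftrightarrow> f holomorphic_on {z. Im z > 0} \<and>
    (\<forall>a b c d z. a * d - b * c = 1 \<and> 11 dvd c \<and> Im z > 0 \<longrightarrow>
       f (moeb a b c d z) = (of_int c * z + of_int d) ^ 4 * f z) \<and>
    ((\<lambda>z. f (- 1 / z) / z ^ 4) \<longlongrightarrow> 0) (filtercomap Im at_top)"

text \<open>The cusp 0 has width 11: conjugating z -> z + 11 by z -> - 1 / z gives the matrix with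
  rows (1, 0) and (- 11, 1).\<close>

lemma level11_form_period:
  assumes f: "level11_form f" and z: "Im z > 0"
  shows "f (- 1 / (z + 11)) / (z + 11) ^ 4 = f (- 1 / z) / z ^ 4"
proof -
  have nz: "z \<noteq> 0" "z + 11 \<noteq> 0" using z by (auto simp: complex_eq_iff)
  have e: "of_int (-11) * (- 1 / z) + of_int 1 = (z + 11) / z" using nz by (simp add: field_simps)
  have "moeb 1 0 (-11) 1 (- 1 / z) = - 1 / (z + 11)"
    unfolding moeb_def e using nz by simp
  moreover have "f (moeb 1 0 (-11) 1 (- 1 / z)) = (of_int (-11) * (- 1 / z) + of_int 1) ^ 4 * f (- 1 / z)"
    using f Im_minus_inverse_pos[OF z] unfolding level11_form_def by (metis (no_types, opaque_lifting) diff_0_right dvd_minus_iff dvd_refl mult_1 mult_zero_left)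
  ultimately have "f (- 1 / (z + 11)) = ((z + 11) / z) ^ 4 * f (- 1 / z)" unfolding e by simp
  then show ?thesis using nz by (simp add: power_divide)
qed

text \<open>Conjugation by z -> 11 z carries the group of level 11 into the full modular group, so
  laws of level 1 pass to functions of 11 z.\<close>

lemma moeb_times_11:
  assumes "c = 11 * c'"
  shows "11 * moeb a b c d z = moeb a (11 * b) c' d (11 * z)"
  unfolding moeb_def assms by (simp add: algebra_simps add_divide_distrib)

lemma delta_11_modular:
  assumes det: "a * d - b * c = 1" and c: "11 dvd c" and z: "Im z > 0"
  shows "delta (11 * moeb a b c d z) = (of_int c * z + of_int d) ^ 12 * delta (11 * z)"
proof -
  obtain c' where c': "c = 11 * c'" using c by blast
  have "delta (moeb a (11 * b) c' d (11 * z)) = (of_int c' * (11 * z) + of_int d) ^ 12 * delta (11 * z)"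
    by (rule delta_modular) (use det z in \<open>auto simp: c'\<close>)
  then show ?thesis unfolding moeb_times_11[OF c'] by (simp add: c' mult_ac)
qed

text \<open>The exponents are those for which \<open>f ^ 60 / (delta z ^ 4 * delta (11 * z) ^ 16)\<close> has weight
  0 and order 0 at both cusps when \<open>f\<close> vanishes to order 3 at infinity and to order 1 at 0. It
  is then a constant, and comparing the next coefficients at infinity gives
  \<open>5 * a 4 = - 8 * a 3\<close>.\<close>

lemma level11_form_eq_0:
  assumes f: "level11_form f" and F: "fps_conv_radius F \<ge> 1"
    and fF: "\<And>z. Im z > 0 \<Longrightarrow> f z = eval_fps F (nome z)"
    and coeffs: "fps_nth F 0 = 0" "fps_nth F 1 = 0" "fps_nth F 2 = 0" "fps_nth F 4 = 0"
  shows "F = 0"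
proof -
  define L where "L = eval_fps delta_log_fps"
  have hol_L: "L holomorphic_on ball 0 1" unfolding L_def by (rule holomorphic_eval_fps_ball[OF fps_conv_radius_delta_log])
  have pow_ball: "q ^ 11 \<in> ball 0 1" if "q \<in> ball 0 1" for q :: complex
    using that by (simp add: norm_power power_less_one_iff)
  have hol_L11: "(\<lambda>q. L (q ^ 11)) holomorphic_on ball 0 1"
  proof -
    have "(\<lambda>q. q ^ 11) holomorphic_on ball 0 (1 :: real)" by (intro holomorphic_intros)
    moreover have "(\<lambda>q. q ^ 11) ` ball 0 1 \<subseteq> (ball 0 1 :: complex set)" using pow_ball by blast
    ultimately show ?thesis using holomorphic_on_compose_gen[OF _ hol_L] unfolding o_def by blast
  qed
  define G where "G = (\<lambda>z. f z ^ 60 / (delta z ^ 4 * delta (11 * z) ^ 16))"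

  \<comment> \<open>The cofactor of q^3; its coefficient of index 1 is the vanishing a_4.\<close>
  define K where "K = fps_shift 3 F"
  have FK: "F = fps_X ^ 3 * K"
  proof (rule fps_ext)
    fix n show "fps_nth F n = fps_nth (fps_X ^ 3 * K) n"
    proof (cases "n < 3")
      case True
      then have "n = 0 \<or> n = 1 \<or> n = 2" by auto
      then show ?thesis using coeffs True by (auto simp: fps_X_power_mult_nth)
    next
      case False
      then show ?thesis by (simp add: fps_X_power_mult_nth K_def)
    qed
  qed
  have rK: "fps_conv_radius K \<ge> 1" using F by (simp add: K_def)
  \<comment> \<open>The denominator of \<open>G\<close> without its factor q^(4 + 11 * 16) = q^180,
    which cancels against the 60th power of q^3.\<close>
  define W where "W = (\<lambda>q. exp (- 24 * L q) ^ 4 * exp (- 24 * L (q ^ 11)) ^ 16)"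
  have W0: "W q \<noteq> 0" for q by (simp add: W_def)
  define R where "R = (\<lambda>q. eval_fps K q ^ 60 / W q)"
  have hol_W: "W holomorphic_on ball 0 1" unfolding W_def by (intro holomorphic_intros hol_L hol_L11)
  have hol_R: "R holomorphic_on ball 0 1" unfolding R_def using W0 by (intro holomorphic_intros holomorphic_eval_fps_ball[OF rK] hol_W) auto
  have GR: "G z = R (nome z)" if z: "Im z > 0" for z
  proof -
    define q where "q = nome z"
    have q: "norm q < 1" unfolding q_def by (rule norm_nome_less_1[OF z])
    have "f z = q ^ 3 * eval_fps K q"
      unfolding fF[OF z] q_def[symmetric]
      by (subst FK, subst eval_fps_mult) (auto intro!: norm_less_conv_radius q rK)
    moreover have "delta z = q * exp (- 24 * L q)" unfolding L_def q_def by (rule delta_eq_nome)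
    moreover have "delta (11 * z) = q ^ 11 * exp (- 24 * L (q ^ 11))"
      using delta_eq_nome[of "11 * z"] nome_mult_nat[of 11 z] by (simp add: L_def q_def)
    moreover have "(x ^ 3 * k) ^ 60 / ((x * A) ^ 4 * (x ^ 11 * B) ^ 16) = k ^ 60 / (A ^ 4 * B ^ 16)"
      if "x \<noteq> 0" for x k A B :: complex
    proof -
      have "(x ^ 3 * k) ^ 60 = x ^ 180 * k ^ 60" "(x * A) ^ 4 * (x ^ 11 * B) ^ 16 = x ^ 180 * (A ^ 4 * B ^ 16)"
        by (simp_all add: power_mult_distrib flip: power_mult power_add mult.assoc)
      then show ?thesis using that by simp
    qed
    ultimately show ?thesis unfolding G_def R_def W_def q_def[symmetric] by (simp add: q_def)
  qed

  have fS: "((\<lambda>z. f (- 1 / z) / z ^ 4) \<longlongrightarrow> 0) (filtercomap Im at_top)"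
    and hol_f: "f holomorphic_on {z. Im z > 0}"
    and mod_f: "\<And>a b c d z. a * d - b * c = 1 \<Longrightarrow> 11 dvd c \<Longrightarrow> Im z > 0 \<Longrightarrow>
       f (moeb a b c d z) = (of_int c * z + of_int d) ^ 4 * f z"
    using f unfolding level11_form_def by blast+
  \<comment> \<open>Substituting z = 11 w normalises the width of the cusp 0 to 1.\<close>
  define fs where "fs = (\<lambda>w. f (- 1 / (11 * w)) / (11 * w) ^ 4)"
  have scale: "filterlim (\<lambda>w. 11 * w) (filtercomap Im at_top) (filtercomap Im at_top)"
    "filterlim (\<lambda>w. w / 11) (filtercomap Im at_top) (filtercomap Im at_top)"
    using filterlim_Im_scale[of 11] filterlim_Im_scale[of "1 / 11"] by simp_all
  obtain h where h: "h holomorphic_on ball 0 1" "\<And>w. Im w > 0 \<Longrightarrow> fs w = nome w * h (nome w)"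
  proof (rule periodic_cusp_expansion[of fs])
    have "(\<lambda>w. - 1 / (11 * w)) holomorphic_on {z. Im z > 0}" by (auto intro!: holomorphic_intros)
    moreover have "(\<lambda>w. - 1 / (11 * w)) ` {z. Im z > 0} \<subseteq> {z. Im z > 0}"
      using Im_minus_inverse_pos[of "11 * w" for w] by auto
    ultimately have "(\<lambda>w. f (- 1 / (11 * w))) holomorphic_on {z. Im z > 0}"
      using holomorphic_on_compose_gen[OF _ hol_f] unfolding o_def by blast
    then show "fs holomorphic_on {z. Im z > 0}"
      unfolding fs_def by (intro holomorphic_intros) auto
    show "fs (w + 1) = fs w" if "Im w > 0" for w
    proof -
      have e: "11 * (w + 1) = 11 * w + 11" by (simp add: distrib_left)
      show ?thesis unfolding fs_def e by (rule level11_form_period[OF f]) (use that in simp)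
    qed
    show "(fs \<longlongrightarrow> 0) (filtercomap Im at_top)"
      unfolding fs_def by (rule filterlim_compose[OF fS scale(1)])
  qed auto
  \<comment> \<open>Naming the number 11 keeps its power 192 symbolic.\<close>
  define m :: complex where "m = 11"
  define R0 where "R0 = (\<lambda>p. m ^ 192 * h p ^ 60 / (exp (- 24 * L (p ^ 11)) ^ 4 * exp (- 24 * L p) ^ 16))"
  have hol_R0: "R0 holomorphic_on ball 0 1"
    unfolding R0_def by (intro holomorphic_intros h hol_L hol_L11) auto
  have GR0: "G (- 1 / z) = R0 (nome (z / 11))" if z: "Im z > 0" for z
  proof -
    define p where "p = nome (z / 11)"
    have z0: "z \<noteq> 0" using z by auto
    have z11: "Im (z / 11) > 0" using z by simp
    have 1: "f (- 1 / z) = z ^ 4 * (p * h p)"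
      using h(2)[OF z11] z0 by (simp add: fs_def p_def field_simps)
    have 2: "delta (- 1 / z) = z ^ 12 * (p ^ 11 * exp (- 24 * L (p ^ 11)))"
      unfolding delta_S[OF z] delta_eq_nome[of z] using nome_mult_nat[of 11 "z / 11"] by (simp add: p_def L_def)
    have 3: "delta (11 * (- 1 / z)) = (z / m) ^ 12 * (p * exp (- 24 * L p))"
      using delta_S[OF z11] delta_eq_nome[of "z / 11"] by (simp add: p_def L_def m_def)
    have 4: "(z ^ 4 * (x * k)) ^ 60 / ((z ^ 12 * (x ^ 11 * A)) ^ 4 * ((z / m) ^ 12 * (x * B)) ^ 16)
        = m ^ 192 * k ^ 60 / (A ^ 4 * B ^ 16)"
      if "x \<noteq> 0" "m \<noteq> 0" for x k A B m :: complex
    proof -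
      have num: "(z ^ 4 * (x * k)) ^ 60 = (z ^ 240 * x ^ 60) * k ^ 60"
        by (simp add: power_mult_distrib flip: power_mult)
      have "(z ^ 12 * (x ^ 11 * A)) ^ 4 = z ^ 48 * x ^ 44 * A ^ 4"
        "((z / m) ^ 12 * (x * B)) ^ 16 = z ^ 192 / m ^ 192 * x ^ 16 * B ^ 16"
        by (simp_all add: power_mult_distrib power_divide flip: power_mult)
      then have "(z ^ 12 * (x ^ 11 * A)) ^ 4 * ((z / m) ^ 12 * (x * B)) ^ 16
          = ((z ^ 48 * z ^ 192) * (x ^ 44 * x ^ 16)) * (A ^ 4 * B ^ 16) / m ^ 192"
        by (simp add: mult_ac)
      also have "(z ^ 48 * z ^ 192) * (x ^ 44 * x ^ 16) = z ^ 240 * x ^ 60"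
        by (simp flip: power_add)
      finally show ?thesis unfolding num using that z0 by simp
    qed
    show ?thesis
      unfolding G_def R0_def p_def[symmetric] 1 2 3 by (rule 4) (simp_all add: p_def m_def)
  qed

  have hol_delta: "delta holomorphic_on {z. Im z > 0}"
    unfolding holomorphic_on_def field_differentiable_def
    using DERIV_delta by (blast intro: has_field_derivative_at_within)
  have hol_G: "G holomorphic_on {z. Im z > 0}"
  proof -
    have "(\<lambda>z. 11 * z) holomorphic_on {z. Im z > 0}" by (intro holomorphic_intros)
    moreover have "(\<lambda>z. 11 * z) ` {z. Im z > 0} \<subseteq> {z. Im z > 0}" by auto
    ultimately have "(\<lambda>z. delta (11 * z)) holomorphic_on {z. Im z > 0}"
      using holomorphic_on_compose_gen[OF _ hol_delta] unfolding o_def by blast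
    then show ?thesis unfolding G_def by (intro holomorphic_intros hol_f hol_delta) auto
  qed
  have inv_G: "Gamma0_11_invariant G"
    unfolding Gamma0_11_invariant_def
  proof (intro allI impI, elim conjE)
    fix a b c d :: int and z :: complex
    assume det: "a * d - b * c = 1" and c: "11 dvd c" and z: "Im z > 0"
    define j where "j = of_int c * z + of_int d"
    have j0: "j \<noteq> 0" unfolding j_def by (rule denom_nonzero[OF det z])
    have "G (moeb a b c d z) = (j ^ 4 * f z) ^ 60 / ((j ^ 12 * delta z) ^ 4 * (j ^ 12 * delta (11 * z)) ^ 16)"
      unfolding G_def mod_f[OF det c z] delta_modular[OF det z] delta_11_modular[OF det c z] j_def ..
    also have "(j ^ 12 * delta z) ^ 4 * (j ^ 12 * delta (11 * z)) ^ 16 = j ^ 240 * (delta z ^ 4 * delta (11 * z) ^ 16)"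
    proof -
      have "j ^ 240 = j ^ 48 * j ^ 192" by (simp flip: power_add)
      then show ?thesis by (simp add: power_mult_distrib flip: power_mult)
    qed
    also have "(j ^ 4 * f z) ^ 60 = j ^ 240 * f z ^ 60" by (simp add: power_mult_distrib flip: power_mult)
    finally show "G (moeb a b c d z) = G z" using j0 by (simp add: G_def)
  qed
  have G_const: "G z = R 0" if z: "Im z > 0" for z
  proof (rule invariant_constant[OF inv_G hol_G _ _ z])
    show "(G \<longlongrightarrow> R 0) (filtercomap Im at_top)"
      using holomorphic_nome_tendsto[OF hol_R filterlim_ident]
      by (rule tendsto_cong[THEN iffD1, rotated]) (use eventually_Im_pos GR in \<open>auto elim: eventually_mono\<close>)
    show "((\<lambda>z. G (- 1 / z)) \<longlongrightarrow> R0 0) (filtercomap Im at_top)"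
      using holomorphic_nome_tendsto[OF hol_R0 scale(2)]
      by (rule tendsto_cong[THEN iffD1, rotated]) (use eventually_Im_pos GR0 in \<open>auto elim: eventually_mono\<close>)
  qed
  have R_const: "R q = R 0" if q: "q \<in> ball 0 1" for q
  proof (cases "q = 0")
    case False
    then obtain z where "Im z > 0" "nome z = q" using nome_surj[of q] q by auto
    then show ?thesis using GR G_const by metis
  qed simp
  have L0: "L 0 = 0" by (simp add: L_def eval_fps_at_0 delta_log_fps_def)
  \<comment> \<open>Differentiate K^60 = R(0) W at 0. The left side gives 0 since K has no linear
    term; on the right W(0) = 1 and W'(0) = 4 * (- 24) = - 96, as q^11 does not contribute. Hence
    R(0) = 0, which forces K(0) = 0.\<close>
  have K0: "fps_nth K 0 = 0"
  proof (rule ccontr)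
    assume nz: "fps_nth K 0 \<noteq> 0"
    have dL: "(L has_field_derivative 1) (at 0)"
    proof -
      have "(L has_field_derivative eval_fps (fps_deriv delta_log_fps) 0) (at 0)"
        unfolding L_def by (rule has_field_derivative_eval_fps) (use norm_less_conv_radius[OF _ fps_conv_radius_delta_log, of 0] in simp)
      then show ?thesis by (simp add: eval_fps_at_0 delta_log_fps_def divisor_sigma_def)
    qed
    have dL11: "((\<lambda>q. L (q ^ 11)) has_field_derivative 0) (at 0)"
    proof -
      have "((\<lambda>q. q ^ 11) has_field_derivative 0) (at (0 :: complex))"
        by (auto intro!: derivative_eq_intros)
      moreover have "(L has_field_derivative 1) (at (0 ^ 11))" using dL by simp
      ultimately show ?thesis using DERIV_chain2[of L 1 "\<lambda>q. q ^ 11" 0 0 UNIV] by simp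
    qed
    have dW: "(W has_field_derivative - 96) (at 0)"
      unfolding W_def by (rule derivative_eq_intros dL dL11 refl)+ (simp add: L0)
    have dK: "((\<lambda>q. eval_fps K q ^ 60) has_field_derivative 0) (at 0)"
    proof -
      have "(eval_fps K has_field_derivative eval_fps (fps_deriv K) 0) (at 0)"
        by (rule has_field_derivative_eval_fps) (use norm_less_conv_radius[OF _ rK, of 0] in simp)
      moreover have "eval_fps (fps_deriv K) 0 = 0" using coeffs(4) by (simp add: eval_fps_at_0 K_def)
      ultimately have "(eval_fps K has_field_derivative 0) (at 0)" by simp
      from DERIV_power[OF this, of 60] show ?thesis by simp
    qed
    have "((\<lambda>q. eval_fps K q ^ 60) has_field_derivative R 0 * (- 96)) (at 0)"
    proof (rule has_field_derivative_transform_within_open)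
      show "((\<lambda>q. R 0 * W q) has_field_derivative R 0 * (- 96)) (at 0)" by (rule DERIV_cmult[OF dW])
      show "R 0 * W q = eval_fps K q ^ 60" if "q \<in> ball 0 1" for q
        using R_const[OF that] W0[of q] by (simp add: R_def field_simps)
    qed auto
    from DERIV_unique[OF this dK] have "R 0 = 0" by simp
    then show False using nz W0[of 0] by (simp add: R_def eval_fps_at_0)
  qed
  then have "R 0 = 0" by (simp add: R_def eval_fps_at_0)
  have "eval_fps F q = 0" if q: "q \<in> ball 0 1" for q
  proof (cases "q = 0")
    case True
    then show ?thesis using coeffs(1) by (simp add: eval_fps_at_0)
  next
    case False
    then obtain z where z: "Im z > 0" "nome z = q" using nome_surj[of q] q by auto
    have "G z = 0" using G_const[OF z(1)] \<open>R 0 = 0\<close> by simp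
    then have "f z = 0" by (simp add: G_def)
    then show ?thesis using fF[OF z(1)] z(2) by simp
  qed
  then have "\<forall>\<^sub>F q in nhds 0. eval_fps F q = eval_fps 0 q"
    by (intro eventually_mono[OF eventually_nhds_in_open[of "ball 0 1"]]) auto
  then show "F = 0" using F by (intro eval_fps_eqD) (auto intro: less_le_trans[of 0 1])
qed

section \<open>Fourier expansions\<close>

lemma eval_fps_nome_tendsto:
  assumes F: "fps_conv_radius F \<ge> 1"
    and u: "filterlim u (filtercomap Im at_top) (filtercomap Im at_top)"
  shows "((\<lambda>z. eval_fps F (nome (u z))) \<longlongrightarrow> fps_nth F 0) (filtercomap Im at_top)"
  using holomorphic_nome_tendsto[OF holomorphic_eval_fps_ball[OF F] u] by (simp add: eval_fps_at_0)

lemma fps_eqI_nome: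
  assumes F: "fps_conv_radius F \<ge> 1" and G: "fps_conv_radius G \<ge> 1"
    and eq: "\<And>z. Im z > 0 \<Longrightarrow> eval_fps F (nome z) = eval_fps G (nome z)"
  shows "F = G"
proof -
  \<comment> \<open>The nome omits the value 0; multiplying by q makes the agreement at 0
    automatic.\<close>
  have "eval_fps (fps_X * F) q = eval_fps (fps_X * G) q" if q: "norm q < 1" for q
  proof -
    have "eval_fps (fps_X * F) q = q * eval_fps F q" "eval_fps (fps_X * G) q = q * eval_fps G q"
      using norm_less_conv_radius[OF q F] norm_less_conv_radius[OF q G] by (simp_all add: eval_fps_mult)
    moreover have "q = 0 \<or> eval_fps F q = eval_fps G q"
      using nome_surj[OF q] eq by metis
    ultimately show ?thesis by auto
  qed
  then have "\<forall>\<^sub>F q in nhds 0. eval_fps (fps_X * F) q = eval_fps (fps_X * G) q"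
    by (intro eventually_mono[OF eventually_nhds_in_open[of "ball 0 1"]]) auto
  moreover have "fps_conv_radius (fps_X * F) > 0" "fps_conv_radius (fps_X * G) > 0"
    using conv_radius_ge_1_mult[OF conv_radius_ge_1_triv(4) F] conv_radius_ge_1_mult[OF conv_radius_ge_1_triv(4) G]
    by (auto intro: less_le_trans[of 0 1])
  ultimately have "fps_X * F = fps_X * G" by (intro eval_fps_eqD)
  then show ?thesis by simp
qed

lemma fourier_expansion_fps:
  assumes "fourier_expansion f a"
  shows "fps_conv_radius (Abs_fps a) \<ge> 1" "\<And>z. Im z > 0 \<Longrightarrow> f z = eval_fps (Abs_fps a) (nome z)"
proof -
  have s: "(\<lambda>n. a n * nome z ^ n) sums f z" if "Im z > 0" for z
    using assms that by (simp add: fourier_expansion_def upper_half_plane_def)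
  show "fps_conv_radius (Abs_fps a) \<ge> 1"
  proof (rule sums_imp_conv_radius)
    fix q :: complex assume q: "norm q < 1"
    show "summable (\<lambda>n. fps_nth (Abs_fps a) n * q ^ n)"
    proof (cases "q = 0")
      case False
      then obtain z where "Im z > 0" "nome z = q" using nome_surj[OF q] by blast
      then show ?thesis using sums_summable[OF s[of z]] by simp
    qed (simp add: power_0_left if_distrib cong: if_cong)
  qed
  show "f z = eval_fps (Abs_fps a) (nome z)" if "Im z > 0" for z
    using sums_unique[OF s[OF that]] by (simp add: eval_fps_def)
qed

text \<open>The substitution of q^k for q.\<close>

definition fps_stretch :: "nat \<Rightarrow> complex fps \<Rightarrow> complex fps" where
  "fps_stretch k F = Abs_fps (\<lambda>n. if k dvd n then fps_nth F (n div k) else 0)"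

lemma fps_stretch_sums:
  assumes k: "k > 0" and F: "fps_conv_radius F \<ge> 1" and q: "norm q < 1"
  shows "(\<lambda>n. fps_nth (fps_stretch k F) n * q ^ n) sums eval_fps F (q ^ k)"
proof -
  have "norm (q ^ k) < 1" using q k by (simp add: norm_power power_less_one_iff)
  from sums_eval_fps[OF norm_less_conv_radius[OF this F]]
  have "(\<lambda>n. fps_nth F n * (q ^ k) ^ n) sums eval_fps F (q ^ k)" .
  moreover have "fps_nth F n * (q ^ k) ^ n = fps_nth (fps_stretch k F) (k * n) * q ^ (k * n)" for n
    using k by (simp add: fps_stretch_def power_mult)
  ultimately have "(\<lambda>n. fps_nth (fps_stretch k F) (k * n) * q ^ (k * n)) sums eval_fps F (q ^ k)" by simp
  moreover have "strict_mono (\<lambda>n. k * n)" using k by (simp add: strict_mono_def)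
  ultimately show ?thesis
    by (subst (asm) sums_mono_reindex) (auto simp: fps_stretch_def dvd_def)
qed

lemma conv_radius_ge_1_stretch:
  assumes "k > 0" "fps_conv_radius F \<ge> 1"
  shows "fps_conv_radius (fps_stretch k F) \<ge> 1"
  by (rule sums_imp_conv_radius) (use fps_stretch_sums[OF assms] in \<open>auto simp: sums_iff\<close>)

lemma eval_fps_stretch:
  assumes "k > 0" "fps_conv_radius F \<ge> 1" "norm q < 1"
  shows "eval_fps (fps_stretch k F) q = eval_fps F (q ^ k)"
  using fps_stretch_sums[OF assms] by (simp add: eval_fps_def sums_iff)

lemma fps_stretch_mult:
  assumes k: "k > 0" and F: "fps_conv_radius F \<ge> 1" and G: "fps_conv_radius G \<ge> 1"
  shows "fps_stretch k (F * G) = fps_stretch k F * fps_stretch k G"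
proof (rule fps_eqI_nome)
  fix z assume z: "Im (z :: complex) > 0"
  define q where "q = nome z"
  have q: "norm q < 1" unfolding q_def by (rule norm_nome_less_1[OF z])
  have qk: "norm (q ^ k) < 1" using q k by (simp add: norm_power power_less_one_iff)
  have "eval_fps (fps_stretch k (F * G)) q = eval_fps F (q ^ k) * eval_fps G (q ^ k)"
    using eval_fps_stretch[OF k conv_radius_ge_1_mult[OF F G] q]
    by (simp add: eval_fps_mult norm_less_conv_radius[OF qk F] norm_less_conv_radius[OF qk G])
  also have "\<dots> = eval_fps (fps_stretch k F * fps_stretch k G) q"
    by (subst eval_fps_mult) (auto intro!: norm_less_conv_radius q conv_radius_ge_1_stretch k F G
        simp: eval_fps_stretch[OF k _ q] F G)
  finally show "eval_fps (fps_stretch k (F * G)) (nome z) = eval_fps (fps_stretch k F * fps_stretch k G) (nome z)"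
    unfolding q_def .
qed (intro conv_radius_ge_1_stretch conv_radius_ge_1_mult k F G)+

section \<open>Cusp forms of weight 4 and level 11\<close>

lemma matrix_entries:
  fixes a b c d :: int and A :: "int ^ 2 ^ 2"
  assumes "A = vector [vector [a, b], vector [c, d]]"
  shows "A $ 1 $ 1 = a" "A $ 1 $ 2 = b" "A $ 2 $ 1 = c" "A $ 2 $ 2 = d" "det A = a * d - b * c"
  by (simp_all add: assms det_2)

lemma slash_matrix:
  "slash k (vector [vector [a, b], vector [c, d]]) f z = f (moeb a b c d z) / (of_int c * z + of_int d) ^ k"
  by (simp add: slash_def moebius_action_def automorphy_factor_def moeb_def matrix_entries[OF refl])

lemma cusp_form_imp_level11_form:
  assumes "cusp_form 4 11 f"
  shows "level11_form f" "(f \<longlongrightarrow> 0) (filtercomap Im at_top)"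
proof -
  have hol: "f holomorphic_on {z. Im z > 0}"
    and inv: "\<And>A z. A \<in> Gamma0 11 \<Longrightarrow> Im z > 0 \<Longrightarrow> slash 4 A f z = f z"
    and lim: "\<And>A. A \<in> SL2Z \<Longrightarrow> (slash 4 A f \<longlongrightarrow> 0) (filtercomap Im at_top)"
    using assms by (simp_all add: cusp_form_def upper_half_plane_def)
  have mod: "f (moeb a b c d z) = (of_int c * z + of_int d) ^ 4 * f z"
    if det: "a * d - b * c = 1" and c: "11 dvd c" and z: "Im z > 0" for a b c d z
  proof -
    have "vector [vector [a, b], vector [c, d]] \<in> Gamma0 11"
      using det c by (simp add: Gamma0_def SL2Z_def matrix_entries[OF refl])
    from inv[OF this z] show ?thesis
      using denom_nonzero[OF det z] by (simp add: slash_matrix field_simps)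
  qed
  have "vector [vector [0, -1], vector [1, 0]] \<in> SL2Z" by (simp add: SL2Z_def matrix_entries[OF refl])
  from lim[OF this] have "((\<lambda>z. f (- 1 / z) / z ^ 4) \<longlongrightarrow> 0) (filtercomap Im at_top)"
    by (simp add: slash_matrix[abs_def] moeb_def)
  with hol mod show "level11_form f" unfolding level11_form_def by blast
  have "vector [vector [1, 0], vector [0, 1]] \<in> SL2Z" by (simp add: SL2Z_def matrix_entries[OF refl])
  from lim[OF this] show "(f \<longlongrightarrow> 0) (filtercomap Im at_top)"
    by (simp add: slash_matrix[abs_def] moeb_def)
qed

lemma level11_form_diff_cmult:
  assumes f: "level11_form f" and g: "level11_form g"
  shows "level11_form (\<lambda>z. f z - c * g z)"
  unfolding level11_form_def
proof (intro conjI allI impI)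
  show "(\<lambda>z. f z - c * g z) holomorphic_on {z. Im z > 0}"
    using f g unfolding level11_form_def by (intro holomorphic_intros) auto
  show "f (moeb a b c' d z) - c * g (moeb a b c' d z) = (of_int c' * z + of_int d) ^ 4 * (f z - c * g z)"
    if "a * d - b * c' = 1 \<and> 11 dvd c' \<and> Im z > 0" for a b c' d z
    using f g that unfolding level11_form_def by (simp add: algebra_simps)
  have "((\<lambda>z. f (- 1 / z) / z ^ 4 - c * (g (- 1 / z) / z ^ 4)) \<longlongrightarrow> 0 - c * 0) (filtercomap Im at_top)"
    using f g unfolding level11_form_def by (intro tendsto_intros) auto
  then show "((\<lambda>z. (f (- 1 / z) - c * g (- 1 / z)) / z ^ 4) \<longlongrightarrow> 0) (filtercomap Im at_top)"
    by (simp add: diff_divide_distrib)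
qed

lemma hecke_operator_4_11_2:
  "hecke_operator 4 11 2 f z = 8 * f (2 * z) + (f (z / 2) + f ((z + 1) / 2)) / 2"
proof -
  have "d = 1 \<or> d = 2" if "d dvd 2" for d :: nat
    using dvd_imp_le[OF that] that by (cases "d = 0") auto
  then have "{d :: nat. d dvd 2 \<and> coprime (2 div d) 11} = {1, 2}"
    by (auto simp: coprime_commute)
  moreover have "coprime (2 :: nat) 11" by (simp add: coprime_left_2_iff_odd)
  ultimately show ?thesis
    by (simp add: hecke_operator_def numeral_2_eq_2 lessThan_Suc power_int_def)
qed

text \<open>Written in terms of \<open>p = nome (z / 2)\<close>, the eigenvalue equation is an identity of power series.\<close>

lemma hecke_eigenform_coeff_4:
  assumes eig: "hecke_eigenform 4 11 f" and exp: "fourier_expansion f a" and a1: "a 1 = 1"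
  shows "a 4 = a 2 ^ 2 - 8"
proof -
  define F where "F = Abs_fps a"
  have F: "fps_conv_radius F \<ge> 1" and fF: "\<And>z. Im z > 0 \<Longrightarrow> f z = eval_fps F (nome z)"
    using fourier_expansion_fps[OF exp] by (simp_all add: F_def)
  obtain c where c: "\<And>z. Im z > 0 \<Longrightarrow> hecke_operator 4 11 2 f z = c * f z"
  proof -
    have "\<exists>c. \<forall>z\<in>upper_half_plane. hecke_operator 4 11 2 f z = c * f z"
      using eig unfolding hecke_eigenform_def by (meson zero_less_numeral)
    then show ?thesis using that by (auto simp: upper_half_plane_def)
  qed
  \<comment> \<open>The translate by 1/2 changes the sign of the nome, so adding it doubles the even
    coefficients and removes the odd ones.\<close>
  define N where "N = Abs_fps (\<lambda>n. (- 1) ^ n * a n)"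
  have N_sums: "(\<lambda>n. fps_nth N n * q ^ n) sums eval_fps F (- q)" if "norm q < 1" for q
  proof -
    have "(\<lambda>n. fps_nth F n * (- q) ^ n) sums eval_fps F (- q)"
      by (rule sums_eval_fps) (use norm_less_conv_radius[OF _ F, of "- q"] that in simp)
    moreover have "fps_nth F n * (- q) ^ n = fps_nth N n * q ^ n" for n
      by (simp add: F_def N_def power_minus[of q] mult_ac)
    ultimately show ?thesis by simp
  qed
  have N: "fps_conv_radius N \<ge> 1"
    by (rule sums_imp_conv_radius) (use N_sums in \<open>auto simp: sums_iff\<close>)
  have eN: "eval_fps N q = eval_fps F (- q)" if "norm q < 1" for q
    using N_sums[OF that] by (simp add: eval_fps_def sums_iff)
  have "fps_const 8 * fps_stretch 4 F + fps_const (1 / 2) * (F + N) = fps_const c * fps_stretch 2 F"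
  proof (rule fps_eqI_nome)
    show "fps_conv_radius (fps_const 8 * fps_stretch 4 F + fps_const (1 / 2) * (F + N)) \<ge> 1"
      "fps_conv_radius (fps_const c * fps_stretch 2 F) \<ge> 1"
      by (intro conv_radius_ge_1_intros conv_radius_ge_1_stretch F N; simp)+
    fix v assume v: "Im (v :: complex) > 0"
    define p where "p = nome v"
    have p: "norm p < 1" unfolding p_def by (rule norm_nome_less_1[OF v])
    note r = norm_less_conv_radius[OF p]
    have "nome (v + 1 / 2) = nome v * exp (pi * \<i>)"
      unfolding exp_add[symmetric] by (simp add: algebra_simps)
    then have "nome (v + 1 / 2) = - p" by (simp add: p_def)
    then have "f (v + 1 / 2) = eval_fps N p" using fF[of "v + 1 / 2"] v eN[OF p] by simp
    moreover have "f (4 * v) = eval_fps (fps_stretch 4 F) p" "f (2 * v) = eval_fps (fps_stretch 2 F) p"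
      using fF[of "4 * v"] fF[of "2 * v"] v nome_mult_nat[of 4 v] nome_mult_nat[of 2 v]
        eval_fps_stretch[OF _ F p, of 4] eval_fps_stretch[OF _ F p, of 2] by (simp_all add: p_def)
    moreover have "8 * f (4 * v) + (f v + f (v + 1 / 2)) / 2 = c * f (2 * v)"
      using c[of "2 * v"] v by (simp add: hecke_operator_4_11_2 add_divide_distrib)
    ultimately have "8 * eval_fps (fps_stretch 4 F) p + (eval_fps F p + eval_fps N p) / 2
        = c * eval_fps (fps_stretch 2 F) p"
      using fF[OF v] by (simp add: p_def)
    then show "eval_fps (fps_const 8 * fps_stretch 4 F + fps_const (1 / 2) * (F + N)) (nome v)
        = eval_fps (fps_const c * fps_stretch 2 F) (nome v)"
      unfolding p_def[symmetric]
      by (simp add: eval_fps_add eval_fps_mult r F N conv_radius_ge_1_intros conv_radius_ge_1_stretch)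
  qed
  then have eq: "fps_nth (fps_const 8 * fps_stretch 4 F + fps_const (1 / 2) * (F + N)) n
      = fps_nth (fps_const c * fps_stretch 2 F) n" for n by simp
  \<comment> \<open>In the variable p, index 2 belongs to the first coefficient of \<open>f\<close>
    and gives the eigenvalue; index 4 then reads 8 a_1 + a_4 = a_2^2.\<close>
  have "c = a 2" using eq[of 2] a1 by (simp add: fps_stretch_def F_def N_def)
  then show ?thesis using eq[of 4] a1 by (simp add: fps_stretch_def F_def N_def power2_eq_square algebra_simps)
qed

lemma primitive_form_properties:
  assumes prim: "primitive_form 4 11 f" and exp: "fourier_expansion f a"
  shows "level11_form f" "a 0 = 0" "a 1 = 1" "a 4 = a 2 ^ 2 - 8"
proof -
  note E = fourier_expansion_fps[OF exp]
  have cusp: "cusp_form 4 11 f" and eig: "hecke_eigenform 4 11 f"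
    and ex: "\<exists>b. fourier_expansion f b \<and> b 1 = 1"
    using prim unfolding primitive_form_def in_new_subspace_def by blast+
  show "level11_form f" by (rule cusp_form_imp_level11_form[OF cusp])
  have "((\<lambda>z. eval_fps (Abs_fps a) (nome z)) \<longlongrightarrow> fps_nth (Abs_fps a) 0) (filtercomap Im at_top)"
    by (rule eval_fps_nome_tendsto[OF E(1) filterlim_ident])
  then have "((\<lambda>z. eval_fps (Abs_fps a) (nome z)) \<longlongrightarrow> a 0) (filtercomap Im at_top)" by simp
  then have "(f \<longlongrightarrow> a 0) (filtercomap Im at_top)"
    by (rule tendsto_cong[THEN iffD1, rotated]) (use eventually_Im_pos E(2) in \<open>auto elim: eventually_mono\<close>)
  then show "a 0 = 0"
    using cusp_form_imp_level11_form(2)[OF cusp] tendsto_unique[OF filtercomap_Im_nontrivial] by blast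
  \<comment> \<open>The normalisation is known for some expansion of \<open>f\<close>; uniqueness
    transfers it to the given one.\<close>
  obtain b where b: "fourier_expansion f b" "b 1 = 1" using ex by blast
  have "Abs_fps a = Abs_fps b"
    by (rule fps_eqI_nome) (use E fourier_expansion_fps[OF b(1)] in auto)
  then have "fps_nth (Abs_fps a) 1 = fps_nth (Abs_fps b) 1" by simp
  then show a1: "a 1 = 1" using b(2) by simp
  show "a 4 = a 2 ^ 2 - 8" by (rule hecke_eigenform_coeff_4[OF eig exp a1])
qed

section \<open>An explicit cusp form\<close>

text \<open>The Eisenstein series of weight 2 for level 11: in this combination the inhomogeneous
  terms of \<open>E2\<close> cancel, and 10 normalises the constant term to 1.\<close>

definition L2 :: "complex \<Rightarrow> complex" where
  "L2 z = (11 * E2 (11 * z) - E2 z) / 10"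

text \<open>The coefficients of the two Eisenstein series make \<open>C4\<close> vanish at both cusps.\<close>

definition C4 :: "complex \<Rightarrow> complex" where
  "C4 z = L2 z ^ 2 - E4 z / 122 - 121 / 122 * E4 (11 * z)"

definition L2_fps :: "complex fps" where
  "L2_fps = 1 + fps_const (12 / 5) * (sigma_fps 1 - fps_const 11 * fps_stretch 11 (sigma_fps 1))"

definition C4_fps :: "complex fps" where
  "C4_fps = L2_fps ^ 2 - fps_const (1 / 122) * (1 + fps_const 240 * sigma_fps 3)
    - fps_const (121 / 122) * (1 + fps_const 240 * fps_stretch 11 (sigma_fps 3))"

lemmas sigma_radius_intros = conv_radius_ge_1_intros fps_conv_radius_sigma
  conv_radius_ge_1_stretch[OF _ fps_conv_radius_sigma, of 11, simplified]

lemma fps_conv_radius_C4: "fps_conv_radius L2_fps \<ge> 1" "fps_conv_radius C4_fps \<ge> 1"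
  unfolding L2_fps_def C4_fps_def by (intro sigma_radius_intros)+

lemma C4_eq_eval:
  assumes z: "Im z > 0"
  shows "C4 z = eval_fps C4_fps (nome z)"
proof -
  define q where "q = nome z"
  have q: "norm q < 1" unfolding q_def by (rule norm_nome_less_1[OF z])
  note r = norm_less_conv_radius[OF q]
  have q11: "nome (11 * z) = q ^ 11" using nome_mult_nat[of 11 z] by (simp add: q_def)
  have st: "eval_fps (fps_stretch 11 (sigma_fps j)) q = eval_fps (sigma_fps j) (q ^ 11)" for j
    using eval_fps_stretch[OF _ fps_conv_radius_sigma q, of 11] by simp
  have eL: "eval_fps L2_fps q = 1 + 12 / 5 * (eval_fps (sigma_fps 1) q - 11 * eval_fps (sigma_fps 1) (q ^ 11))"
    unfolding L2_fps_def by (simp add: eval_fps_add eval_fps_diff eval_fps_mult r sigma_radius_intros st)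
  have L: "eval_fps L2_fps q = L2 z"
    unfolding eL L2_def E2_def q11 q_def[symmetric] by (simp add: field_simps)
  have "eval_fps C4_fps q = eval_fps L2_fps q ^ 2 - 1 / 122 * (1 + 240 * eval_fps (sigma_fps 3) q)
      - 121 / 122 * (1 + 240 * eval_fps (sigma_fps 3) (q ^ 11))"
    unfolding C4_fps_def
    by (simp add: eval_fps_add eval_fps_diff eval_fps_mult eval_fps_power r sigma_radius_intros fps_conv_radius_C4 st)
  then show ?thesis
    using E4_eq[OF z] E4_eq[of "11 * z"] z unfolding C4_def L q11 q_def[symmetric] by simp
qed

lemma L2_modular:
  assumes det: "a * d - b * c = 1" and c: "11 dvd c" and z: "Im z > 0"
  shows "L2 (moeb a b c d z) = (of_int c * z + of_int d) ^ 2 * L2 z"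
proof -
  obtain c' where c': "c = 11 * c'" using c by blast
  define j where "j = of_int c * z + of_int d"
  define P where "P = 2 * of_real pi * \<i>"
  have P0: "P \<noteq> 0" by (simp add: P_def)
  have 1: "P * E2 (moeb a b c d z) = P * E2 z * j\<^sup>2 + 12 * of_int c * j"
    unfolding P_def j_def by (rule E2_modular[OF det z])
  have "2 * of_real pi * \<i> * E2 (moeb a (11 * b) c' d (11 * z)) =
      2 * of_real pi * \<i> * E2 (11 * z) * (of_int c' * (11 * z) + of_int d)\<^sup>2
        + 12 * of_int c' * (of_int c' * (11 * z) + of_int d)"
    by (rule E2_modular) (use det z in \<open>auto simp: c'\<close>)
  moreover have "of_int c' * (11 * z) + of_int d = j" by (simp add: j_def c')
  ultimately have 2: "P * E2 (11 * moeb a b c d z) = P * E2 (11 * z) * j\<^sup>2 + 12 * of_int c' * j"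
    unfolding moeb_times_11[OF c'] P_def by simp
  \<comment> \<open>Since c = 11 c', both parts carry the same inhomogeneous term 12 c j.\<close>
  have "P * (11 * E2 (11 * moeb a b c d z) - E2 (moeb a b c d z))
      = 11 * (P * E2 (11 * moeb a b c d z)) - P * E2 (moeb a b c d z)"
    by (simp add: algebra_simps)
  also have "\<dots> = P * (j\<^sup>2 * (11 * E2 (11 * z) - E2 z))"
    unfolding 1 2 by (simp add: c' algebra_simps)
  finally show ?thesis using P0 by (simp add: L2_def j_def)
qed

lemma E4_11_modular:
  assumes det: "a * d - b * c = 1" and c: "11 dvd c" and z: "Im z > 0"
  shows "E4 (11 * moeb a b c d z) = (of_int c * z + of_int d) ^ 4 * E4 (11 * z)"
proof -
  obtain c' where c': "c = 11 * c'" using c by blast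
  have "E4 (moeb a (11 * b) c' d (11 * z)) = (of_int c' * (11 * z) + of_int d) ^ 4 * E4 (11 * z)"
    by (rule E4_modular) (use det z in \<open>auto simp: c'\<close>)
  then show ?thesis unfolding moeb_times_11[OF c'] by (simp add: c' mult_ac)
qed

lemma E4_S:
  assumes z: "Im z > 0"
  shows "E4 (- 1 / z) = z ^ 4 * E4 z"
  using E4_modular[of 0 0 "-1" 1 z] z by (simp add: moeb_def)

text \<open>Because 11 (- 1 / z) = - 1 / (z / 11), the laws at z and at z / 11 express the behaviour
  near the cusp 0 through functions whose limits at infinity are known.\<close>

lemma C4_S:
  assumes z: "Im z > 0"
  shows "C4 (- 1 / z) / z ^ 4 = ((E2 (z / 11) / 11 - E2 z) / 10) ^ 2 - E4 z / 122 - E4 (z / 11) / (122 * 121)"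
proof -
  have z0: "z \<noteq> 0" using z by auto
  have z11: "Im (z / 11) > 0" using z by simp
  have e: "11 * (- 1 / z) = - 1 / (z / 11)" by simp
  have L: "L2 (- 1 / z) = z ^ 2 * ((E2 (z / 11) / 11 - E2 z) / 10)"
  proof -
    have "11 * ((z / 11)\<^sup>2 * A - 6 * \<i> * (z / 11) / P) - (z\<^sup>2 * B - 6 * \<i> * z / P) = z\<^sup>2 * (A / 11 - B)" for A B P
      by (simp add: power2_eq_square algebra_simps)
    then show ?thesis unfolding L2_def e E2_S[OF z] E2_S[OF z11] by simp
  qed
  have E: "E4 (11 * (- 1 / z)) = z ^ 4 / 14641 * E4 (z / 11)"
    unfolding e E4_S[OF z11] by (simp add: power_divide)
  define X where "X = (E2 (z / 11) / 11 - E2 z) / 10"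
  have "C4 (- 1 / z) = z ^ 4 * (X ^ 2 - E4 z / 122 - E4 (z / 11) / (122 * 121))"
    unfolding C4_def E4_S[OF z] L E X_def[symmetric] by (simp add: power_mult_distrib algebra_simps flip: power_mult)
  then show ?thesis unfolding X_def[symmetric] using z0 by simp
qed

lemma E2_E4_tendsto_1:
  assumes u: "filterlim u (filtercomap Im at_top) (filtercomap Im at_top)"
  shows "((\<lambda>z. E2 (u z)) \<longlongrightarrow> 1) (filtercomap Im at_top)" "((\<lambda>z. E4 (u z)) \<longlongrightarrow> 1) (filtercomap Im at_top)"
proof -
  have s: "((\<lambda>z. eval_fps (sigma_fps j) (nome (u z))) \<longlongrightarrow> 0) (filtercomap Im at_top)" for j
    using eval_fps_nome_tendsto[OF fps_conv_radius_sigma u, of j] by (simp add: sigma_fps_def)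
  have "((\<lambda>z. 1 - 24 * eval_fps (sigma_fps 1) (nome (u z))) \<longlongrightarrow> 1 - 24 * 0) (filtercomap Im at_top)"
    by (intro tendsto_intros s)
  then show "((\<lambda>z. E2 (u z)) \<longlongrightarrow> 1) (filtercomap Im at_top)" by (simp add: E2_def[abs_def])
  have "((\<lambda>z. 1 + 240 * eval_fps (sigma_fps 3) (nome (u z))) \<longlongrightarrow> 1 + 240 * 0) (filtercomap Im at_top)"
    by (intro tendsto_intros s)
  moreover have "\<forall>\<^sub>F z in filtercomap Im at_top. Im (u z) > 0"
    using u eventually_Im_pos by (auto simp: filterlim_iff)
  then have "\<forall>\<^sub>F z in filtercomap Im at_top. 1 + 240 * eval_fps (sigma_fps 3) (nome (u z)) = E4 (u z)"
    by eventually_elim (simp add: E4_eq)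
  ultimately show "((\<lambda>z. E4 (u z)) \<longlongrightarrow> 1) (filtercomap Im at_top)"
    by (auto dest: tendsto_cong)
qed

lemma level11_form_C4: "level11_form C4"
  unfolding level11_form_def
proof (intro conjI allI impI)
  show "C4 holomorphic_on {z. Im z > 0}"
    using holomorphic_eval_fps_nome[OF fps_conv_radius_C4(2)]
    by (rule holomorphic_transform) (simp add: C4_eq_eval)
  show "C4 (moeb a b c d z) = (of_int c * z + of_int d) ^ 4 * C4 z"
    if "a * d - b * c = 1 \<and> 11 dvd c \<and> Im z > 0" for a b c d z
    using that unfolding C4_def
    by (simp add: L2_modular E4_modular E4_11_modular power_mult_distrib algebra_simps flip: power_mult)
  \<comment> \<open>The limit vanishes because (- 1/11)^2 = 1/121 = (1 + 1/121) / 122.\<close>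
  have "((\<lambda>z. ((E2 (z / 11) / 11 - E2 z) / 10) ^ 2 - E4 z / 122 - E4 (z / 11) / (122 * 121))
      \<longlongrightarrow> ((1 / 11 - 1) / 10) ^ 2 - 1 / 122 - 1 / (122 * 121)) (filtercomap Im at_top)"
    using filterlim_Im_scale[of "1 / 11"]
    by (intro tendsto_intros E2_E4_tendsto_1 filterlim_ident) auto
  then have "((\<lambda>z. ((E2 (z / 11) / 11 - E2 z) / 10) ^ 2 - E4 z / 122 - E4 (z / 11) / (122 * 121)) \<longlongrightarrow> 0) (filtercomap Im at_top)"
    by (simp add: power2_eq_square)
  then show "((\<lambda>z. C4 (- 1 / z) / z ^ 4) \<longlongrightarrow> 0) (filtercomap Im at_top)"
    by (rule tendsto_cong[THEN iffD1, rotated]) (use eventually_Im_pos C4_S in \<open>auto elim: eventually_mono\<close>)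
qed


section \<open>The convolution sum\<close>

lemma divisor_sigma_sum: "n > 0 \<Longrightarrow> divisor_sigma j n = (\<Sum>d=1..n. if d dvd n then d ^ j else 0)"
  unfolding divisor_sigma_def
  by (subst sum.inter_filter[symmetric]) (auto intro!: sum.cong Nat.gr0I dest: dvd_imp_le simp: Suc_le_eq)

lemma divisor_sigma_values:
  "divisor_sigma j 1 = 1" "divisor_sigma j 2 = 1 + 2 ^ j"
  "divisor_sigma j 3 = 1 + 3 ^ j" "divisor_sigma j 4 = 1 + 2 ^ j + 4 ^ j"
proof -
  have "{1..1::nat} = {1}" "{1..2::nat} = {1, 2}" "{1..3::nat} = {1, 2, 3}" "{1..4::nat} = {1, 2, 3, 4}" by auto
  then show "divisor_sigma j 1 = 1" "divisor_sigma j 2 = 1 + 2 ^ j"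
    "divisor_sigma j 3 = 1 + 3 ^ j" "divisor_sigma j 4 = 1 + 2 ^ j + 4 ^ j"
    by (simp_all add: divisor_sigma_sum del: One_nat_def)
qed

text \<open>The stretched series contribute nothing below index 11, so divisor sums up to index 4
  suffice.\<close>

lemma C4_fps_coeffs:
  "fps_nth C4_fps 0 = 0" "fps_nth C4_fps 1 = 864 / 305"
  "fps_nth C4_fps 2 = 3744 / 1525" "fps_nth C4_fps 4 = - 18432 / 1525"
proof -
  have L: "fps_nth L2_fps 0 = 1" "fps_nth L2_fps 1 = 12 / 5" "fps_nth L2_fps 2 = 36 / 5"
    "fps_nth L2_fps 3 = 48 / 5" "fps_nth L2_fps 4 = 84 / 5"
    using divisor_sigma_values[of 1]
    by (simp_all add: L2_fps_def sigma_fps_def fps_stretch_def)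
  have sets: "{0..4::nat} = {0, 1, 2, 3, 4}" "{0..2::nat} = {0, 1, 2}" "{0..1::nat} = {0, 1}" by auto
  have sq: "fps_nth (L2_fps ^ 2) 0 = 1" "fps_nth (L2_fps ^ 2) 1 = 24 / 5"
    "fps_nth (L2_fps ^ 2) 2 = 504 / 25" "fps_nth (L2_fps ^ 2) 4 = 3288 / 25"
    by (simp_all add: L L(2)[unfolded One_nat_def] sets power2_eq_square fps_mult_nth del: One_nat_def)
  show "fps_nth C4_fps 0 = 0" "fps_nth C4_fps 1 = 864 / 305"
    "fps_nth C4_fps 2 = 3744 / 1525" "fps_nth C4_fps 4 = - 18432 / 1525"
    using divisor_sigma_values[of 3]
    by (simp_all add: sq sq(2)[unfolded One_nat_def] C4_fps_def sigma_fps_def fps_stretch_def)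
qed

lemma divisor_sigma_ext_div:
  assumes "n > 0"
  shows "divisor_sigma_ext j (of_nat n / 11) = (if 11 dvd n then divisor_sigma j (n div 11) else 0)"
proof (cases "11 dvd n")
  case True
  then obtain k where k: "n = 11 * k" by blast
  then have "of_nat n / 11 = (of_nat k :: rat)" "k > 0" using assms by simp_all
  then show ?thesis using k by (simp add: divisor_sigma_ext_def)
next
  case False
  have "(of_nat n / 11 :: rat) \<notin> \<nat>"
  proof
    assume "(of_nat n / 11 :: rat) \<in> \<nat>"
    then obtain k where "of_nat n / 11 = (of_nat k :: rat)" by (auto elim: Nats_cases)
    then have "(of_nat n :: rat) = of_nat (11 * k)" by (simp add: field_simps)
    then have "n = 11 * k" by (simp only: of_nat_eq_iff)
    with False show False by simp
  qed
  then show ?thesis using False by (simp add: divisor_sigma_ext_def)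
qed

lemma fps_nth_sigma_stretch_mult:
  assumes "n > 0"
  shows "fps_nth (fps_stretch 11 (sigma_fps 1) * sigma_fps 1) n = of_nat (conv_W 11 n)"
proof -
  let ?M = "{m. 0 < m \<and> 11 * m < n}"
  have "fps_nth (fps_stretch 11 (sigma_fps 1) * sigma_fps 1) n
      = (\<Sum>i=0..n. fps_nth (fps_stretch 11 (sigma_fps 1)) i * of_nat (divisor_sigma 1 (n - i)))"
    by (simp add: fps_mult_nth sigma_fps_def)
  also have "\<dots> = (\<Sum>i\<in>(\<lambda>m. 11 * m) ` ?M. fps_nth (fps_stretch 11 (sigma_fps 1)) i * of_nat (divisor_sigma 1 (n - i)))"
  proof (rule sum.mono_neutral_right)
    show "\<forall>i\<in>{0..n} - (\<lambda>m. 11 * m) ` ?M. fps_nth (fps_stretch 11 (sigma_fps 1)) i * of_nat (divisor_sigma 1 (n - i)) = 0"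
    proof
      fix i assume i: "i \<in> {0..n} - (\<lambda>m. 11 * m) ` ?M"
      show "fps_nth (fps_stretch 11 (sigma_fps 1)) i * of_nat (divisor_sigma 1 (n - i)) = 0"
      proof (cases "11 dvd i")
        case True
        then obtain m where m: "i = 11 * m" by blast
        with i have "m = 0 \<or> i = n" by auto
        then show ?thesis by (auto simp: m fps_stretch_def sigma_fps_def)
      qed (simp add: fps_stretch_def)
    qed
  qed auto
  also have "\<dots> = of_nat (conv_W 11 n)"
    by (subst sum.reindex) (auto simp: inj_on_def conv_W_def fps_stretch_def sigma_fps_def)
  finally show ?thesis .
qed

lemma fps_nth_sigma_square: "fps_nth (sigma_fps 1 * sigma_fps 1) n = of_nat (conv_W 1 n)"
  unfolding conv_W_cauchy[symmetric] by (simp add: fps_mult_nth sigma_fps_def)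

text \<open>The mixed term in the square of \<open>L2_fps\<close> is the convolution sum sought, and
  \<open>conv_W_1\<close> evaluates the two pure squares. The factor 25 clears the denominators of
  that square, 61 those of 240 / 122.\<close>

lemma fps_nth_C4:
  assumes n: "n > 0"
  defines "s \<equiv> \<lambda>j. of_nat (divisor_sigma j n)" and "s' \<equiv> \<lambda>j. of_nat (divisor_sigma_ext j (of_nat n / 11))"
  shows "25 * 61 * fps_nth C4_fps n = 732 * (5 * s 3 - (6 * of_nat n - 1) * s 1)
    + 732 * (605 * s' 3 - 11 * (6 * of_nat n - 11) * s' 1)
    - 193248 * of_nat (conv_W 11 n) + 7320 * (s 1 - 11 * s' 1) - 3000 * s 3 - 363000 * s' 3"
proof -
  define S where "S = sigma_fps 1"
  define T where "T = fps_stretch 11 S"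
  have rS: "fps_conv_radius S \<ge> 1" unfolding S_def by (rule fps_conv_radius_sigma)
  have "5 * L2_fps = 5 + 12 * (S - 11 * T)"
    by (rule fps_ext) (simp add: L2_fps_def T_def S_def fps_numeral_nth distrib_left right_diff_distrib)
  then have "(5 * L2_fps) ^ 2 = (5 + 12 * (S - 11 * T)) ^ 2" by simp
  then have "25 * L2_fps ^ 2 = 25 + 120 * (S - 11 * T) + 144 * (S * S - 22 * (T * S) + 121 * (T * T))"
    by (simp add: power2_eq_square algebra_simps)
  then have "fps_nth (25 * L2_fps ^ 2) n
      = fps_nth (25 + 120 * (S - 11 * T) + 144 * (S * S - 22 * (T * S) + 121 * (T * T))) n" by simp
  then have L: "25 * fps_nth (L2_fps ^ 2) n = 120 * (fps_nth S n - 11 * fps_nth T n)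
      + 144 * (fps_nth (S * S) n - 22 * fps_nth (T * S) n + 121 * fps_nth (T * T) n)"
    using n by (simp add: fps_numeral_nth)
  have ext: "divisor_sigma_ext j (of_nat n / 11) = (if 11 dvd n then divisor_sigma j (n div 11) else 0)" for j
    by (rule divisor_sigma_ext_div[OF n])
  have 1: "fps_nth S n = s 1" "fps_nth T n = s' 1" "fps_nth (T * S) n = of_nat (conv_W 11 n)"
    using fps_nth_sigma_stretch_mult[OF n]
    by (simp_all add: S_def T_def s_def s'_def ext fps_stretch_def sigma_fps_def)
  have W1: "12 * of_nat (conv_W 1 m) = 5 * of_nat (divisor_sigma 3 m) - (6 * of_nat m - 1) * (of_nat (divisor_sigma 1 m) :: complex)"
    if "m > 0" for m
  proof -
    have "(of_int (12 * int (conv_W 1 m)) :: complex)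
        = of_int (5 * int (divisor_sigma 3 m) - (6 * int m - 1) * int (divisor_sigma 1 m))"
      by (subst conv_W_1[OF that]) (rule refl)
    then show ?thesis by simp
  qed
  have 2: "12 * fps_nth (S * S) n = 5 * s 3 - (6 * of_nat n - 1) * s 1"
    unfolding S_def fps_nth_sigma_square s_def by (rule W1[OF n])
  have 3: "12 * (121 * fps_nth (T * T) n) = 605 * s' 3 - 11 * (6 * of_nat n - 11) * s' 1"
  proof (cases "11 dvd n")
    case True
    then obtain k where k: "n = 11 * k" by blast
    with n have "k > 0" by simp
    have "fps_nth (T * T) n = of_nat (conv_W 1 k)"
      unfolding T_def fps_stretch_mult[OF _ rS rS, of 11, simplified, symmetric]
      using fps_nth_sigma_square[of k] by (simp add: fps_stretch_def k S_def)
    then have "12 * (121 * fps_nth (T * T) n) = 121 * (12 * of_nat (conv_W 1 k))" by simp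
    moreover have "s' j = of_nat (divisor_sigma j k)" for j unfolding s'_def ext by (simp add: k)
    moreover have "of_nat n = (11 * of_nat k :: complex)" by (simp add: k)
    ultimately show ?thesis unfolding W1[OF \<open>k > 0\<close>] by (simp add: algebra_simps)
  next
    case False
    then show ?thesis
      unfolding T_def fps_stretch_mult[OF _ rS rS, of 11, simplified, symmetric]
      by (simp add: fps_stretch_def s'_def ext)
  qed
  have C: "fps_nth C4_fps n = fps_nth (L2_fps ^ 2) n - 240 / 122 * s 3 - 121 * 240 / 122 * s' 3"
    using n by (simp add: C4_fps_def s_def s'_def ext fps_stretch_def sigma_fps_def)
  have "25 * 61 * fps_nth C4_fps n = 61 * (25 * fps_nth (L2_fps ^ 2) n) - 3000 * s 3 - 363000 * s' 3"
    unfolding C by (simp add: algebra_simps)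
  also have "61 * (25 * fps_nth (L2_fps ^ 2) n) = 7320 * (s 1 - 11 * s' 1)
      + 732 * (12 * fps_nth (S * S) n) - 193248 * of_nat (conv_W 11 n) + 732 * (12 * (121 * fps_nth (T * T) n))"
    unfolding L 1 by (simp add: algebra_simps)
  finally show ?thesis unfolding 2 3 by (simp add: algebra_simps)
qed

theorem theorem2:
  fixes t :: complex
    and \<Delta>1 \<Delta>2 :: "complex \<Rightarrow> complex"
    and \<tau>1 \<tau>2 :: "nat \<Rightarrow> complex"
    and n :: nat
  assumes "t\<^sup>2 - 2 * t - 2 = 0"
    and "primitive_form 4 11 \<Delta>1" and "fourier_expansion \<Delta>1 \<tau>1" and "\<tau>1 2 = 2 - t"
    and "primitive_form 4 11 \<Delta>2" and "fourier_expansion \<Delta>2 \<tau>2" and "\<tau>2 2 = t"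
    and "n > 0"
  shows "of_nat (conv_W 11 n) =
      5 / 1464 * of_nat (divisor_sigma 3 n)
    + 605 / 1464 * of_nat (divisor_sigma_ext 3 (of_nat n / 11))
    - 1 / 44 * of_nat n * of_nat (divisor_sigma 1 n)
    - 1 / 4 * of_nat n * of_nat (divisor_sigma_ext 1 (of_nat n / 11))
    + 1 / 24 * of_nat (divisor_sigma 1 n)
    + 1 / 24 * of_nat (divisor_sigma_ext 1 (of_nat n / 11))
    - (2 * t + 43) / 4026 * \<tau>1 n
    + (2 * t - 47) / 4026 * \<tau>2 n"
proof -
  have t2: "t * t = 2 * t + 2" using assms(1) by (simp add: power2_eq_square algebra_simps)
  note P1 = primitive_form_properties[OF assms(2,3)] and P2 = primitive_form_properties[OF assms(5,6)]
  note E1 = fourier_expansion_fps[OF assms(3)] and E2 = fourier_expansion_fps[OF assms(6)]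
  \<comment> \<open>The solution of the linear system matching indices 1 and 2: \<gamma> + \<delta>
    = 864 / 305 and \<gamma> (2 - t) + \<delta> t = 3744 / 1525. That index 4 matches as well is the
    remaining check.\<close>
  define \<gamma> \<delta> where "\<gamma> = 48 / 1525 * (2 * t + 43)" and "\<delta> = - (48 / 1525) * (2 * t - 47)"
  define F where "F = C4_fps - fps_const \<gamma> * Abs_fps \<tau>1 - fps_const \<delta> * Abs_fps \<tau>2"
  have \<gamma>\<delta>: "\<gamma> * x + \<delta> * y = 48 / 1525 * ((2 * t + 43) * x - (2 * t - 47) * y)" for x y
  proof -
    have "k * a * x + - k * b * y = k * (a * x - b * y)" for k a b by (simp add: algebra_simps)
    then show ?thesis unfolding \<gamma>_def \<delta>_def .
  qed
  have "F = 0"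
  proof (rule level11_form_eq_0)
    show "level11_form (\<lambda>z. (C4 z - \<gamma> * \<Delta>1 z) - \<delta> * \<Delta>2 z)"
      by (intro level11_form_diff_cmult level11_form_C4 P1(1) P2(1))
    show "fps_conv_radius F \<ge> 1"
      unfolding F_def by (intro conv_radius_ge_1_intros fps_conv_radius_C4 E1(1) E2(1))
    fix z :: complex assume z: "Im z > 0"
    define q where "q = nome z"
    have q: "norm q < 1" unfolding q_def by (rule norm_nome_less_1[OF z])
    show "(C4 z - \<gamma> * \<Delta>1 z) - \<delta> * \<Delta>2 z = eval_fps F (nome z)"
      unfolding F_def C4_eq_eval[OF z] E1(2)[OF z] E2(2)[OF z] q_def[symmetric]
      by (simp add: eval_fps_diff eval_fps_mult norm_less_conv_radius[OF q] conv_radius_ge_1_intros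
          fps_conv_radius_C4 E1(1) E2(1))
  next
    show "fps_nth F 0 = 0" using P1(2) P2(2) by (simp add: F_def C4_fps_coeffs)
    show "fps_nth F 1 = 0" using P1(3) P2(3) by (simp add: F_def C4_fps_coeffs(2)[unfolded One_nat_def] \<gamma>_def \<delta>_def field_simps)
    have "(2 * t + 43) * (2 - t) - (2 * t - 47) * t = 86 + 8 * t - 4 * (t * t)"
      by (simp add: algebra_simps)
    also have "\<dots> = 78" unfolding t2 by simp
    finally have e2: "\<gamma> * (2 - t) + \<delta> * t = 48 / 1525 * 78"
      unfolding \<gamma>\<delta> by (rule arg_cong)
    have "fps_nth F 2 = 3744 / 1525 - (\<gamma> * (2 - t) + \<delta> * t)"
      by (simp add: F_def C4_fps_coeffs assms(4,7))
    \<comment> \<open>Below, the Hecke relation and the equation of t give the coefficients of index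
      4 as linear expressions in t.\<close>
    then show "fps_nth F 2 = 0" unfolding e2 by simp
    have "(2 - t)\<^sup>2 - 8 = t * t - 4 * t - 4" by (simp add: power2_eq_square algebra_simps)
    then have a1: "\<tau>1 4 = - 2 * t - 2" unfolding P1(4) assms(4) t2 by simp
    have a2: "\<tau>2 4 = 2 * t - 6" unfolding P2(4) assms(7) power2_eq_square t2 by simp
    have "(2 * t + 43) * (- 2 * t - 2) - (2 * t - 47) * (2 * t - 6) = 16 * t - 368 - 8 * (t * t)"
      by (simp add: algebra_simps)
    also have "\<dots> = - 384" unfolding t2 by simp
    finally have e4: "\<gamma> * (- 2 * t - 2) + \<delta> * (2 * t - 6) = 48 / 1525 * (- 384)"
      unfolding \<gamma>\<delta> by (rule arg_cong)
    have "fps_nth F 4 = - 18432 / 1525 - (\<gamma> * (- 2 * t - 2) + \<delta> * (2 * t - 6))"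
      by (simp add: F_def C4_fps_coeffs a1 a2)
    then show "fps_nth F 4 = 0" unfolding e4 by simp
  qed
  then have "fps_nth F n = 0" by simp
  then have C: "fps_nth C4_fps n = \<gamma> * \<tau>1 n + \<delta> * \<tau>2 n"
    by (simp add: F_def diff_eq_eq add.commute)
  define X Y where "X = (2 * t + 43) * \<tau>1 n" and "Y = (2 * t - 47) * \<tau>2 n"
  have "25 * 61 * fps_nth C4_fps n = 48 * (X - Y)"
    unfolding C \<gamma>\<delta> X_def Y_def by simp
  \<comment> \<open>The equation is linear in w with coefficient 193248 = 48 * 4026, which is where
    the denominators 4026 come from.\<close>
  moreover have "w = 5 / 1464 * A + 605 / 1464 * B - 1 / 44 * m * a - 1 / 4 * m * b + 1 / 24 * a + 1 / 24 * b - X / 4026 + Y / 4026"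
    if "732 * (5 * A - (6 * m - 1) * a) + 732 * (605 * B - 11 * (6 * m - 11) * b)
      - 193248 * w + 7320 * (a - 11 * b) - 3000 * A - 363000 * B = 48 * (X - Y)" for w A B a b m :: complex
  proof -
    have "193248 * w = 660 * A + 79860 * B - 4392 * (m * a) - 48312 * (m * b) + 8052 * a + 8052 * b - 48 * X + 48 * Y"
      using that by (simp add: algebra_simps)
    then have "w = (660 * A + 79860 * B - 4392 * (m * a) - 48312 * (m * b) + 8052 * a + 8052 * b - 48 * X + 48 * Y) / 193248"
      by (simp add: nonzero_eq_divide_eq mult.commute)
    then show ?thesis by (simp add: add_divide_distrib diff_divide_distrib mult.commute)
  qed
  ultimately show ?thesis
    unfolding fps_nth_C4[OF assms(8)] X_def Y_def by simp
qed

end
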